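(* Let $q\geq 2$ be an integer, and assume that $F=I_q(f)$, where $f\in\mathfrak{H}^{\odot q}$. Denote by $\kappa_s(F)$, $s\geq 1$, the cumulants of $F$. Then $\kappa_1(F)=0$, $\kappa_2(F)=q!\,\|f\|^2_{\mathfrak{H}^{\otimes q}}$ and, for every integer $s\geq 3$, $$\kappa_s(F)= q!\,(s-1)!\sum c_q(r_1,\ldots,r_{s-2}) \big\langle (\ldots((f\widetilde{\otimes}_{r_1} f) \widetilde{\otimes}_{r_2} f)\ldots \widetilde{\otimes}_{r_{s-3}}f)\widetilde{\otimes}_{r_{s-2}}f,\,f\big\rangle_{\mathfrak{H}^{\otimes q}},$$ where the sum runs over all collections of integers $r_1,\ldots,r_{s-2}$ such that: (i) $1\leq r_1,\ldots, r_{s-2}\leq q$; (ii) $r_1+\ldots+r_{s-2}=\frac{(s-2)q}{2}$; (iii) $r_1<q$, $r_1+r_2 <\frac{3q}{2}$, $\ldots$, $r_1+\ldots +r_{s-3}< \frac{(s-2)q}{2}$ (that is, $r_1+\ldots+r_a<\frac{(a+1)q}{2}$ for $a=1,\ldots,s-3$); (iv) $r_2\leq 2q-2r_1$, $\ldots$, $r_{s-2}\leq (s-2)q-2r_1-\ldots-2r_{s-3}$ (that is, $r_a\leq aq-2r_1-\ldots-2r_{a-1}$ for $a=2,\ldots,s-2$); and where the combinatorial constants $c_q(r_1,\ldots,r_{s-2})$ are recursively defined by $$c_q(r)=q(r-1)!\binom{q-1}{r-1}^2,$$ and, for $a\geq 2$, $$c_q(r_1,\ldots,r_{a})=q(r_{a}-1)!\binom{aq-2r_1-\ldots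 - 2r_{a-1}-1}{r_{a}-1} \binom{q-1}{r_{a}-1}c_q(r_1,\ldots,r_{a-1}).$$
   Context: Gaussian setting. Let $\mathfrak{H}$ be a real separable Hilbert space; $\mathfrak{H}^{\otimes q}$ and $\mathfrak{H}^{\odot q}$ denote its $q$th tensor power and $q$th symmetric tensor power. Let $X=\{X(h),h\in \mathfrak{H}\}$ be an isonormal Gaussian process over $\mathfrak{H}$ on a probability space $(\Omega ,\mathcal{F},P)$ with $\mathcal{F}=\sigma(X)$: a centered Gaussian family with $E[X(h)X(g)]=\langle h,g\rangle_{\mathfrak{H}}$. For $q\geq 1$, the $q$th Wiener chaos $\mathcal{H}_q$ is the closed linear subspace of $L^2(\Omega,\mathcal{F},P)$ generated by $\{H_q(X(h)) : h\in\mathfrak{H},\ \|h\|_{\mathfrak{H}}=1\}$, with $H_q(x)=(-1)^q e^{x^2/2}\frac{d^q}{dx^q}e^{-x^2/2}$. Multiple integrals. The map $I_q(h^{\otimes q})=H_q(X(h))$, $\|h\|_{\mathfrak{H}}=1$, extends to a linear isometry $I_q$ from $\mathfrak{H}^{\odot q}$, equipped with the modified norm $\sqrt{q!}\,\|\cdot\|_{\mathfrak{H}^{\otimes q}}$, onto $\mathcal{H}_q$. Contractions. Let $\{e_k,k\geq 1\}$ be a complete orthonormal system in $\mathfrak{H}$. For $f\in\mathfrak{H}^{\odot p}$, $g\in\mathfrak{H}^{\odot q}$ and $r=0,\ldots,p\wedge q$, $$f\otimes_r g=\sum_{i_1,\ldots,i_r=1}^\infty\langle f,e_{i_1}\otimes\cdots\otimes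 e_{i_r}\rangle_{\mathfrak{H}^{\otimes r}}\otimes\langle g,e_{i_1}\otimes\cdots\otimes e_{i_r}\rangle_{\mathfrak{H}^{\otimes r}}\in\mathfrak{H}^{\otimes(p+q-2r)}$$ (independent of the choice of $\{e_k\}$), and $f\widetilde{\otimes}_r g\in\mathfrak{H}^{\odot(p+q-2r)}$ is its symmetrization. Cumulants. If $E|Y|^n<\infty$ and $\phi_Y(t)=E(e^{itY})$, the $j$th cumulant of $Y$, $1\leq j\leq n$, is $\kappa_j(Y)=(-i)^j\frac{d^j}{dt^j}\log\phi_Y(t)|_{t=0}$. (Elements of a fixed Wiener chaos have moments of all orders.) An empty sum equals $0$; for $s=3$ conditions (iii) and (iv) in the "that is" form are void. *)

theory Defs
  imports "HOL-Probability.Probability" "HOL-Combinatorics.Permutations"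
begin

text \<open>
  Tensors over a real Hilbert space \<open>'h\<close> are modelled as Hilbert-Schmidt functionals: the tensor
  \<open>T\<close> of order \<open>q\<close> is the bounded \<open>q\<close>-linear form sending the list \<open>[x\<^sub>1, \<dots>, x\<^sub>q]\<close> to the
  inner product of \<open>T\<close> with the elementary tensor of \<open>x\<^sub>1, \<dots>, x\<^sub>q\<close>. On lists of any
  other length the form is \<open>0\<close>, so equality of tensors is equality of functions.
\<close>

type_synonym 'h tensor = "'h list \<Rightarrow> real"

definition complete_orthonormal :: "'h::real_inner set \<Rightarrow> bool" where
  "complete_orthonormal E \<longleftrightarrow>
     pairwise orthogonal E \<and> (\<forall>e\<in>E. norm e = 1) \<and> closure (span E) = UNIV"

definition tuples :: "'h set \<Rightarrow> nat \<Rightarrow> 'h list set" where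
  "tuples E r = {es. set es \<subseteq> E \<and> length es = r}"

definition bounded_multilinear :: "nat \<Rightarrow> 'h::real_normed_vector tensor \<Rightarrow> bool" where
  "bounded_multilinear q f \<longleftrightarrow>
     (\<forall>xs i. length xs = q \<and> i < q \<longrightarrow> linear (\<lambda>x. f (xs[i := x]))) \<and>
     (\<exists>C. \<forall>xs. length xs = q \<longrightarrow> \<bar>f xs\<bar> \<le> C * prod_list (map norm xs))"

text \<open>
  Below, \<open>E\<close> is a complete orthonormal system (an indexed family is not needed, and
  \<open>'h\<close> may be finite-dimensional). Neither the Hilbert-Schmidt condition nor the inner product, the
  norm and the contractions depend on its choice.
\<close>

definition tensor_power :: "'h::real_inner set \<Rightarrow> nat \<Rightarrow> 'h tensor set" where
  "tensor_power E q =
     {f. bounded_multilinear q f \<and> (\<forall>xs. length xs \<noteq> q \<longrightarrow> f xs = 0) \<and>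
         (\<lambda>es. (f es)\<^sup>2) summable_on tuples E q}"

definition tensor_inner :: "'h::real_inner set \<Rightarrow> nat \<Rightarrow> 'h tensor \<Rightarrow> 'h tensor \<Rightarrow> real" where
  "tensor_inner E q f g = (\<Sum>\<^sub>\<infinity>es\<in>tuples E q. f es * g es)"

definition tensor_norm :: "'h::real_inner set \<Rightarrow> nat \<Rightarrow> 'h tensor \<Rightarrow> real" where
  "tensor_norm E q f = sqrt (tensor_inner E q f f)"

definition sym_tensor_power :: "'h::real_inner set \<Rightarrow> nat \<Rightarrow> 'h tensor set" where
  "sym_tensor_power E q =
     {f \<in> tensor_power E q.
        \<forall>\<pi> xs. \<pi> permutes {..<q} \<and> length xs = q \<longrightarrow> f (permute_list \<pi> xs) = f xs}"

definition elem_power :: "nat \<Rightarrow> 'h::real_inner \<Rightarrow> 'h tensor" where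
  "elem_power q h = (\<lambda>xs. if length xs = q then prod_list (map (inner h) xs) else 0)"

definition symmetrization :: "'h tensor \<Rightarrow> 'h tensor" where
  "symmetrization f xs =
     (\<Sum>\<pi> | \<pi> permutes {..<length xs}. f (permute_list \<pi> xs)) / fact (length xs)"

text \<open>
  For \<open>f\<close> of order \<open>p\<close>, the form \<open>\<lambda>ys. f (ys @ [e\<^sub>1, \<dots>, e\<^sub>r])\<close> is the partial inner product of
  \<open>f\<close> with the elementary tensor of \<open>e\<^sub>1, \<dots>, e\<^sub>r\<close>; for symmetric \<open>f\<close> it does not matter in which
  slots one contracts. The tensor product of two forms evaluates them on consecutive blocks.
\<close>

definition contraction ::
  "'h::real_inner set \<Rightarrow> nat \<Rightarrow> nat \<Rightarrow> nat \<Rightarrow> 'h tensor \<Rightarrow> 'h tensor \<Rightarrow> 'h tensor" where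
  "contraction E p q r f g = (\<lambda>xs.
     if length xs = p + q - 2 * r
     then \<Sum>\<^sub>\<infinity>es\<in>tuples E r. f (take (p - r) xs @ es) * g (drop (p - r) xs @ es)
     else 0)"

definition sym_contraction ::
  "'h::real_inner set \<Rightarrow> nat \<Rightarrow> nat \<Rightarrow> nat \<Rightarrow> 'h tensor \<Rightarrow> 'h tensor \<Rightarrow> 'h tensor" where
  "sym_contraction E p q r f g = symmetrization (contraction E p q r f g)"


definition gaussian_rv :: "'a measure \<Rightarrow> ('a \<Rightarrow> real) \<Rightarrow> bool" where
  \<comment> \<open>degenerate (constant) Gaussians are included\<close>
  "gaussian_rv M Y \<longleftrightarrow> Y \<in> borel_measurable M \<and>
     ((\<exists>\<mu> \<sigma>. 0 < \<sigma> \<and> distributed M lborel Y (normal_density \<mu> \<sigma>)) \<or>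
      (\<exists>\<mu>. AE \<omega> in M. Y \<omega> = \<mu>))"

definition gaussian_family :: "'a measure \<Rightarrow> ('i \<Rightarrow> 'a \<Rightarrow> real) \<Rightarrow> bool" where
  "gaussian_family M X \<longleftrightarrow>
     (\<forall>S c. finite S \<longrightarrow> gaussian_rv M (\<lambda>\<omega>. \<Sum>i\<in>S. c i * X i \<omega>))"

definition isonormal_process :: "'a measure \<Rightarrow> ('h::real_inner \<Rightarrow> 'a \<Rightarrow> real) \<Rightarrow> bool" where
  "isonormal_process M X \<longleftrightarrow>
     prob_space M \<and>
     gaussian_family M X \<and>
     (\<forall>h. (LINT \<omega>|M. X h \<omega>) = 0) \<and>
     (\<forall>h g. (LINT \<omega>|M. X h \<omega> * X g \<omega>) = inner h g) \<and>
     sets M = sigma_sets (space M) {X h -` A \<inter> space M | h A. A \<in> sets borel}"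

definition hermite :: "nat \<Rightarrow> real \<Rightarrow> real" where
  "hermite q x = (-1) ^ q * exp (x\<^sup>2 / 2) * (deriv ^^ q) (\<lambda>t. exp (- (t\<^sup>2 / 2))) x"

definition L2 :: "'a measure \<Rightarrow> ('a \<Rightarrow> real) set" where
  "L2 M = {Y \<in> borel_measurable M. integrable M (\<lambda>\<omega>. (Y \<omega>)\<^sup>2)}"

definition L2_norm :: "'a measure \<Rightarrow> ('a \<Rightarrow> real) \<Rightarrow> real" where
  "L2_norm M Y = sqrt (LINT \<omega>|M. (Y \<omega>)\<^sup>2)"

text \<open>The closure in \<open>L2 M\<close> of the linear span of the generators:\<close>

definition wiener_chaos ::
  "'a measure \<Rightarrow> ('h::real_inner \<Rightarrow> 'a \<Rightarrow> real) \<Rightarrow> nat \<Rightarrow> ('a \<Rightarrow> real) set" where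
  "wiener_chaos M X q =
     {Y \<in> L2 M. \<forall>\<epsilon>>0. \<exists>S c. finite S \<and> (\<forall>h\<in>S. norm h = 1) \<and>
        L2_norm M (\<lambda>\<omega>. Y \<omega> - (\<Sum>h\<in>S. c h * hermite q (X h \<omega>))) < \<epsilon>}"

text \<open>
  \<open>I\<close> is the \<open>q\<close>th multiple integral. Random variables are honest functions, so identities in
  \<open>L\<^sup>2\<close> are required almost everywhere only.
\<close>

definition multiple_integral ::
  "'a measure \<Rightarrow> ('h::real_inner \<Rightarrow> 'a \<Rightarrow> real) \<Rightarrow> 'h set \<Rightarrow> nat \<Rightarrow>
   ('h tensor \<Rightarrow> 'a \<Rightarrow> real) \<Rightarrow> bool" where
  "multiple_integral M X E q I \<longleftrightarrow>
     (\<forall>h. norm h = 1 \<longrightarrow> (AE \<omega> in M. I (elem_power q h) \<omega> = hermite q (X h \<omega>))) \<and>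
     (\<forall>f\<in>sym_tensor_power E q. \<forall>g\<in>sym_tensor_power E q. \<forall>a b.
        AE \<omega> in M. I (\<lambda>xs. a * f xs + b * g xs) \<omega> = a * I f \<omega> + b * I g \<omega>) \<and>
     (\<forall>f\<in>sym_tensor_power E q. I f \<in> wiener_chaos M X q \<and>
        L2_norm M (I f) = sqrt (fact q) * tensor_norm E q f) \<and>
     (\<forall>Y\<in>wiener_chaos M X q. \<exists>f\<in>sym_tensor_power E q. AE \<omega> in M. I f \<omega> = Y \<omega>)"


text \<open>
  The principal branch \<open>Ln\<close> suffices: the characteristic function is continuous with value \<open>1\<close>
  at \<open>0\<close>, and only its values near \<open>0\<close> matter.
\<close>

definition cumulant :: "'a measure \<Rightarrow> ('a \<Rightarrow> real) \<Rightarrow> nat \<Rightarrow> complex" where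
  "cumulant M Y j =
     (- \<i>) ^ j *
     ((\<lambda>g t. vector_derivative g (at t)) ^^ j) (\<lambda>t. Ln (char (distr M borel Y) t)) 0"


text \<open>
  A collection \<open>r\<^sub>1, r\<^sub>2, \<dots>\<close> is a function \<open>r\<close> on \<open>{1..}\<close>. The order of the tensor obtained after
  \<open>a\<close> contractions is \<open>(a + 1) q - 2 r\<^sub>1 - \<dots> - 2 r\<^sub>a\<close>. The subtractions below are on natural numbers;
  they are never truncated for the collections in \<open>cumulant_indices\<close>, whose own inequalities
  are stated over the reals and the integers.
\<close>

definition tensor_order :: "nat \<Rightarrow> (nat \<Rightarrow> nat) \<Rightarrow> nat \<Rightarrow> nat" where
  "tensor_order q r a = (a + 1) * q - 2 * (\<Sum>i=1..a. r i)"

primrec iterated_contraction ::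
  "'h::real_inner set \<Rightarrow> nat \<Rightarrow> 'h tensor \<Rightarrow> (nat \<Rightarrow> nat) \<Rightarrow> nat \<Rightarrow> 'h tensor" where
  "iterated_contraction E q f r 0 = f"
| "iterated_contraction E q f r (Suc a) =
     sym_contraction E (tensor_order q r a) q (r (Suc a)) (iterated_contraction E q f r a) f"

text \<open>\<open>cumulant_coeff q r a\<close> is \<open>c\<^sub>q(r\<^sub>1, \<dots>, r\<^sub>a)\<close>; the value at \<open>a = 0\<close> is a dummy.\<close>

fun cumulant_coeff :: "nat \<Rightarrow> (nat \<Rightarrow> nat) \<Rightarrow> nat \<Rightarrow> nat" where
  "cumulant_coeff q r 0 = 1"
| "cumulant_coeff q r (Suc 0) = q * fact (r 1 - 1) * ((q - 1) choose (r 1 - 1))\<^sup>2"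
| "cumulant_coeff q r (Suc (Suc b)) =
     (let a = Suc (Suc b) in
      q * fact (r a - 1) * ((a * q - 2 * (\<Sum>i=1..a-1. r i) - 1) choose (r a - 1)) *
      ((q - 1) choose (r a - 1)) * cumulant_coeff q r (Suc b))"

definition cumulant_indices :: "nat \<Rightarrow> nat \<Rightarrow> (nat \<Rightarrow> nat) set" where
  "cumulant_indices q s =
     {r \<in> {1..s-2} \<rightarrow>\<^sub>E {1..q}.
        real (\<Sum>i=1..s-2. r i) = real ((s - 2) * q) / 2 \<and>
        (\<forall>a\<in>{1..s-3}. real (\<Sum>i=1..a. r i) < real ((a + 1) * q) / 2) \<and>
        (\<forall>a\<in>{2..s-2}. int (r a) \<le> int (a * q) - 2 * int (\<Sum>i=1..a-1. r i))}"

end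

theory Submission
  imports Defs
begin

text \<open>
  Cumulants and moments of a random variable determine each other by
  \<open>E[F\<^bsup>n+1\<^esup>] = \<Sum>\<^sub>j (n choose j) \<kappa>\<^bsub>j+1\<^esub> E[F\<^bsup>n-j\<^esup>]\<close>, which is \<open>\<phi>' = (log \<phi>)' \<phi>\<close> differentiated \<open>n\<close> times at \<open>0\<close>
  (\<open>moment_cumulant_recursion\<close>). So it suffices that the moments of \<open>F\<close> obey this recursion with the
  claimed values in place of the cumulants (\<open>cumulant_eqI\<close>).

  The source of that recursion is the identity, for \<open>p \<ge> 1\<close>,
  \<open>E[F\<^bsup>n+1\<^esup> I\<^sub>p(g)] = (n+1) \<Sum>\<^sub>r q (r-1)! (p-1 choose r-1) (q-1 choose r-1) E[F\<^sup>n I\<^bsub>p+q-2r\<^esub>(g \<otimes>\<^sub>r f)]\<close>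
  with symmetrized contractions: Gaussian integration by parts lets one slot of \<open>g\<close> differentiate a factor
  \<open>F = I\<^sub>q(f)\<close>, which contracts it with one slot of \<open>f\<close>, and multiplying out \<open>I\<^bsub>p-1\<^esub> I\<^bsub>q-1\<^esub>\<close> contracts
  \<open>r - 1\<close> further slots. Start from \<open>E[F\<^bsup>n+1\<^esup>] = E[F\<^sup>n I\<^sub>q(f)]\<close> and apply the identity repeatedly. As soon as
  the order of the tensor drops to \<open>0\<close>, a constant times a lower moment splits off. Order \<open>0\<close> is only
  reached from order \<open>q\<close> by \<open>r = q\<close>, which contributes \<open>q!\<close> and an inner product with \<open>f\<close>; the
  sequences \<open>r\<^sub>1, r\<^sub>2, \<dots>\<close> of contractions that keep the order positive and arrive at order \<open>q\<close> are the
  ones described by the conditions of the theorem (\<open>cumulant_indices_eq\<close>), and the coefficients of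
  the identity multiply up to \<open>c\<^sub>q\<close>. This is \<open>hermite_sum_moment_recursion\<close>.

  The identity is proved for finite sums \<open>F = \<Sum> c\<^sub>h H\<^sub>q(X(h))\<close> only, which are polynomials in finitely many jointly
  Gaussian variables. There \<open>E[F\<^sup>n I\<^sub>p(g)]\<close> can be replaced by the finite sum of
  \<open>g [h\<^sub>1, \<dots>, h\<^sub>p] E[\<partial>\<^bsub>h1\<^esub> \<dots> \<partial>\<^bsub>hp\<^esub> F\<^sup>n]\<close> over the \<open>h\<^sub>i\<close> that occur in \<open>F\<close> (the definition \<open>pairing\<close>), so that the
  argument consists of integration by parts (\<open>gaussian_ibp\<close>) and algebra (\<open>pairing_hermite_mult\<close>,
  \<open>pairing_hermite_sum_power\<close>).

  The general case follows by density. By definition of the Wiener chaos, \<open>F\<close> is an \<open>L\<^sup>2\<close> limit of such finite sums,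
  and by the isometry property their tensors \<open>f\<^sub>k\<close> converge to \<open>f\<close> in the Hilbert-Schmidt norm
  (\<open>multiple_integral_approximation\<close>). Contractions are continuous by the Cauchy-Schwarz inequality
  (\<open>path_sum_tendsto\<close>), so the coefficients of the recursions converge. Then, by induction along the recursion,
  so do all moments; in particular they are bounded in \<open>k\<close>, and this uniform integrability
  identifies their limits with the moments of \<open>F\<close> (\<open>multiple_integral_moments\<close>).
\<close>

section \<open>Tuples and symmetric forms\<close>

lemma tuples_0: "tuples E 0 = {[]}"
  by (auto simp: tuples_def)

lemma bij_betw_append_tuples:
  "bij_betw (\<lambda>(xs, ys). xs @ ys) (tuples E a \<times> tuples E b) (tuples E (a + b))"
  by (rule bij_betw_byWitness[where f' = "\<lambda>zs. (take a zs, drop a zs)"])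
    (auto simp: tuples_def dest: in_set_takeD in_set_dropD)

lemma bij_betw_Cons_tuples:
  "bij_betw (\<lambda>(x, xs). x # xs) (E \<times> tuples E b) (tuples E (Suc b))"
  by (rule bij_betw_byWitness[where f' = "\<lambda>zs. (hd zs, tl zs)"])
    (auto simp: tuples_def length_Suc_conv)

lemma sum_tuples_Suc:
  "(\<Sum>xs\<in>tuples S (Suc p). f xs) = (\<Sum>x\<in>S. \<Sum>xs\<in>tuples S p. f (x # xs))"
  unfolding sum.cartesian_product
  by (subst sum.reindex_bij_betw[OF bij_betw_Cons_tuples, symmetric]) (simp add: case_prod_beta)

lemma bij_betw_permute_tuples:
  assumes "\<pi> permutes {..<p}"
  shows "bij_betw (permute_list \<pi>) (tuples E p) (tuples E p)"
proof (rule bij_betw_byWitness[where f' = "permute_list (inv \<pi>)"])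
  have inv: "inv \<pi> permutes {..<p}" using assms by (rule permutes_inv)
  show "\<forall>xs\<in>tuples E p. permute_list (inv \<pi>) (permute_list \<pi> xs) = xs"
    using inv permutes_inv_o[OF assms]
    by (auto simp: tuples_def simp flip: permute_list_compose)
  show "\<forall>xs\<in>tuples E p. permute_list \<pi> (permute_list (inv \<pi>) xs) = xs"
    using assms permutes_inv_o[OF assms]
    by (auto simp: tuples_def simp flip: permute_list_compose)
qed (use assms permutes_inv[OF assms] in \<open>auto simp: tuples_def\<close>)

text \<open>Invariance under the multiset of arguments, so that slots can be rearranged without naming a permutation.\<close>

definition symmetric_form :: "('h list \<Rightarrow> real) \<Rightarrow> bool" where
  "symmetric_form g \<longleftrightarrow> (\<forall>xs ys. mset xs = mset ys \<longrightarrow> g xs = g ys)"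

lemma symmetric_formD: "symmetric_form g \<Longrightarrow> mset xs = mset ys \<Longrightarrow> g xs = g ys"
  unfolding symmetric_form_def by blast

lemma symmetric_form_Cons: "symmetric_form g \<Longrightarrow> symmetric_form (\<lambda>xs. g (x # xs))"
  unfolding symmetric_form_def by simp

lemma symmetric_form_symmetrization: "symmetric_form (symmetrization g)"
  unfolding symmetric_form_def
proof (intro allI impI)
  fix xs ys :: "'a list" assume mset: "mset xs = mset ys"
  then obtain \<sigma> where \<sigma>: "\<sigma> permutes {..<length ys}" "permute_list \<sigma> ys = xs"
    using mset_eq_permutation by blast
  have len: "length xs = length ys" using mset by (rule mset_eq_length)
  have "(\<Sum>\<pi> | \<pi> permutes {..<length ys}. g (permute_list \<pi> xs)) =
      (\<Sum>\<pi> | \<pi> permutes {..<length ys}. g (permute_list (\<sigma> \<circ> \<pi>) ys))"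
    by (intro sum.cong) (auto simp: permute_list_compose \<sigma>(2))
  also have "\<dots> = (\<Sum>\<pi> | \<pi> permutes {..<length ys}. g (permute_list \<pi> ys))"
    by (rule setum_permutations_compose_left[OF \<sigma>(1), symmetric])
  finally show "symmetrization g xs = symmetrization g ys"
    by (simp add: symmetrization_def len)
qed

section \<open>Parseval's identity and sums over tuples\<close>

lemma parseval_norm:
  fixes E :: "'h::real_inner set"
  assumes E: "complete_orthonormal E"
  shows "((\<lambda>e. (inner b e)\<^sup>2) has_sum (norm b)\<^sup>2) E"
proof -
  have orth: "inner e e' = (if e = e' then 1 else 0)" if "e \<in> E" "e' \<in> E" for e e'
    using E that by (auto simp: complete_orthonormal_def pairwise_def orthogonal_def dot_square_norm)
  define P where "P F = (\<Sum>e\<in>F. inner b e *\<^sub>R e)" for F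
  have P_e: "inner (P F) e = (if e \<in> F then inner b e else 0)" if "finite F" "F \<subseteq> E" "e \<in> E" for F e
  proof -
    have "inner (P F) e = (\<Sum>e'\<in>F. if e' = e then inner b e else 0)"
      unfolding P_def inner_sum_left using that by (intro sum.cong) (auto simp: orth subset_iff)
    then show ?thesis using that by simp
  qed
  have dist: "(norm (b - P F))\<^sup>2 = (norm b)\<^sup>2 - (\<Sum>e\<in>F. (inner b e)\<^sup>2)" if "finite F" "F \<subseteq> E" for F
  proof -
    have "inner (P F) (P F) = (\<Sum>e\<in>F. inner b e * inner (P F) e)"
      by (subst (2) P_def) (simp add: inner_sum_right)
    also have "\<dots> = (\<Sum>e\<in>F. (inner b e)\<^sup>2)"
      using that by (intro sum.cong) (auto simp: P_e subset_iff power2_eq_square)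
    also have "\<dots> = inner b (P F)"
      by (simp add: P_def inner_sum_right power2_eq_square)
    finally show ?thesis
      unfolding power2_norm_eq_inner
      by (simp add: inner_diff inner_commute P_def inner_sum_right power2_eq_square)
  qed
  have bessel: "(\<Sum>e\<in>F. (inner b e)\<^sup>2) \<le> (norm b)\<^sup>2" if "finite F" "F \<subseteq> E" for F
    using dist[OF that] zero_le_power2[of "norm (b - P F)"] by linarith
  have summable: "(\<lambda>e. (inner b e)\<^sup>2) summable_on E"
    by (rule nonneg_bdd_above_summable_on) (auto intro!: bdd_aboveI2 bessel)
  moreover have "infsum (\<lambda>e. (inner b e)\<^sup>2) E = (norm b)\<^sup>2"
  proof (rule antisym)
    show "infsum (\<lambda>e. (inner b e)\<^sup>2) E \<le> (norm b)\<^sup>2"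
      by (rule infsum_le_finite_sums[OF summable bessel])
    show "(norm b)\<^sup>2 \<le> infsum (\<lambda>e. (inner b e)\<^sup>2) E"
    proof (rule field_le_epsilon)
      fix \<epsilon> :: real assume "0 < \<epsilon>"
      then have "0 < sqrt \<epsilon>" by simp
      moreover have "b \<in> closure (span E)" using E by (simp add: complete_orthonormal_def)
      ultimately obtain v where v: "v \<in> span E" "dist v b < sqrt \<epsilon>"
        unfolding closure_approachable by blast
      then obtain F r where F: "finite F" "F \<subseteq> E" "v = (\<Sum>e\<in>F. r e *\<^sub>R e)"
        unfolding span_explicit by blast
      \<comment> \<open>Among the elements of the span of \<open>F\<close> the projection \<open>P F\<close> is closest to \<open>b\<close>.\<close>
      have "inner (b - P F) (P F - v) = 0"
        using F by (simp add: F(3) P_def inner_diff_right inner_sum_right)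
          (simp add: inner_diff_left P_e[unfolded P_def] subset_iff)
      then have "(norm (b - v))\<^sup>2 = (norm (b - P F))\<^sup>2 + (norm (P F - v))\<^sup>2"
        using dot_norm[of "b - P F" "P F - v"] by simp
      then have "(norm (b - P F))\<^sup>2 \<le> (norm (b - v))\<^sup>2" by simp
      also have "\<dots> < \<epsilon>"
        using v(2) \<open>0 < \<epsilon>\<close> by (metis dist_norm norm_minus_commute norm_ge_zero real_sqrt_pow2 less_imp_le power_strict_mono zero_less_numeral)
      finally have "(norm b)\<^sup>2 \<le> (\<Sum>e\<in>F. (inner b e)\<^sup>2) + \<epsilon>" using dist[OF F(1,2)] by simp
      also have "(\<Sum>e\<in>F. (inner b e)\<^sup>2) \<le> infsum (\<lambda>e. (inner b e)\<^sup>2) E"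
        by (rule finite_sum_le_infsum[OF summable F(1,2)]) simp
      finally show "(norm b)\<^sup>2 \<le> infsum (\<lambda>e. (inner b e)\<^sup>2) E + \<epsilon>" by simp
    qed
  qed
  ultimately show ?thesis by (simp add: has_sum_iff)
qed

lemma parseval:
  fixes E :: "'h::real_inner set"
  assumes E: "complete_orthonormal E"
  shows "((\<lambda>e. inner b e * inner d e) has_sum inner b d) E"
proof -
  have "((\<lambda>e. 1/4 * ((inner (b + d) e)\<^sup>2 - (inner (b - d) e)\<^sup>2)) has_sum
      1/4 * ((norm (b + d))\<^sup>2 - (norm (b - d))\<^sup>2)) E"
    unfolding diff_conv_add_uminus[of "_\<^sup>2"]
    by (intro has_sum_cmult_right has_sum_add has_sum_uminusI parseval_norm E)
  moreover have "1/4 * ((inner (b + d) e)\<^sup>2 - (inner (b - d) e)\<^sup>2) = inner b e * inner d e" for e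
    by (simp add: inner_add_left inner_diff_left power2_eq_square algebra_simps)
  moreover have "1/4 * ((norm (b + d))\<^sup>2 - (norm (b - d))\<^sup>2) = inner b d"
    unfolding power2_norm_eq_inner by (simp add: inner_add inner_diff inner_commute)
  ultimately show ?thesis by simp
qed

lemma has_sum_product_real:
  fixes f :: "'a \<Rightarrow> real" and g :: "'b \<Rightarrow> real"
  assumes f: "(f has_sum a) A" and g: "(g has_sum b) B"
  shows "((\<lambda>(x, y). f x * g y) has_sum a * b) (A \<times> B)"
proof (rule has_sum_SigmaI)
  show "((\<lambda>y. case (x, y) of (x, y) \<Rightarrow> f x * g y) has_sum f x * b) B" for x
    using has_sum_cmult_right[OF g] by simp
  show "((\<lambda>x. f x * b) has_sum a * b) A"
    by (rule has_sum_cmult_left[OF f])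
  have "(\<lambda>x. \<bar>f x\<bar>) summable_on A" "(\<lambda>y. \<bar>g y\<bar>) summable_on B"
    using f g summable_on_iff_abs_summable_on_real[of f A] summable_on_iff_abs_summable_on_real[of g B]
    by (auto dest: has_sum_imp_summable)
  then have "(\<lambda>z. norm (case z of (x, y) \<Rightarrow> f x * g y)) summable_on A \<times> B"
  proof (subst Infinite_Sum.abs_summable_on_Sigma_iff, intro conjI ballI)
    assume A: "(\<lambda>x. \<bar>f x\<bar>) summable_on A" and B: "(\<lambda>y. \<bar>g y\<bar>) summable_on B"
    show "(\<lambda>y. norm (case (x, y) of (x, y) \<Rightarrow> f x * g y)) summable_on B" for x
      using summable_on_cmult_right[OF B, of "\<bar>f x\<bar>"] by (simp add: abs_mult)
    have "norm (\<Sum>\<^sub>\<infinity>y\<in>B. norm (case (x, y) of (x, y) \<Rightarrow> f x * g y)) = \<bar>f x\<bar> * (\<Sum>\<^sub>\<infinity>y\<in>B. \<bar>g y\<bar>)" for x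
    proof -
      have "0 \<le> (\<Sum>\<^sub>\<infinity>y\<in>B. \<bar>g y\<bar>)" by (rule infsum_nonneg) simp
      then show ?thesis by (simp add: abs_mult infsum_cmult_right')
    qed
    then show "(\<lambda>x. norm (\<Sum>\<^sub>\<infinity>y\<in>B. norm (case (x, y) of (x, y) \<Rightarrow> f x * g y))) summable_on A"
      using summable_on_cmult_left[OF A, of "\<Sum>\<^sub>\<infinity>y\<in>B. \<bar>g y\<bar>"] by simp
  qed
  then show "(\<lambda>(x, y). f x * g y) summable_on A \<times> B"
    by (rule summable_on_iff_abs_summable_on_real[THEN iffD2])
qed

definition elementary :: "'h::real_inner list \<Rightarrow> 'h list \<Rightarrow> real" where
  "elementary us xs = (\<Prod>(u, x)\<leftarrow>zip us xs. inner u x)"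

lemma elementary_append:
  "length us = length xs \<Longrightarrow> elementary (us @ us') (xs @ xs') = elementary us xs * elementary us' xs'"
  by (simp add: elementary_def)

lemma elementary_replicate:
  "elementary (replicate (length xs) h) xs = (\<Prod>x\<leftarrow>xs. inner h x)"
  by (induction xs) (auto simp: elementary_def)

lemma elementary_permute:
  assumes "\<pi> permutes {..<length us}" "length us = length xs"
  shows "elementary (permute_list \<pi> us) (permute_list \<pi> xs) = elementary us xs"
proof -
  have "zip (permute_list \<pi> us) (permute_list \<pi> xs) = permute_list \<pi> (zip us xs)"
    using assms by (subst permute_list_zip[of \<pi> "{..<length us}"]) auto
  then show ?thesis
    using assms by (simp add: elementary_def flip: prod_mset_prod_list)
qed

text \<open>Parseval's identity in the tensor power, one factor at a time.\<close>

lemma parseval_elementary: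
  fixes E :: "'h::real_inner set"
  assumes E: "complete_orthonormal E" and "length us = length vs"
  shows "((\<lambda>es. elementary us es * elementary vs es) has_sum elementary us vs) (tuples E (length us))"
  using assms(2)
proof (induction us vs rule: list_induct2)
  case Nil
  then show ?case by (auto simp: tuples_0 elementary_def intro: has_sum_finiteI)
next
  case (Cons u us v vs)
  have eq: "elementary (x # xs) (e # es) = inner x e * elementary xs es" for x e :: 'h and xs es
    by (simp add: elementary_def)
  from has_sum_product_real[OF parseval[OF E, of u v] Cons.IH]
  have "((\<lambda>z. (\<lambda>es. elementary (u # us) es * elementary (v # vs) es) ((\<lambda>(e, es). e # es) z))
    has_sum elementary (u # us) (v # vs)) (E \<times> tuples E (length us))"
    by (simp add: case_prod_unfold eq mult_ac)
  then show ?case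
    using has_sum_reindex_bij_betw[OF bij_betw_Cons_tuples,
        of "\<lambda>es. elementary (u # us) es * elementary (v # vs) es"] by simp
qed

section \<open>Simple tensors\<close>

text \<open>
  The algebraic tensor power. Iterated contractions of finite sums of powers \<open>h \<otimes> \<dots> \<otimes> h\<close> stay inside it, and on
  it the infinite sums that define contractions can be evaluated in closed form.
\<close>

inductive_set simple_tensors :: "nat \<Rightarrow> 'h::real_inner tensor set" for p where
  elem: "length us = p \<Longrightarrow> (\<lambda>xs. if length xs = p then elementary us xs else 0) \<in> simple_tensors p"
| add: "g \<in> simple_tensors p \<Longrightarrow> g' \<in> simple_tensors p \<Longrightarrow> (\<lambda>xs. g xs + g' xs) \<in> simple_tensors p"
| cmult: "g \<in> simple_tensors p \<Longrightarrow> (\<lambda>xs. a * g xs) \<in> simple_tensors p"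

lemma simple_tensors_zero: "(\<lambda>xs. 0) \<in> simple_tensors p"
  using simple_tensors.cmult[OF simple_tensors.elem[OF length_replicate], of 0] by simp

lemma simple_tensors_sum:
  "(\<And>i. i \<in> T \<Longrightarrow> g i \<in> simple_tensors p) \<Longrightarrow> (\<lambda>xs. \<Sum>i\<in>T. g i xs) \<in> simple_tensors p"
  by (induction T rule: infinite_finite_induct) (auto intro: simple_tensors_zero simple_tensors.add)

lemma simple_tensors_length: "g \<in> simple_tensors p \<Longrightarrow> length xs \<noteq> p \<Longrightarrow> g xs = 0"
  by (induction rule: simple_tensors.induct) auto

lemma elem_power_simple: "elem_power q h \<in> simple_tensors q"
proof -
  have "elem_power q h = (\<lambda>xs. if length xs = q then elementary (replicate q h) xs else 0)"
    by (auto simp: elem_power_def simp flip: elementary_replicate)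
  then show ?thesis using simple_tensors.elem[of "replicate q h" q] by simp
qed

text \<open>
  Contracting with a power of \<open>h\<close> amounts to inserting \<open>h\<close> into the contracted slots. Both sides are linear in
  \<open>g\<close>, and for elementary tensors this is Parseval's identity.
\<close>

lemma simple_tensors_reproducing:
  fixes E :: "'h::real_inner set"
  assumes E: "complete_orthonormal E" and g: "g \<in> simple_tensors p" and "length xs + r = p"
  shows "((\<lambda>es. g (xs @ es) * (\<Prod>x\<leftarrow>es. inner h x)) has_sum g (xs @ replicate r h)) (tuples E r)"
  using g
proof (induction rule: simple_tensors.induct)
  case (elem us)
  define vs ws where "vs = take (length xs) us" and "ws = drop (length xs) us"
  have us: "us = vs @ ws" "length vs = length xs" "length ws = r"
    using elem assms(3) by (auto simp: vs_def ws_def)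
  have A: "((\<lambda>es. elementary vs xs * (elementary ws es * elementary (replicate r h) es))
      has_sum elementary vs xs * elementary ws (replicate r h)) (tuples E r)"
    using has_sum_cmult_right[OF parseval_elementary[OF E, of ws "replicate r h"]] us by simp
  have B: "elementary vs xs * (elementary ws es * elementary (replicate r h) es) =
      (if length (xs @ es) = p then elementary us (xs @ es) else 0) * (\<Prod>x\<leftarrow>es. inner h x)"
    if "es \<in> tuples E r" for es
    using that us assms(3) elementary_replicate[of es h] by (simp add: tuples_def elementary_append)
  have C: "elementary us (xs @ replicate r h) = elementary vs xs * elementary ws (replicate r h)"
    unfolding us(1) by (rule elementary_append[OF us(2)])
  from has_sum_cong[THEN iffD1, OF B A] show ?case using assms(3) by (simp add: C)
next
  case (add g g')
  then show ?case using has_sum_add[OF add.IH] by (simp add: distrib_right)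
next
  case (cmult g a)
  then show ?case using has_sum_cmult_right[OF cmult.IH, of a] by (simp add: mult.assoc)
qed

lemma has_sum_finite_sum:
  "finite T \<Longrightarrow> (\<And>i. i \<in> T \<Longrightarrow> ((\<lambda>x. f i x :: real) has_sum s i) A) \<Longrightarrow>
    ((\<lambda>x. \<Sum>i\<in>T. f i x) has_sum (\<Sum>i\<in>T. s i)) A"
  by (induction T rule: finite_induct) (auto intro: has_sum_add)

text \<open>The kernel of the random variable \<open>\<Sum>\<^bsub>h\<in>S\<^esub> c h H\<^sub>q(X(h))\<close>.\<close>

definition hermite_tensor :: "'h set \<Rightarrow> ('h \<Rightarrow> real) \<Rightarrow> nat \<Rightarrow> 'h::real_inner tensor" where
  "hermite_tensor S c q = (\<lambda>xs. \<Sum>h\<in>S. c h * elem_power q h xs)"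

lemma hermite_tensor_simple: "hermite_tensor S c q \<in> simple_tensors q"
  unfolding hermite_tensor_def
  by (intro simple_tensors_sum simple_tensors.cmult elem_power_simple)

lemma hermite_tensor_symmetric: "symmetric_form (hermite_tensor S c q)"
proof -
  have "elem_power q h xs = elem_power q h ys" if "mset xs = mset ys" for h :: 'a and xs ys
    using that mset_eq_length[OF that]
    by (simp add: elem_power_def flip: prod_mset_prod_list)
  then show ?thesis
    unfolding symmetric_form_def hermite_tensor_def
    by (intro allI impI sum.cong refl arg_cong2[where f = "(*)"])
qed

text \<open>
  The orthonormal system disappears from contractions with such kernels: this is the form in which they come out
  of the algebraic computation with derivatives below.
\<close>

lemma contraction_hermite_tensor:
  fixes E :: "'h::real_inner set"
  assumes E: "complete_orthonormal E" and g: "g \<in> simple_tensors p"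
    and S: "finite S" and r: "r \<le> p" "r \<le> q"
  shows "contraction E p q r g (hermite_tensor S c q) =
    (\<lambda>xs. if length xs = p + q - 2 * r
      then \<Sum>h\<in>S. c h * (g (take (p - r) xs @ replicate r h) * (\<Prod>x\<leftarrow>drop (p - r) xs. inner h x)) else 0)"
proof (rule ext)
  fix xs :: "'h list"
  show "contraction E p q r g (hermite_tensor S c q) xs =
    (if length xs = p + q - 2 * r
      then \<Sum>h\<in>S. c h * (g (take (p - r) xs @ replicate r h) * (\<Prod>x\<leftarrow>drop (p - r) xs. inner h x)) else 0)"
  proof (cases "length xs = p + q - 2 * r")
    case len: True
    let ?a = "take (p - r) xs" and ?b = "drop (p - r) xs"
    have "((\<lambda>es. c h * (\<Prod>x\<leftarrow>?b. inner h x) * (g (?a @ es) * (\<Prod>x\<leftarrow>es. inner h x))) has_sum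
        c h * (\<Prod>x\<leftarrow>?b. inner h x) * g (?a @ replicate r h)) (tuples E r)" for h
      by (intro has_sum_cmult_right simple_tensors_reproducing[OF E g]) (use len r in auto)
    from has_sum_finite_sum[OF S this]
    have "((\<lambda>es. \<Sum>h\<in>S. c h * (\<Prod>x\<leftarrow>?b. inner h x) * (g (?a @ es) * (\<Prod>x\<leftarrow>es. inner h x))) has_sum
       (\<Sum>h\<in>S. c h * (g (?a @ replicate r h) * (\<Prod>x\<leftarrow>?b. inner h x)))) (tuples E r)"
      by (simp add: mult_ac)
    moreover have "(\<Sum>h\<in>S. c h * (\<Prod>x\<leftarrow>?b. inner h x) * (g (?a @ es) * (\<Prod>x\<leftarrow>es. inner h x))) =
        g (?a @ es) * hermite_tensor S c q (?b @ es)" if "es \<in> tuples E r" for es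
      using that len r
      by (simp add: tuples_def hermite_tensor_def elem_power_def sum_distrib_left mult_ac)
    ultimately have "((\<lambda>es. g (?a @ es) * hermite_tensor S c q (?b @ es)) has_sum
       (\<Sum>h\<in>S. c h * (g (?a @ replicate r h) * (\<Prod>x\<leftarrow>?b. inner h x)))) (tuples E r)"
      by (simp cong: has_sum_cong)
    then show ?thesis using len by (simp add: contraction_def infsumI)
  qed (simp add: contraction_def)
qed

lemma contraction_hermite_tensor_simple:
  fixes E :: "'h::real_inner set"
  assumes E: "complete_orthonormal E" and g: "g \<in> simple_tensors p"
    and S: "finite S" and r: "r \<le> p" "r \<le> q"
  shows "contraction E p q r g (hermite_tensor S c q) \<in> simple_tensors (p + q - 2 * r)"
proof -
  let ?k = "\<lambda>g h xs. if length xs = p + q - 2 * r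
     then g (take (p - r) xs @ replicate r h) * (\<Prod>x\<leftarrow>drop (p - r) xs. inner h x) else 0"
  have "?k g h \<in> simple_tensors (p + q - 2 * r)" for h
    using g
  proof (induction rule: simple_tensors.induct)
    case (elem us)
    define vs ws where "vs = take (p - r) us" and "ws = drop (p - r) us"
    have us: "us = vs @ ws" "length vs = p - r" "length ws = r"
      using elem r by (auto simp: vs_def ws_def)
    have "?k (\<lambda>xs. if length xs = p then elementary us xs else 0) h =
        (\<lambda>xs. elementary ws (replicate r h) *
          (if length xs = p + q - 2 * r then elementary (vs @ replicate (q - r) h) xs else 0))"
    proof (rule ext)
      fix xs :: "'h list"
      show "?k (\<lambda>xs. if length xs = p then elementary us xs else 0) h xs =
        elementary ws (replicate r h) *
          (if length xs = p + q - 2 * r then elementary (vs @ replicate (q - r) h) xs else 0)"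
      proof (cases "length xs = p + q - 2 * r")
        case True
        have "elementary (vs @ replicate (q - r) h) xs =
            elementary vs (take (p - r) xs) * (\<Prod>x\<leftarrow>drop (p - r) xs. inner h x)"
          using elementary_append[of vs "take (p - r) xs" "replicate (q - r) h" "drop (p - r) xs"]
            True r us elementary_replicate[of "drop (p - r) xs" h] by simp
        then show ?thesis using True r us by (simp add: elementary_append)
      qed simp
    qed
    then show ?case
      using simple_tensors.cmult[OF simple_tensors.elem[of "vs @ replicate (q - r) h" "p + q - 2 * r"]]
        us r by simp
  next
    case (add g g')
    have "?k (\<lambda>xs. g xs + g' xs) h = (\<lambda>xs. ?k g h xs + ?k g' h xs)"
      by (auto simp: distrib_right)
    then show ?case using simple_tensors.add[OF add.IH] by simp
  next
    case (cmult g a)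
    have "?k (\<lambda>xs. a * g xs) h = (\<lambda>xs. a * ?k g h xs)" by auto
    then show ?case using simple_tensors.cmult[OF cmult.IH] by simp
  qed
  then have "(\<lambda>xs. \<Sum>h\<in>S. c h * ?k g h xs) \<in> simple_tensors (p + q - 2 * r)"
    by (intro simple_tensors_sum simple_tensors.cmult)
  also have "(\<lambda>xs. \<Sum>h\<in>S. c h * ?k g h xs) = contraction E p q r g (hermite_tensor S c q)"
    unfolding contraction_hermite_tensor[OF assms] by auto
  finally show ?thesis .
qed

lemma symmetrization_simple:
  fixes g :: "'h::real_inner tensor"
  assumes g: "g \<in> simple_tensors p"
  shows "symmetrization g \<in> simple_tensors p"
proof -
  have "(\<lambda>xs. if length xs = p then g (permute_list \<pi> xs) else 0) \<in> simple_tensors p"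
    if \<pi>: "\<pi> permutes {..<p}" for \<pi>
    using g
  proof (induction rule: simple_tensors.induct)
    case (elem us)
    have us: "us = permute_list \<pi> (permute_list (inv \<pi>) us)"
      using elem \<pi> permutes_inv_o[OF \<pi>] by (simp flip: permute_list_compose)
    have "elementary us (permute_list \<pi> xs) = elementary (permute_list (inv \<pi>) us) xs"
      if "length xs = p" for xs
      using that elem \<pi> by (subst us) (simp add: elementary_permute)
    then show ?case
      using simple_tensors.elem[of "permute_list (inv \<pi>) us" p] elem by (simp cong: if_cong)
  next
    case (add g g')
    then show ?case using simple_tensors.add[OF add.IH] by (simp add: if_distrib if_distribR cong: if_cong)
  next
    case (cmult g a)
    then show ?case using simple_tensors.cmult[OF cmult.IH, of a] by (simp add: if_distrib cong: if_cong)
  qed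
  then have "(\<lambda>xs. \<Sum>\<pi> | \<pi> permutes {..<p}. 1 / fact p * (if length xs = p then g (permute_list \<pi> xs) else 0))
      \<in> simple_tensors p"
    by (intro simple_tensors_sum simple_tensors.cmult) auto
  also have "(\<lambda>xs. \<Sum>\<pi> | \<pi> permutes {..<p}. 1 / fact p * (if length xs = p then g (permute_list \<pi> xs) else 0))
      = symmetrization g"
  proof (rule ext)
    show "(\<Sum>\<pi> | \<pi> permutes {..<p}. 1 / fact p * (if length xs = p then g (permute_list \<pi> xs) else 0)) =
        symmetrization g xs" for xs
      by (cases "length xs = p")
        (simp_all add: symmetrization_def sum_divide_distrib simple_tensors_length[OF g])
  qed
  finally show ?thesis .
qed

section \<open>Hermite polynomials\<close>

text \<open>
  With the recursion \<open>He\<^bsub>n+1\<^esub> = x He\<^sub>n - He\<^sub>n'\<close> as definition, the Rodrigues formula is immediate, and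
  raising the degree by one is adjoint to differentiation.
\<close>

fun hermite_poly :: "nat \<Rightarrow> real poly" where
  "hermite_poly 0 = 1"
| "hermite_poly (Suc n) = [:0, 1:] * hermite_poly n - pderiv (hermite_poly n)"

lemma pderiv_hermite_poly: "pderiv (hermite_poly (Suc n)) = of_nat (Suc n) * hermite_poly n"
proof (induction n)
  case 0
  then show ?case by (simp add: pderiv_pCons)
next
  case (Suc n)
  have p1: "pderiv [:0, 1::real:] = 1" by (simp add: pderiv_pCons)
  have "pderiv (hermite_poly (Suc (Suc n))) =
      hermite_poly (Suc n) + [:0, 1:] * pderiv (hermite_poly (Suc n))
        - pderiv (pderiv (hermite_poly (Suc n)))"
    by (subst hermite_poly.simps(2)) (simp only: pderiv_diff pderiv_mult p1 mult_1_right)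
  also have "\<dots> = hermite_poly (Suc n) + of_nat (Suc n) * hermite_poly (Suc n)"
    unfolding Suc.IH
    by (subst (3) hermite_poly.simps(2))
      (simp only: pderiv_mult pderiv_of_nat mult_zero_left add_0_right right_diff_distrib
         mult.left_commute diff_add_eq mult_zero_right add.assoc[symmetric] add_diff_eq)
  finally show ?case by (simp only: of_nat_Suc[of "Suc n"] distrib_right mult_1_left)
qed

lemma deriv_gaussian_eq:
  "(deriv ^^ n) (\<lambda>t. exp (- (t\<^sup>2 / 2))) x = (-1) ^ n * poly (hermite_poly n) x * exp (- (x\<^sup>2 / 2))"
proof (induction n arbitrary: x)
  case (Suc n)
  have "(deriv ^^ Suc n) (\<lambda>t. exp (- (t\<^sup>2 / 2))) x =
      deriv (\<lambda>x. (-1) ^ n * poly (hermite_poly n) x * exp (- (x\<^sup>2 / 2))) x"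
    by (simp add: Suc.IH[THEN ext])
  also have "\<dots> = (-1) ^ Suc n * poly (hermite_poly (Suc n)) x * exp (- (x\<^sup>2 / 2))"
    by (rule DERIV_imp_deriv)
      (auto intro!: derivative_eq_intros poly_DERIV simp: algebra_simps)
  finally show ?case .
qed simp

lemma hermite_eq_poly: "hermite n x = poly (hermite_poly n) x"
proof -
  have "exp (x\<^sup>2 / 2) * exp (- (x\<^sup>2 / 2)) = 1"
    by (simp add: exp_minus)
  then show ?thesis
    unfolding hermite_def deriv_gaussian_eq
    by (simp add: power_mult_distrib[symmetric] mult.assoc mult.commute mult.left_commute flip: power_add)
qed

section \<open>Polynomial functions of finitely many coordinates\<close>

text \<open>
  Polynomials in the coordinates \<open>y k\<close>, \<open>k \<in> S\<close>, to be evaluated at \<open>y k = X k \<omega>\<close>. Building them up by multiplication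
  with single coordinates rather than general products matches the induction that proves integration by parts.
\<close>

inductive_set polyfuns :: "'h set \<Rightarrow> (('h \<Rightarrow> real) \<Rightarrow> real) set" for S where
  const: "(\<lambda>y. a) \<in> polyfuns S"
| add: "G \<in> polyfuns S \<Longrightarrow> H \<in> polyfuns S \<Longrightarrow> (\<lambda>y. G y + H y) \<in> polyfuns S"
| coord: "k \<in> S \<Longrightarrow> G \<in> polyfuns S \<Longrightarrow> (\<lambda>y. y k * G y) \<in> polyfuns S"

lemma polyfuns_cmult: "G \<in> polyfuns S \<Longrightarrow> (\<lambda>y. a * G y) \<in> polyfuns S"
proof (induction rule: polyfuns.induct)
  case (coord k G)
  then have "(\<lambda>y. y k * (a * G y)) \<in> polyfuns S" by (auto intro: polyfuns.coord)
  then show ?case by (simp add: mult.left_commute)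
qed (auto simp: distrib_left intro: polyfuns.intros)

lemma polyfuns_mult:
  "G \<in> polyfuns S \<Longrightarrow> H \<in> polyfuns S \<Longrightarrow> (\<lambda>y. G y * H y) \<in> polyfuns S"
proof (induction rule: polyfuns.induct)
  case (coord k G)
  then have "(\<lambda>y. y k * (G y * H y)) \<in> polyfuns S" by (auto intro: polyfuns.coord)
  then show ?case by (simp add: mult.assoc)
qed (auto simp: distrib_right intro: polyfuns.intros polyfuns_cmult)

lemma polyfuns_proj: "k \<in> S \<Longrightarrow> (\<lambda>y. y k) \<in> polyfuns S"
  using polyfuns.coord[OF _ polyfuns.const[of 1]] by simp

lemma polyfuns_power: "G \<in> polyfuns S \<Longrightarrow> (\<lambda>y. G y ^ n) \<in> polyfuns S"
  by (induction n) (auto intro: polyfuns.const polyfuns_mult)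

lemma polyfuns_sum:
  "(\<And>i. i \<in> T \<Longrightarrow> G i \<in> polyfuns S) \<Longrightarrow> (\<lambda>y. \<Sum>i\<in>T. G i y) \<in> polyfuns S"
  by (induction T rule: infinite_finite_induct) (auto intro: polyfuns.const polyfuns.add)

lemma polyfuns_if: "G \<in> polyfuns S \<Longrightarrow> (\<lambda>y. if b then G y else 0) \<in> polyfuns S"
  by (cases b) (auto intro: polyfuns.const)

lemma polyfuns_poly: "k \<in> S \<Longrightarrow> (\<lambda>y. poly p (y k)) \<in> polyfuns S"
  by (induction p) (auto intro: polyfuns.intros)

definition partial :: "'h \<Rightarrow> (('h \<Rightarrow> real) \<Rightarrow> real) \<Rightarrow> ('h \<Rightarrow> real) \<Rightarrow> real" where
  "partial k G y = deriv (\<lambda>t. G (y(k := t))) (y k)"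

lemma polyfuns_differentiable:
  assumes "G \<in> polyfuns S"
  shows "(\<lambda>t. G (y(k := t))) field_differentiable (at t)"
  using assms
proof (induction rule: polyfuns.induct)
  case (coord l G)
  have "(\<lambda>t. (y(k := t)) l) field_differentiable (at t)" by (cases "l = k") auto
  then show ?case by (rule field_differentiable_mult[OF _ coord.IH])
qed (auto intro: field_differentiable_add)

lemma has_partial:
  assumes "G \<in> polyfuns S"
  shows "((\<lambda>t. G (y(k := t))) has_real_derivative partial k G y) (at (y k))"
  unfolding partial_def using polyfuns_differentiable[OF assms]
  by (simp add: field_differentiable_derivI)

lemma partial_eqI:
  "((\<lambda>t. G (y(k := t))) has_real_derivative d) (at (y k)) \<Longrightarrow> partial k G y = d"
  unfolding partial_def by (rule DERIV_imp_deriv)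

lemma partial_const: "partial k (\<lambda>y. a) = (\<lambda>y. 0)"
  by (rule ext, rule partial_eqI) auto

lemma partial_add:
  "G \<in> polyfuns S \<Longrightarrow> H \<in> polyfuns S \<Longrightarrow>
    partial k (\<lambda>y. G y + H y) = (\<lambda>y. partial k G y + partial k H y)"
  by (rule ext, rule partial_eqI) (intro DERIV_add has_partial; assumption)

lemma partial_mult:
  "G \<in> polyfuns S \<Longrightarrow> H \<in> polyfuns S \<Longrightarrow>
    partial k (\<lambda>y. G y * H y) = (\<lambda>y. partial k G y * H y + G y * partial k H y)"
  by (rule ext, rule partial_eqI)
    (rule derivative_eq_intros has_partial | assumption | simp)+

lemma partial_cmult:
  "G \<in> polyfuns S \<Longrightarrow> partial k (\<lambda>y. a * G y) = (\<lambda>y. a * partial k G y)"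
  by (rule ext, rule partial_eqI) (rule DERIV_cmult has_partial | assumption)+

lemma partial_poly:
  "partial k (\<lambda>y. poly p (y l)) = (\<lambda>y. if k = l then poly (pderiv p) (y l) else 0)"
  by (rule ext, rule partial_eqI) (auto intro: poly_DERIV)

lemma partial_proj: "partial k (\<lambda>y. y l) = (\<lambda>y. if k = l then 1 else 0)"
  by (rule ext, rule partial_eqI) auto

lemma partial_coord:
  assumes "l \<in> S" "G \<in> polyfuns S"
  shows "partial k (\<lambda>y. y l * G y) = (\<lambda>y. (if k = l then G y else 0) + y l * partial k G y)"
  by (subst partial_mult[OF polyfuns_proj[OF assms(1)] assms(2)]) (auto simp: partial_proj)

lemma partial_power:
  assumes "G \<in> polyfuns S"
  shows "partial k (\<lambda>y. G y ^ n) = (\<lambda>y. real n * G y ^ (n - 1) * partial k G y)"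
  by (rule ext, rule partial_eqI)
    (use DERIV_power[OF has_partial[OF assms]] in \<open>simp add: mult_ac\<close>)

lemma partial_sum:
  "finite T \<Longrightarrow> (\<And>i. i \<in> T \<Longrightarrow> G i \<in> polyfuns S) \<Longrightarrow>
    partial k (\<lambda>y. \<Sum>i\<in>T. G i y) = (\<lambda>y. \<Sum>i\<in>T. partial k (G i) y)"
  by (rule ext, rule partial_eqI,
      rule DERIV_sum[where f = "\<lambda>t i. G i (_(k := t))" and f' = "\<lambda>i. partial k (G i) _"])
    (rule has_partial, blast)

lemma partial_polyfuns: "G \<in> polyfuns S \<Longrightarrow> partial k G \<in> polyfuns S"
proof (induction rule: polyfuns.induct)
  case (coord l G)
  then show ?case
    by (subst partial_coord) (auto intro!: polyfuns.add polyfuns.coord polyfuns_if)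
qed (auto simp: partial_const partial_add intro: polyfuns.intros)

lemma partial_commute: "G \<in> polyfuns S \<Longrightarrow> partial k (partial l G) = partial l (partial k G)"
proof (induction rule: polyfuns.induct)
  case (add G H)
  then show ?case by (simp add: partial_add[of _ S] partial_polyfuns)
next
  case (coord j G)
  have *: "partial k (partial l (\<lambda>y. y j * G y)) =
      (\<lambda>y. (if l = j then partial k G y else 0) +
           ((if k = j then partial l G y else 0) + y j * partial k (partial l G) y))" for k l
  proof -
    have a: "(\<lambda>y. y j * partial l G y) \<in> polyfuns S"
      by (intro polyfuns.coord coord.hyps partial_polyfuns)
    have b: "(\<lambda>y. if l = j then G y else 0) \<in> polyfuns S"
      by (intro polyfuns_if coord.hyps)
    have c: "partial k (\<lambda>y. if l = j then G y else 0) = (\<lambda>y. if l = j then partial k G y else 0)"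
      by (auto simp: partial_const)
    show ?thesis
      unfolding partial_coord[OF coord.hyps] partial_add[OF b a] c
        partial_coord[OF coord.hyps(1) partial_polyfuns[OF coord.hyps(2)]] ..
  qed
  show ?case unfolding * using coord.IH by (auto simp: fun_eq_iff)
qed (simp add: partial_const)

section \<open>Moments of jointly Gaussian variables\<close>

text \<open>Random variables with moments of all orders form an algebra.\<close>

definition all_moments :: "'a measure \<Rightarrow> ('a \<Rightarrow> real) \<Rightarrow> bool" where
  "all_moments M Z \<longleftrightarrow> Z \<in> borel_measurable M \<and> (\<forall>n. integrable M (\<lambda>\<omega>. Z \<omega> ^ n))"

lemma all_moments_integrable: "all_moments M Z \<Longrightarrow> integrable M Z"
  unfolding all_moments_def using power_one_right[of "Z _"] by (metis (no_types, lifting) Bochner_Integration.integrable_cong power_one_right)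

lemma all_moments_integrable_mult:
  assumes "all_moments M Z" "all_moments M W"
  shows "integrable M (\<lambda>\<omega>. Z \<omega> ^ i * W \<omega> ^ j)"
proof (rule Bochner_Integration.integrable_bound)
  show "integrable M (\<lambda>\<omega>. Z \<omega> ^ (2 * i) + W \<omega> ^ (2 * j))"
    using assms unfolding all_moments_def by auto
  show "(\<lambda>\<omega>. Z \<omega> ^ i * W \<omega> ^ j) \<in> borel_measurable M"
    using assms unfolding all_moments_def by auto
  have "\<bar>a * b\<bar> \<le> a\<^sup>2 + b\<^sup>2" for a b :: real
  proof -
    have "0 \<le> \<bar>a\<bar> * \<bar>b\<bar>" by simp
    with sum_squares_bound[of "\<bar>a\<bar>" "\<bar>b\<bar>"] show ?thesis
      unfolding abs_mult power2_abs by linarith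
  qed
  then have "norm (Z \<omega> ^ i * W \<omega> ^ j) \<le> norm (Z \<omega> ^ (2 * i) + W \<omega> ^ (2 * j))" for \<omega>
    unfolding real_norm_def power_mult power2_eq_square[symmetric]
    by (metis abs_ge_self order_trans power_commuting_commutes power_even_eq power_mult)
  then show "AE \<omega> in M. norm (Z \<omega> ^ i * W \<omega> ^ j) \<le> norm (Z \<omega> ^ (2 * i) + W \<omega> ^ (2 * j))"
    by simp
qed

lemma all_moments_mult:
  assumes "all_moments M Z" "all_moments M W"
  shows "all_moments M (\<lambda>\<omega>. Z \<omega> * W \<omega>)"
  using all_moments_integrable_mult[OF assms] assms
  by (auto simp: all_moments_def power_mult_distrib)

lemma all_moments_add:
  assumes "all_moments M Z" "all_moments M W"
  shows "all_moments M (\<lambda>\<omega>. Z \<omega> + W \<omega>)"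
  using all_moments_integrable_mult[OF assms] assms
  by (auto simp: all_moments_def binomial_ring mult.assoc intro!: Bochner_Integration.integrable_sum)

lemma (in prob_space) all_moments_const: "all_moments M (\<lambda>\<omega>. a)"
  by (simp add: all_moments_def)

text \<open>Both kinds of centered Gaussian, normal and degenerate, satisfy the same two-step moment recursion.\<close>

lemma gaussian_moments:
  assumes "prob_space M" "gaussian_rv M Y" "(LINT \<omega>|M. Y \<omega>) = 0"
  shows "all_moments M Y"
    and "(LINT \<omega>|M. Y \<omega> ^ (n + 2)) = real (n + 1) * (LINT \<omega>|M. (Y \<omega>)\<^sup>2) * (LINT \<omega>|M. Y \<omega> ^ n)"
proof -
  interpret prob_space M by fact
  have Y[measurable]: "Y \<in> borel_measurable M" using assms(2) by (simp add: gaussian_rv_def)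
  consider (normal) \<mu> \<sigma> where "0 < \<sigma>" "distributed M lborel Y (normal_density \<mu> \<sigma>)"
    | (const) \<mu> where "AE \<omega> in M. Y \<omega> = \<mu>"
    using assms(2) by (auto simp: gaussian_rv_def)
  then have "all_moments M Y \<and>
    (LINT \<omega>|M. Y \<omega> ^ (n + 2)) = real (n + 1) * (LINT \<omega>|M. (Y \<omega>)\<^sup>2) * (LINT \<omega>|M. Y \<omega> ^ n)"
  proof cases
    case normal
    have "(LINT \<omega>|M. Y \<omega>) = (LINT x|lborel. normal_density \<mu> \<sigma> x * x)"
      by (rule distributed_integral[OF normal(2), symmetric]) auto
    then have \<mu>: "\<mu> = 0"
      using assms(3) integral_normal_moment_nz_1[OF normal(1), of \<mu>] by simp
    have int: "integrable M (\<lambda>\<omega>. Y \<omega> ^ n)" for n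
      using integrable_normal_moment[OF normal(1), of \<mu> n] \<mu>
      by (subst distributed_integrable[OF normal(2), symmetric]) auto
    have mom: "(LINT \<omega>|M. Y \<omega> ^ n) = (LINT x|lborel. normal_density \<mu> \<sigma> x * (x - \<mu>) ^ n)" for n
      using \<mu> by (subst distributed_integral[OF normal(2), symmetric]) auto
    have even: "(LINT \<omega>|M. Y \<omega> ^ (2 * k)) = fact (2 * k) / ((2 / \<sigma>\<^sup>2) ^ k * fact k)" for k
      unfolding mom by (rule integral_normal_moment_even[OF normal(1)])
    have odd: "(LINT \<omega>|M. Y \<omega> ^ (2 * k + 1)) = 0" for k
      unfolding mom by (rule integral_normal_moment_odd[OF normal(1)])
    have var: "(LINT \<omega>|M. (Y \<omega>)\<^sup>2) = \<sigma>\<^sup>2" using even[of 1] by simp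
    have "(LINT \<omega>|M. Y \<omega> ^ (n + 2)) = real (n + 1) * \<sigma>\<^sup>2 * (LINT \<omega>|M. Y \<omega> ^ n)"
    proof (cases "even n")
      case True
      then obtain k where k: "n = 2 * k" by (auto elim: evenE)
      have alg: "(2 * x + 2) * (2 * x + 1) * f / ((2 / s) ^ Suc k * ((x + 1) * g)) =
          (2 * x + 1) * s * (f / ((2 / s) ^ k * g))" if "0 \<le> x" "0 < s" for x s f g :: real
        using that by (simp add: divide_simps power_divide)
      have "fact (2 * Suc k) = (2 * real k + 2) * (2 * real k + 1) * (fact (2 * k) :: real)"
        by (simp add: algebra_simps)
      moreover have "fact (Suc k) = (real k + 1) * (fact k :: real)" by (simp add: algebra_simps)
      moreover have "2 * k + 2 = 2 * Suc k" by simp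
      ultimately show ?thesis
        using even[of k] even[of "Suc k"] alg[of "real k" "\<sigma>\<^sup>2"] normal(1) unfolding k
        by (simp del: power_Suc fact_Suc)
    next
      case False
      then obtain k where k: "n = 2 * k + 1" by (auto elim: oddE)
      then show ?thesis using odd[of k] odd[of "Suc k"] by (simp add: k)
    qed
    then show ?thesis using int var by (simp add: all_moments_def)
  next
    case const
    then have "(LINT \<omega>|M. Y \<omega>) = (LINT \<omega>|M. \<mu>)" by (intro integral_cong_AE) auto
    then have ae: "AE \<omega> in M. Y \<omega> = 0" using const assms(3) by (simp add: prob_space)
    have int: "integrable M (\<lambda>\<omega>. Y \<omega> ^ n)" for n
      by (rule integrable_cong_AE_imp[of M "\<lambda>_. 0 ^ n"]) (use ae in auto)
    have "(LINT \<omega>|M. Y \<omega> ^ n) = (LINT \<omega>|M. 0 ^ n)" for n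
      by (rule integral_cong_AE) (use ae in auto)
    then show ?thesis using int by (simp add: all_moments_def del: power_Suc add_2_eq_Suc')
  qed
  then show "all_moments M Y" and
    "(LINT \<omega>|M. Y \<omega> ^ (n + 2)) = real (n + 1) * (LINT \<omega>|M. (Y \<omega>)\<^sup>2) * (LINT \<omega>|M. Y \<omega> ^ n)"
    by auto
qed

locale isonormal = prob_space M for M :: "'a measure" +
  fixes X :: "'h::real_inner \<Rightarrow> 'a \<Rightarrow> real"
  assumes family: "gaussian_family M X"
    and mean: "expectation (X h) = 0"
    and covariance: "expectation (\<lambda>\<omega>. X h \<omega> * X g \<omega>) = inner h g"
begin

definition mean_of :: "(('h \<Rightarrow> real) \<Rightarrow> real) \<Rightarrow> real" where
  "mean_of G = expectation (\<lambda>\<omega>. G (\<lambda>k. X k \<omega>))"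

lemma gaussian_sum: "finite S \<Longrightarrow> gaussian_rv M (\<lambda>\<omega>. \<Sum>k\<in>S. \<theta> k * X k \<omega>)"
  using family by (simp add: gaussian_family_def)

lemma all_moments_X: "all_moments M (X h)"
  using gaussian_moments(1)[OF prob_space_axioms _ mean, of h] gaussian_sum[of "{h}" "\<lambda>_. 1"] by simp

lemma all_moments_polyfun: "G \<in> polyfuns S \<Longrightarrow> all_moments M (\<lambda>\<omega>. G (\<lambda>k. X k \<omega>))"
  by (induction rule: polyfuns.induct)
    (auto intro: all_moments_const all_moments_add all_moments_mult all_moments_X)

lemma integrable_polyfun: "G \<in> polyfuns S \<Longrightarrow> integrable M (\<lambda>\<omega>. G (\<lambda>k. X k \<omega>))"
  by (rule all_moments_integrable[OF all_moments_polyfun])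

lemma mean_of_add: "G \<in> polyfuns S \<Longrightarrow> H \<in> polyfuns S \<Longrightarrow> mean_of (\<lambda>y. G y + H y) = mean_of G + mean_of H"
  unfolding mean_of_def by (intro Bochner_Integration.integral_add integrable_polyfun)

lemma mean_of_cmult: "mean_of (\<lambda>y. a * G y) = a * mean_of G"
  unfolding mean_of_def by simp

lemma mean_of_sum:
  "(\<And>i. i \<in> T \<Longrightarrow> G i \<in> polyfuns S) \<Longrightarrow> mean_of (\<lambda>y. \<Sum>i\<in>T. G i y) = (\<Sum>i\<in>T. mean_of (G i))"
  unfolding mean_of_def by (rule Bochner_Integration.integral_sum) (rule integrable_polyfun)

lemma mean_of_proj: "mean_of (\<lambda>y. y h) = 0"
  unfolding mean_of_def by (rule mean)

lemma mean_of_const: "mean_of (\<lambda>y. a) = a"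
  unfolding mean_of_def by (simp add: prob_space)

text \<open>The coefficient of \<open>t\<close> in a binomial expansion.\<close>

lemma DERIV_mean_of_power:
  assumes Y: "Y \<in> polyfuns S" and Z: "Z \<in> polyfuns S" and Q: "Q \<in> polyfuns S"
  shows "((\<lambda>t. mean_of (\<lambda>y. (Y y + t * Z y) ^ a * Q y)) has_real_derivative
            real a * mean_of (\<lambda>y. Y y ^ (a - 1) * (Z y * Q y))) (at 0)"
proof -
  have expand: "mean_of (\<lambda>y. (Y y + t * Z y) ^ a * Q y) =
      (\<Sum>j\<le>a. t ^ j * (real (a choose j) * mean_of (\<lambda>y. Y y ^ (a - j) * (Z y ^ j * Q y))))" for t
  proof -
    have "mean_of (\<lambda>y. (Y y + t * Z y) ^ a * Q y) =
        mean_of (\<lambda>y. \<Sum>j\<le>a. (t ^ j * real (a choose j)) * (Y y ^ (a - j) * (Z y ^ j * Q y)))"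
      by (intro arg_cong[where f = mean_of] ext, subst add.commute)
        (simp add: binomial_ring sum_distrib_right sum_distrib_left power_mult_distrib mult_ac)
    also have "\<dots> = (\<Sum>j\<le>a. mean_of (\<lambda>y. (t ^ j * real (a choose j)) * (Y y ^ (a - j) * (Z y ^ j * Q y))))"
      by (rule mean_of_sum[where S = S]) (intro polyfuns_cmult polyfuns_mult polyfuns_power Y Z Q)
    finally show ?thesis by (simp only: mean_of_cmult mult.assoc)
  qed
  define b where "b j = real (a choose j) * mean_of (\<lambda>y. Y y ^ (a - j) * (Z y ^ j * Q y))" for j
  have "((\<lambda>t. \<Sum>j\<le>a. t ^ j * b j) has_real_derivative (\<Sum>j\<le>a. (real j * 0 ^ (j - 1)) * b j)) (at 0)"
    by (auto intro!: derivative_eq_intros sum.cong)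
  also have "(\<Sum>j\<le>a. (real j * 0 ^ (j - 1)) * b j) = (\<Sum>j\<le>a. if j = 1 then b 1 else 0)"
    by (intro sum.cong) (auto simp: power_0_left)
  also have "\<dots> = real a * mean_of (\<lambda>y. Y y ^ (a - 1) * (Z y * Q y))"
    by (cases a) (auto simp: b_def)
  finally show ?thesis unfolding expand b_def .
qed

text \<open>
  Integration by parts for powers of a linear form \<open>Y\<close>. Only the laws of single linear combinations are known, but
  for all of them: the moment recursion for \<open>Y + t X\<^sub>h\<close>, differentiated in \<open>t\<close>, yields the mixed moments of \<open>Y\<close>
  and \<open>X\<^sub>h\<close>.
\<close>

lemma mean_of_linear_gaussian:
  fixes S :: "'h set" and \<theta> :: "'h \<Rightarrow> real"
  assumes S: "finite S" and h: "h \<in> S"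
  defines "Y \<equiv> \<lambda>y. \<Sum>k\<in>S. \<theta> k * y k"
  defines "u \<equiv> \<Sum>k\<in>S. \<theta> k *\<^sub>R k"
  shows "mean_of (\<lambda>y. y h * Y y ^ a) = real a * inner h u * mean_of (\<lambda>y. Y y ^ (a - 1))"
proof -
  have polyY: "(\<lambda>y. \<Sum>k\<in>S. \<theta> k * y k) \<in> polyfuns S" for \<theta>
    by (intro polyfuns_sum polyfuns_cmult polyfuns_proj)
  note poly = polyY[of \<theta>, folded Y_def] polyfuns_proj[OF h]
  have cov: "mean_of (\<lambda>y. y k * Y y) = inner k u" if "k \<in> S" for k
  proof -
    have "mean_of (\<lambda>y. y k * Y y) = mean_of (\<lambda>y. \<Sum>l\<in>S. \<theta> l * (y k * y l))"
      by (auto simp: Y_def sum_distrib_left mult_ac intro!: arg_cong[where f = mean_of])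
    also have "\<dots> = (\<Sum>l\<in>S. \<theta> l * mean_of (\<lambda>y. y k * y l))"
      by (subst mean_of_sum[where S = S])
        (auto intro!: polyfuns_cmult polyfuns_mult polyfuns_proj that simp: mean_of_cmult)
    also have "\<dots> = inner k u"
      by (simp add: mean_of_def covariance u_def inner_sum_right)
    finally show ?thesis .
  qed
  have var: "mean_of (\<lambda>y. (\<Sum>k\<in>S. \<theta> k * y k)\<^sup>2) = inner (\<Sum>k\<in>S. \<theta> k *\<^sub>R k) (\<Sum>k\<in>S. \<theta> k *\<^sub>R k)" for \<theta>
  proof -
    have "mean_of (\<lambda>y. (\<Sum>k\<in>S. \<theta> k * y k)\<^sup>2) = mean_of (\<lambda>y. \<Sum>k\<in>S. \<Sum>l\<in>S. (\<theta> k * \<theta> l) * (y k * y l))"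
      by (auto simp: power2_eq_square sum_product mult_ac intro!: arg_cong[where f = mean_of])
    also have "\<dots> = (\<Sum>k\<in>S. \<Sum>l\<in>S. (\<theta> k * \<theta> l) * mean_of (\<lambda>y. y k * y l))"
      unfolding mean_of_cmult[symmetric]
      by (subst mean_of_sum[where S = S], intro polyfuns_sum polyfuns_cmult polyfuns_mult polyfuns_proj; assumption?)
        (intro sum.cong refl mean_of_sum[where S = S] polyfuns_cmult polyfuns_mult polyfuns_proj; assumption)
    also have "\<dots> = inner (\<Sum>k\<in>S. \<theta> k *\<^sub>R k) (\<Sum>k\<in>S. \<theta> k *\<^sub>R k)"
      by (simp add: mean_of_def covariance inner_sum_right inner_sum_left sum_distrib_left mult_ac)
        (simp add: inner_commute)
    finally show ?thesis .
  qed
  have moments: "mean_of (\<lambda>y. (\<Sum>k\<in>S. \<theta> k * y k) ^ (n + 2)) =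
      real (n + 1) * inner (\<Sum>k\<in>S. \<theta> k *\<^sub>R k) (\<Sum>k\<in>S. \<theta> k *\<^sub>R k) * mean_of (\<lambda>y. (\<Sum>k\<in>S. \<theta> k * y k) ^ n)" for n \<theta>
  proof -
    have "mean_of (\<lambda>y. \<Sum>k\<in>S. \<theta> k * y k) = 0"
      by (subst mean_of_sum[where S = S]) (auto intro!: polyfuns_cmult polyfuns_proj simp: mean_of_cmult mean_of_proj)
    then show ?thesis
      using gaussian_moments(2)[OF prob_space_axioms gaussian_sum[OF S, of \<theta>], of n]
      unfolding var[symmetric] by (simp add: mean_of_def)
  qed
  have shift: "(\<Sum>k\<in>S. (\<theta> k + (if k = h then t else 0)) * y k) = Y y + t * y h" for t y
    using S h by (simp add: Y_def distrib_right sum.distrib if_distrib[of "\<lambda>x. x * _"] cong: if_cong)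
  have shift': "(\<Sum>k\<in>S. (\<theta> k + (if k = h then t else 0)) *\<^sub>R k) = u + t *\<^sub>R h" for t
    using S h by (simp add: u_def scaleR_left_distrib sum.distrib if_distrib[of "\<lambda>x. x *\<^sub>R _"] cong: if_cong)
  have step: "real (n + 2) * mean_of (\<lambda>y. y h * Y y ^ (n + 1)) =
      real (n + 1) * (2 * inner h u * mean_of (\<lambda>y. Y y ^ n) +
        inner u u * (real n * mean_of (\<lambda>y. y h * Y y ^ (n - 1))))" for n
  proof -
    have D: "((\<lambda>t. mean_of (\<lambda>y. (Y y + t * y h) ^ a)) has_real_derivative
        real a * mean_of (\<lambda>y. y h * Y y ^ (a - 1))) (at 0)" for a
      using DERIV_mean_of_power[OF poly polyfuns.const[of 1], of a] by (simp add: mult.commute)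
    have "((\<lambda>t. inner (u + t *\<^sub>R h) (u + t *\<^sub>R h)) has_real_derivative 2 * inner h u) (at 0)"
      by (simp add: inner_add inner_commute) (auto intro!: derivative_eq_intros)
    from DERIV_mult[OF DERIV_cmult[OF this, of "real (n + 1)"] D[of n]]
    have "((\<lambda>t. real (n + 1) * inner (u + t *\<^sub>R h) (u + t *\<^sub>R h) * mean_of (\<lambda>y. (Y y + t * y h) ^ n))
        has_real_derivative real (n + 1) * (2 * inner h u * mean_of (\<lambda>y. Y y ^ n) +
        inner u u * (real n * mean_of (\<lambda>y. y h * Y y ^ (n - 1))))) (at 0)"
      by (simp add: algebra_simps)
    then have "((\<lambda>t. mean_of (\<lambda>y. (Y y + t * y h) ^ (n + 2)))
        has_real_derivative real (n + 1) * (2 * inner h u * mean_of (\<lambda>y. Y y ^ n) +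
        inner u u * (real n * mean_of (\<lambda>y. y h * Y y ^ (n - 1))))) (at 0)"
      using moments[of "\<lambda>k. \<theta> k + (if k = h then _ else 0)" n] unfolding shift shift' by simp
    from DERIV_unique[OF D[of "n + 2"] this] show ?thesis by simp
  qed
  show ?thesis
  proof (induction a rule: less_induct)
    case (less a)
    consider "a = 0" | "a = 1" | "a = 2" | n where "a = n + 1" "2 \<le> n" by (cases a; force)
    then show ?case
    proof cases
      case 4
      have "mean_of (\<lambda>y. y h * Y y ^ (n - 1)) = real (n - 1) * inner h u * mean_of (\<lambda>y. Y y ^ (n - 2))"
        using less.IH[of "n - 1"] 4 by (simp add: numeral_2_eq_2)
      moreover have "mean_of (\<lambda>y. Y y ^ n) = real (n - 1) * inner u u * mean_of (\<lambda>y. Y y ^ (n - 2))"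
        using moments[of \<theta> "n - 2"] 4(2) unfolding Y_def u_def
        by (simp del: power_Suc add_2_eq_Suc' add: le_add_diff_inverse2)
      ultimately have "real (n + 2) * mean_of (\<lambda>y. y h * Y y ^ (n + 1)) =
          real (n + 2) * (real (n + 1) * inner h u * mean_of (\<lambda>y. Y y ^ n))"
        unfolding step by (simp add: algebra_simps)
      then show ?thesis using 4 by simp
    next
      case 3
      have "mean_of Y = 0"
        unfolding Y_def
        by (subst mean_of_sum[where S = S]) (auto intro!: polyfuns_cmult polyfuns_proj simp: mean_of_cmult mean_of_proj)
      then show ?thesis using step[of 1] 3 by (simp add: mean_of_proj numeral_2_eq_2)
    qed (use cov[OF h] in \<open>simp_all add: mean_of_proj mean_of_const\<close>)
  qed
qed

text \<open>
  Gaussian integration by parts. The extra factor, a power of a linear form, is what makes the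
  induction on the polynomial work: replacing the form \<open>Y\<close> by \<open>Y + t X\<^sub>l\<close> and comparing the terms
  of first order in \<open>t\<close> trades one power of \<open>Y\<close> for a coordinate.
\<close>

lemma gaussian_ibp_power:
  fixes S :: "'h set"
  assumes S: "finite S" and h: "h \<in> S" and G: "G \<in> polyfuns S"
  shows "mean_of (\<lambda>y. y h * (\<Sum>k\<in>S. \<theta> k * y k) ^ a * G y) =
    real a * inner h (\<Sum>k\<in>S. \<theta> k *\<^sub>R k) * mean_of (\<lambda>y. (\<Sum>k\<in>S. \<theta> k * y k) ^ (a - 1) * G y)
    + (\<Sum>k\<in>S. inner h k * mean_of (\<lambda>y. (\<Sum>k\<in>S. \<theta> k * y k) ^ a * partial k G y))"
  using G
proof (induction arbitrary: \<theta> a rule: polyfuns.induct)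
  case (const c)
  have "(\<lambda>y. y h * (\<Sum>k\<in>S. \<theta> k * y k) ^ a * c) = (\<lambda>y. c * (y h * (\<Sum>k\<in>S. \<theta> k * y k) ^ a))"
    by (simp add: mult_ac)
  moreover have "(\<lambda>y. (\<Sum>k\<in>S. \<theta> k * y k) ^ (a - 1) * c) = (\<lambda>y. c * (\<Sum>k\<in>S. \<theta> k * y k) ^ (a - 1))"
    by (simp add: mult_ac)
  ultimately show ?case
    using mean_of_linear_gaussian[OF S h, of \<theta> a] by (simp only: mean_of_cmult) (simp add: partial_const mean_of_const)
next
  case (add G H)
  have Y: "(\<lambda>y. \<Sum>k\<in>S. \<theta> k * y k) \<in> polyfuns S"
    by (intro polyfuns_sum polyfuns_cmult polyfuns_proj)
  have split: "mean_of (\<lambda>y. A y * (B y + C y)) = mean_of (\<lambda>y. A y * B y) + mean_of (\<lambda>y. A y * C y)"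
    if "A \<in> polyfuns S" "B \<in> polyfuns S" "C \<in> polyfuns S" for A B C
    unfolding distrib_left by (rule mean_of_add[where S = S]) (intro polyfuns_mult that)+
  show ?case
    unfolding partial_add[OF add.hyps]
    by (subst (1 2 3) split)
      (auto intro!: polyfuns_mult polyfuns_power polyfuns_proj Y h add.hyps partial_polyfuns
        simp: add.IH distrib_left sum.distrib)
next
  case (coord l G)
  have poly: "(\<lambda>y. \<Sum>k\<in>S. \<theta> k * y k) \<in> polyfuns S" "(\<lambda>y. y l) \<in> polyfuns S"
    by (intro polyfuns_sum polyfuns_cmult polyfuns_proj; assumption)
      (rule polyfuns_proj[OF coord.hyps(1)])
  define Y where "Y = (\<lambda>y. \<Sum>k\<in>S. \<theta> k * y k)"
  define u where "u = (\<Sum>k\<in>S. \<theta> k *\<^sub>R k)"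
  have shift: "(\<Sum>k\<in>S. (\<theta> k + (if k = l then t else 0)) * y k) = Y y + t * y l" for t y
    using S coord.hyps
    by (simp add: Y_def distrib_right sum.distrib if_distrib[of "\<lambda>x. x * _"] cong: if_cong)
  have shift': "(\<Sum>k\<in>S. (\<theta> k + (if k = l then t else 0)) *\<^sub>R k) = u + t *\<^sub>R l" for t
    using S coord.hyps
    by (simp add: u_def scaleR_left_distrib sum.distrib if_distrib[of "\<lambda>x. x *\<^sub>R _"] cong: if_cong)
  note D = DERIV_mean_of_power[OF poly[folded Y_def]]
  have IH: "mean_of (\<lambda>y. (Y y + t * y l) ^ (a + 1) * (y h * G y)) =
      real (a + 1) * (inner h u + t * inner h l) * mean_of (\<lambda>y. (Y y + t * y l) ^ a * G y)
      + (\<Sum>k\<in>S. inner h k * mean_of (\<lambda>y. (Y y + t * y l) ^ (a + 1) * partial k G y))" for t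
    using coord.IH[of "\<lambda>k. \<theta> k + (if k = l then t else 0)" "a + 1"]
    unfolding shift shift' by (simp add: inner_add_right mult_ac)
  have "((\<lambda>t. real (a + 1) * (inner h u + t * inner h l) * mean_of (\<lambda>y. (Y y + t * y l) ^ a * G y)
      + (\<Sum>k\<in>S. inner h k * mean_of (\<lambda>y. (Y y + t * y l) ^ (a + 1) * partial k G y)))
      has_real_derivative
      real (a + 1) * (inner h l * mean_of (\<lambda>y. Y y ^ a * G y) +
        inner h u * (real a * mean_of (\<lambda>y. Y y ^ (a - 1) * (y l * G y))))
      + (\<Sum>k\<in>S. inner h k * (real (a + 1) * mean_of (\<lambda>y. Y y ^ a * (y l * partial k G y))))) (at 0)"
  proof -
    have "((\<lambda>t. real (a + 1) * (inner h u + t * inner h l)) has_real_derivative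
        real (a + 1) * inner h l) (at 0)"
      by (auto intro!: derivative_eq_intros)
    note A = DERIV_mult[OF this D[OF coord.hyps(2), of a]]
    have B: "((\<lambda>t. \<Sum>k\<in>S. inner h k * mean_of (\<lambda>y. (Y y + t * y l) ^ (a + 1) * partial k G y)) has_real_derivative
        (\<Sum>k\<in>S. inner h k * (real (a + 1) * mean_of (\<lambda>y. Y y ^ (a + 1 - 1) * (y l * partial k G y))))) (at 0)"
      by (intro DERIV_sum DERIV_cmult D[OF partial_polyfuns[OF coord.hyps(2)]])
    have eq: "real (a + 1) * inner h l * mean_of (\<lambda>y. (Y y + 0 * y l) ^ a * G y) +
        real a * mean_of (\<lambda>y. Y y ^ (a - 1) * (y l * G y)) * (real (a + 1) * (inner h u + 0 * inner h l)) =
        real (a + 1) * (inner h l * mean_of (\<lambda>y. Y y ^ a * G y) +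
        inner h u * (real a * mean_of (\<lambda>y. Y y ^ (a - 1) * (y l * G y))))"
    proof -
      have "c * p * A + r * B * (c * (w + 0 * p)) = c * (p * A + w * (r * B))" for c p A r B w :: real
        by (simp add: algebra_simps)
      then show ?thesis by (simp only: mult_zero_left add_0_right)
    qed
    show ?thesis using DERIV_add[OF A B] unfolding eq by simp
  qed
  from DERIV_unique[OF D[of "\<lambda>y. y h * G y" "a + 1"] this[folded IH]]
  have "real (a + 1) * mean_of (\<lambda>y. Y y ^ a * (y l * (y h * G y))) =
      real (a + 1) * (inner h l * mean_of (\<lambda>y. Y y ^ a * G y) +
        inner h u * (real a * mean_of (\<lambda>y. Y y ^ (a - 1) * (y l * G y)))
      + (\<Sum>k\<in>S. inner h k * mean_of (\<lambda>y. Y y ^ a * (y l * partial k G y))))"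
    using coord.hyps h
    by (simp add: polyfuns.coord sum_distrib_left algebra_simps)
  then have main: "mean_of (\<lambda>y. Y y ^ a * (y l * (y h * G y))) =
      inner h l * mean_of (\<lambda>y. Y y ^ a * G y) +
        inner h u * (real a * mean_of (\<lambda>y. Y y ^ (a - 1) * (y l * G y)))
      + (\<Sum>k\<in>S. inner h k * mean_of (\<lambda>y. Y y ^ a * (y l * partial k G y)))"
    by (subst (asm) mult_cancel_left) simp
  have "mean_of (\<lambda>y. Y y ^ a * partial k (\<lambda>y. y l * G y) y) =
      (if k = l then mean_of (\<lambda>y. Y y ^ a * G y) else 0) + mean_of (\<lambda>y. Y y ^ a * (y l * partial k G y))" for k
  proof -
    have "mean_of (\<lambda>y. Y y ^ a * partial k (\<lambda>y. y l * G y) y) =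
      mean_of (\<lambda>y. Y y ^ a * (if k = l then G y else 0)) + mean_of (\<lambda>y. Y y ^ a * (y l * partial k G y))"
      unfolding partial_coord[OF coord.hyps] distrib_left
      by (rule mean_of_add[where S = S])
        (intro polyfuns_mult polyfuns_power polyfuns_if polyfuns_proj coord.hyps partial_polyfuns
          poly[folded Y_def])+
    then show ?thesis by (auto simp: mean_of_const)
  qed
  then have "(\<Sum>k\<in>S. inner h k * mean_of (\<lambda>y. Y y ^ a * partial k (\<lambda>y. y l * G y) y)) =
      inner h l * mean_of (\<lambda>y. Y y ^ a * G y) + (\<Sum>k\<in>S. inner h k * mean_of (\<lambda>y. Y y ^ a * (y l * partial k G y)))"
    using S coord.hyps
    by (simp add: distrib_left sum.distrib if_distrib[of "\<lambda>x. _ * x"] cong: if_cong)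
  moreover have "(\<lambda>y. y h * Y y ^ a * (y l * G y)) = (\<lambda>y. Y y ^ a * (y l * (y h * G y)))"
    by (simp add: mult_ac)
  moreover have "(\<Sum>k\<in>S. \<theta> k * y k) = Y y" for y
    by (simp add: Y_def)
  ultimately show ?case using main unfolding u_def[symmetric] by simp
qed

lemma gaussian_ibp:
  fixes S :: "'h set"
  assumes "finite S" "h \<in> S" "G \<in> polyfuns S"
  shows "mean_of (\<lambda>y. y h * G y) = (\<Sum>k\<in>S. inner h k * mean_of (partial k G))"
  using gaussian_ibp_power[OF assms, of "\<lambda>_. 0" 0] by simp

end

lemma isonormal_processD: "isonormal_process M X \<Longrightarrow> isonormal M X"
  by (auto simp: isonormal_process_def isonormal_def isonormal_axioms_def)

section \<open>Pairing symmetric forms with derivatives of polynomials\<close>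

lemma fold_partial_polyfuns: "G \<in> polyfuns S \<Longrightarrow> fold partial hs G \<in> polyfuns S"
  by (induction hs arbitrary: G) (auto intro: partial_polyfuns)

lemma fold_partial_add:
  "G \<in> polyfuns S \<Longrightarrow> H \<in> polyfuns S \<Longrightarrow>
    fold partial hs (\<lambda>y. G y + H y) = (\<lambda>y. fold partial hs G y + fold partial hs H y)"
  by (induction hs arbitrary: G H) (auto simp: partial_add partial_polyfuns)

lemma fold_partial_cmult:
  "G \<in> polyfuns S \<Longrightarrow> fold partial hs (\<lambda>y. a * G y) = (\<lambda>y. a * fold partial hs G y)"
  by (induction hs arbitrary: G) (auto simp: partial_cmult partial_polyfuns)

lemma fold_partial_mset:
  "G \<in> polyfuns S \<Longrightarrow> mset hs = mset ks \<Longrightarrow> fold partial hs G = fold partial ks G"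
  by (rule fold_permuted_eq[where P = "\<lambda>G. G \<in> polyfuns S"])
    (auto intro: partial_polyfuns partial_commute)

context isonormal
begin

text \<open>
  This is \<open>E[G(X) I\<^sub>p(g)]\<close> after \<open>p\<close>-fold integration by parts, expressed without \<open>I\<^sub>p\<close>: the form \<open>g\<close> is only evaluated
  at the vectors on which \<open>G\<close> depends, because other derivatives of \<open>G\<close> vanish.
\<close>

definition pairing :: "'h set \<Rightarrow> nat \<Rightarrow> ('h list \<Rightarrow> real) \<Rightarrow> (('h \<Rightarrow> real) \<Rightarrow> real) \<Rightarrow> real" where
  "pairing S p g G = (\<Sum>hs\<in>tuples S p. g hs * mean_of (fold partial hs G))"

lemma pairing_0: "pairing S 0 g G = g [] * mean_of G"
  by (simp add: pairing_def tuples_0)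

lemma pairing_Suc:
  "pairing S (Suc p) g G = (\<Sum>h\<in>S. pairing S p (\<lambda>xs. g (h # xs)) (partial h G))"
  by (simp add: pairing_def sum_tuples_Suc)

lemma pairing_cong:
  "(\<And>xs. xs \<in> tuples S p \<Longrightarrow> g xs = g' xs) \<Longrightarrow> pairing S p g G = pairing S p g' G"
  by (simp add: pairing_def)

lemma pairing_add:
  assumes "G \<in> polyfuns S" "H \<in> polyfuns S"
  shows "pairing S p g (\<lambda>y. G y + H y) = pairing S p g G + pairing S p g H"
  by (simp add: pairing_def fold_partial_add[OF assms] mean_of_add[of _ S] fold_partial_polyfuns assms
      distrib_left sum.distrib)

lemma pairing_cmult:
  "G \<in> polyfuns S \<Longrightarrow> pairing S p g (\<lambda>y. a * G y) = a * pairing S p g G"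
  by (simp add: pairing_def fold_partial_cmult mean_of_cmult sum_distrib_left mult_ac)

lemma pairing_form_cmult: "pairing S p (\<lambda>xs. a * g xs) G = a * pairing S p g G"
  by (simp add: pairing_def sum_distrib_left mult_ac)

lemma pairing_form_sum:
  "pairing S p (\<lambda>xs. \<Sum>i\<in>T. g i xs) G = (\<Sum>i\<in>T. pairing S p (g i) G)"
  by (simp add: pairing_def sum_distrib_right) (rule sum.swap)

lemma pairing_const: "pairing S (Suc p) g (\<lambda>y. a) = 0"
proof -
  have "fold partial hs (\<lambda>y. 0) = (\<lambda>y. 0 :: real)" for hs :: "'h list"
    by (induction hs) (auto simp: partial_const)
  then show ?thesis by (simp add: pairing_Suc partial_const) (simp add: pairing_def mean_of_const)
qed

text \<open>Partial derivatives commute, so the pairing sees only the symmetric part of a form.\<close>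

lemma pairing_symmetrization:
  assumes G: "G \<in> polyfuns S"
  shows "pairing S p (symmetrization g) G = pairing S p g G"
proof -
  have "(\<Sum>hs\<in>tuples S p. g (permute_list \<pi> hs) * mean_of (fold partial hs G)) = pairing S p g G"
    if "\<pi> permutes {..<p}" for \<pi>
  proof -
    have "(\<Sum>hs\<in>tuples S p. g (permute_list \<pi> hs) * mean_of (fold partial hs G)) =
        (\<Sum>hs\<in>tuples S p. g (permute_list \<pi> hs) * mean_of (fold partial (permute_list \<pi> hs) G))"
      using that by (intro sum.cong refl arg_cong2[where f = "(*)"] arg_cong[where f = mean_of] fold_partial_mset[OF G])
        (auto simp: tuples_def)
    also have "\<dots> = pairing S p g G"
      unfolding pairing_def
      by (rule sum.reindex_bij_betw[OF bij_betw_permute_tuples[OF that],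
            of "\<lambda>hs. g hs * mean_of (fold partial hs G)"])
    finally show ?thesis .
  qed
  then have "(\<Sum>\<pi> | \<pi> permutes {..<p}. \<Sum>hs\<in>tuples S p. g (permute_list \<pi> hs) * mean_of (fold partial hs G))
      = fact p * pairing S p g G"
    using card_permutations[of "{..<p}" p] by simp
  moreover have "fact p * pairing S p (symmetrization g) G =
      (\<Sum>hs\<in>tuples S p. \<Sum>\<pi> | \<pi> permutes {..<p}. g (permute_list \<pi> hs) * mean_of (fold partial hs G))"
    unfolding pairing_def sum_distrib_left
    by (intro sum.cong) (auto simp: symmetrization_def tuples_def sum_distrib_right)
  ultimately show ?thesis by (subst (asm) sum.swap) simp
qed

text \<open>
  \<open>H\<^sub>m(X(h)) = I\<^sub>m(h \<otimes> \<dots> \<otimes> h)\<close>, seen through the pairing. In the step \<open>He\<^bsub>m+1\<^esub> = x He\<^sub>m - He\<^sub>m'\<close>, integrating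
  the factor \<open>x\<close> by parts produces a derivative of \<open>He\<^sub>m\<close> that cancels the second term, since \<open>h\<close> is a unit
  vector.
\<close>

lemma hermite_pairing:
  assumes S: "finite S" and h: "h \<in> S" "norm h = 1" and G: "G \<in> polyfuns S"
  shows "mean_of (\<lambda>y. poly (hermite_poly m) (y h) * G y) = pairing S m (\<lambda>xs. \<Prod>x\<leftarrow>xs. inner h x) G"
  using G
proof (induction m arbitrary: G)
  case 0
  then show ?case by (simp add: pairing_0)
next
  case (Suc m)
  note poly = polyfuns_poly[OF h(1)]
  let ?H = "\<lambda>y :: 'h \<Rightarrow> real. poly (hermite_poly m) (y h)"
  have hh: "inner h h = 1" using h(2) by (simp add: dot_square_norm)
  have part: "mean_of (partial k (\<lambda>y. ?H y * G y)) =
      (if k = h then mean_of (\<lambda>y. poly (pderiv (hermite_poly m)) (y h) * G y) else 0) + mean_of (\<lambda>y. ?H y * partial k G y)" for k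
    unfolding partial_mult[OF poly Suc.prems] partial_poly
    by (subst mean_of_add[where S = S]; (intro polyfuns_mult polyfuns_if poly Suc.prems partial_polyfuns)?)
      (auto simp: mean_of_const)
  have "mean_of (\<lambda>y. poly (hermite_poly (Suc m)) (y h) * G y) =
      mean_of (\<lambda>y. y h * (?H y * G y) + (- 1) * (poly (pderiv (hermite_poly m)) (y h) * G y))"
    by (simp add: algebra_simps)
  also have "\<dots> = mean_of (\<lambda>y. y h * (?H y * G y)) - mean_of (\<lambda>y. poly (pderiv (hermite_poly m)) (y h) * G y)"
    by (subst mean_of_add[where S = S]; (intro polyfuns.coord h polyfuns_cmult polyfuns_mult poly Suc.prems)?)
      (simp only: mean_of_cmult)
  also have "mean_of (\<lambda>y. y h * (?H y * G y)) = (\<Sum>k\<in>S. inner h k * mean_of (partial k (\<lambda>y. ?H y * G y)))"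
    by (intro gaussian_ibp S h polyfuns_mult poly Suc.prems)
  also have "\<dots> = mean_of (\<lambda>y. poly (pderiv (hermite_poly m)) (y h) * G y) +
      (\<Sum>k\<in>S. inner h k * mean_of (\<lambda>y. ?H y * partial k G y))"
    unfolding part using S h(1) hh
    by (simp add: distrib_left sum.distrib if_distrib[of "\<lambda>x. _ * x"] cong: if_cong)
  also have "\<dots> - mean_of (\<lambda>y. poly (pderiv (hermite_poly m)) (y h) * G y) =
      pairing S (Suc m) (\<lambda>xs. \<Prod>x\<leftarrow>xs. inner h x) G"
    by (simp add: pairing_Suc pairing_form_cmult Suc.IH partial_polyfuns Suc.prems)
  finally show ?case .
qed

text \<open>
  Expanding a product of a multiple integral and a Hermite polynomial into multiple integrals: \<open>r\<close> of
  the \<open>p\<close> slots of \<open>g\<close> are contracted with \<open>r\<close> of the \<open>m\<close> factors of the power of \<open>h\<close>, in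
  \<open>r! (p choose r) (m choose r)\<close> ways, and the remaining slots and factors act on \<open>G\<close>. The induction
  feeds the slots of \<open>g\<close> one after the other.
\<close>

lemma pairing_hermite_mult:
  assumes S: "finite S" and h: "h \<in> S" "norm h = 1" and G: "G \<in> polyfuns S" and g: "symmetric_form g"
  shows "pairing S p g (\<lambda>y. poly (hermite_poly m) (y h) * G y) =
    (\<Sum>r\<le>p. fact r * real (p choose r) * real (m choose r) *
      pairing S (p + m - 2 * r)
        (\<lambda>xs. g (take (p - r) xs @ replicate r h) * (\<Prod>x\<leftarrow>drop (p - r) xs. inner h x)) G)"
  using G g
proof (induction p arbitrary: g G m)
  case 0
  have "pairing S 0 g (\<lambda>y. poly (hermite_poly m) (y h) * G y) =
      g [] * pairing S m (\<lambda>xs. \<Prod>x\<leftarrow>xs. inner h x) G"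
    using hermite_pairing[OF S h 0(1)] by (simp add: pairing_0)
  then show ?case by (simp add: pairing_form_cmult)
next
  case (Suc p)
  note poly = polyfuns_poly[OF h(1)]
  note part = partial_polyfuns[OF Suc.prems(1)]
  let ?H = "\<lambda>m. \<lambda>y :: 'h \<Rightarrow> real. poly (hermite_poly m) (y h)"
  define T where "T m r k G = pairing S (p + m - 2 * r)
      (\<lambda>xs. g (k # take (p - r) xs @ replicate r h) * (\<Prod>x\<leftarrow>drop (p - r) xs. inner h x)) G" for m r k G
  define U where "U r = pairing S (Suc p + m - 2 * r)
      (\<lambda>xs. g (take (Suc p - r) xs @ replicate r h) * (\<Prod>x\<leftarrow>drop (Suc p - r) xs. inner h x)) G" for r
  have IH: "pairing S p (\<lambda>xs. g (k # xs)) (\<lambda>y. ?H m y * G y) =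
      (\<Sum>r\<le>p. fact r * real (p choose r) * real (m choose r) * T m r k G)"
    if "G \<in> polyfuns S" for k m G
    unfolding T_def by (rule Suc.IH[OF that symmetric_form_Cons[OF Suc.prems(2)]])
  have hm: "pderiv (hermite_poly m) = smult (real m) (hermite_poly (m - 1))"
    using pderiv_hermite_poly by (cases m) (simp_all add: of_nat_poly)
  have "pairing S p (\<lambda>xs. g (k # xs)) (partial k (\<lambda>y. ?H m y * G y)) =
     (if k = h then real m * pairing S p (\<lambda>xs. g (h # xs)) (\<lambda>y. ?H (m - 1) y * G y) else 0)
     + pairing S p (\<lambda>xs. g (k # xs)) (\<lambda>y. ?H m y * partial k G y)" for k
  proof -
    have "pairing S p (\<lambda>xs. g (k # xs)) (partial k (\<lambda>y. ?H m y * G y)) =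
      pairing S p (\<lambda>xs. g (k # xs)) (\<lambda>y. (if k = h then real m else 0) * (?H (m - 1) y * G y)) +
      pairing S p (\<lambda>xs. g (k # xs)) (\<lambda>y. ?H m y * partial k G y)"
      unfolding partial_mult[OF poly Suc.prems(1)] partial_poly hm
      by (subst pairing_add[symmetric])
        (auto intro!: polyfuns_mult polyfuns_cmult polyfuns_if polyfuns.const poly Suc.prems part arg_cong2[where f = "pairing S p"])
    then show ?thesis
      by (subst (asm) pairing_cmult) (auto intro!: polyfuns_mult poly Suc.prems)
  qed
  then have split: "pairing S (Suc p) g (\<lambda>y. ?H m y * G y) =
      real m * pairing S p (\<lambda>xs. g (h # xs)) (\<lambda>y. ?H (m - 1) y * G y)
      + (\<Sum>k\<in>S. pairing S p (\<lambda>xs. g (k # xs)) (\<lambda>y. ?H m y * partial k G y))"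
    using S h(1) by (simp add: pairing_Suc sum.distrib)
  have first: "real m * pairing S p (\<lambda>xs. g (h # xs)) (\<lambda>y. ?H (m - 1) y * G y) =
      (\<Sum>r\<le>p. fact (Suc r) * real (p choose r) * real (m choose Suc r) * U (Suc r))"
    unfolding IH[OF Suc.prems(1)] sum_distrib_left
  proof (intro sum.cong refl)
    fix r assume "r \<in> {..p}"
    have "g (h # take (p - r) xs @ replicate r h) = g (take (p - r) xs @ replicate (Suc r) h)" for xs
      by (rule symmetric_formD[OF Suc.prems(2)]) simp
    then have "0 < m \<Longrightarrow> T (m - 1) r h G = U (Suc r)"
      by (simp add: T_def U_def)
    moreover have "real m * real ((m - 1) choose r) = real (Suc r) * real (m choose Suc r)"
    proof (cases m)
      case (Suc n)
      have "m * ((m - 1) choose r) = Suc r * (m choose Suc r)"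
        using Suc_times_binomial_eq[of n r] by (simp only: Suc diff_Suc_1 mult.commute)
      then show ?thesis by (metis of_nat_mult)
    qed simp
    ultimately show "real m * (fact r * real (p choose r) * real (m - 1 choose r) * T (m - 1) r h G) =
        fact (Suc r) * real (p choose r) * real (m choose Suc r) * U (Suc r)"
      by (cases m) (simp_all add: mult_ac)
  qed
  have second: "(\<Sum>k\<in>S. pairing S p (\<lambda>xs. g (k # xs)) (\<lambda>y. ?H m y * partial k G y)) =
      (\<Sum>r\<le>p. fact r * real (p choose r) * real (m choose r) * U r)"
  proof -
    have "(\<Sum>k\<in>S. T m r k (partial k G)) = U r" if "r \<le> p" "r \<le> m" for r
    proof -
      have "Suc p + m - 2 * r = Suc (p + m - 2 * r)" "Suc p - r = Suc (p - r)" using that by auto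
      then show ?thesis by (simp add: U_def T_def pairing_Suc)
    qed
    then have "real (m choose r) * (\<Sum>k\<in>S. T m r k (partial k G)) = real (m choose r) * U r"
      if "r \<le> p" for r
      using that by (cases "r \<le> m") auto
    then have "(\<Sum>r\<le>p. fact r * real (p choose r) * (real (m choose r) * (\<Sum>k\<in>S. T m r k (partial k G)))) =
      (\<Sum>r\<le>p. fact r * real (p choose r) * (real (m choose r) * U r))"
      by (intro sum.cong) auto
    then show ?thesis
      unfolding IH[OF part] by (subst sum.swap) (simp add: sum_distrib_left mult_ac)
  qed
  \<comment> \<open>Pascal's rule merges the two contributions to each \<open>r\<close>.\<close>
  have "(\<Sum>r\<le>Suc p. fact r * real (Suc p choose r) * real (m choose r) * U r) =
      (\<Sum>r\<le>p. fact (Suc r) * real (p choose r) * real (m choose Suc r) * U (Suc r))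
      + (\<Sum>r\<le>Suc p. fact r * real (p choose r) * real (m choose r) * U r)"
    unfolding sum.atMost_Suc_shift by (simp add: sum.distrib algebra_simps)
  then show ?case unfolding split first second U_def by (simp add: binomial_eq_0)
qed

end

section \<open>Contraction paths\<close>

text \<open>
  Sequences of contractions with \<open>f\<close> that never ask for more slots than there are and never exhaust the tensor.
  Positivity of the orders is what keeps the truncated subtraction in \<open>tensor_order\<close> exact.
\<close>

definition admissible :: "nat \<Rightarrow> (nat \<Rightarrow> nat) \<Rightarrow> nat \<Rightarrow> bool" where
  "admissible q r a \<longleftrightarrow> (\<forall>i\<in>{1..a}.
     r i \<in> {1..q} \<and> r i \<le> tensor_order q r (i - 1) \<and> 0 < tensor_order q r i)"

definition contraction_paths :: "nat \<Rightarrow> nat \<Rightarrow> (nat \<Rightarrow> nat) set" where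
  "contraction_paths q a = {r \<in> {1..a} \<rightarrow>\<^sub>E {1..q}. admissible q r a}"

lemma finite_contraction_paths: "finite (contraction_paths q a)"
  unfolding contraction_paths_def by (rule finite_subset[OF _ finite_PiE[of "{1..a}" "\<lambda>_. {1..q}"]]) auto

lemma contraction_paths_0: "contraction_paths q 0 = {\<lambda>_. undefined}"
  by (auto simp: contraction_paths_def admissible_def)

lemma tensor_order_0: "tensor_order q r 0 = q"
  by (simp add: tensor_order_def)

lemma tensor_order_cong: "(\<And>i. i \<in> {1..a} \<Longrightarrow> r i = r' i) \<Longrightarrow> tensor_order q r a = tensor_order q r' a"
  unfolding tensor_order_def by (metis (mono_tags, lifting) sum.cong)

lemma iterated_contraction_cong:
  "(\<And>i. i \<in> {1..a} \<Longrightarrow> r i = r' i) \<Longrightarrow>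
    iterated_contraction E q f r a = iterated_contraction E q f r' a"
proof (induction a)
  case (Suc a)
  have "tensor_order q r a = tensor_order q r' a"
    by (rule tensor_order_cong) (use Suc.prems in auto)
  then show ?case using Suc by auto
qed simp

lemma cumulant_coeff_Suc:
  "cumulant_coeff q r (Suc a) = q * fact (r (Suc a) - 1) *
     ((tensor_order q r a - 1) choose (r (Suc a) - 1)) * ((q - 1) choose (r (Suc a) - 1)) *
     cumulant_coeff q r a"
  by (cases a) (simp_all add: tensor_order_def power2_eq_square Let_def)

lemma cumulant_coeff_cong:
  "(\<And>i. i \<in> {1..a} \<Longrightarrow> r i = r' i) \<Longrightarrow> cumulant_coeff q r a = cumulant_coeff q r' a"
proof (induction a)
  case (Suc a)
  have "tensor_order q r a = tensor_order q r' a"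
    by (rule tensor_order_cong) (use Suc.prems in auto)
  then show ?case using Suc by (auto simp: cumulant_coeff_Suc)
qed simp

lemma admissible_cong:
  assumes "\<And>i. i \<in> {1..a} \<Longrightarrow> r i = r' i"
  shows "admissible q r a = admissible q r' a"
proof -
  have "tensor_order q r i = tensor_order q r' i" if "i \<le> a" for i
    by (rule tensor_order_cong) (use assms that in auto)
  then show ?thesis unfolding admissible_def using assms by (intro ball_cong) auto
qed

lemma admissible_SucD: "admissible q r (Suc a) \<Longrightarrow> admissible q r a"
  by (auto simp: admissible_def)

lemma admissible_order_pos: "0 < q \<Longrightarrow> admissible q r a \<Longrightarrow> 0 < tensor_order q r a"
  by (cases a) (auto simp: admissible_def tensor_order_0)

lemma tensor_order_Suc:
  assumes "0 < tensor_order q r a" "r (Suc a) \<le> tensor_order q r a" "r (Suc a) \<le> q"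
  shows "tensor_order q r (Suc a) = tensor_order q r a + q - 2 * r (Suc a)"
  using assms by (simp add: tensor_order_def)

lemma admissible_Suc:
  assumes "0 < q"
  shows "admissible q r (Suc a) \<longleftrightarrow> admissible q r a \<and>
    r (Suc a) \<in> {1..min (tensor_order q r a) q} \<and> 0 < tensor_order q r a + q - 2 * r (Suc a)"
proof (cases "admissible q r a")
  case True
  then have "0 < tensor_order q r a" using assms by (rule admissible_order_pos[rotated])
  then show ?thesis
    using True tensor_order_Suc[of q r a]
    by (auto simp: admissible_def atLeastAtMostSuc_conv)
qed (auto dest: admissible_SucD)

lemma sum_contraction_paths_Suc:
  assumes "0 < q"
  shows "(\<Sum>r\<in>contraction_paths q (Suc a). \<phi> r) =
    (\<Sum>r\<in>contraction_paths q a.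
      \<Sum>x | x \<in> {1..min (tensor_order q r a) q} \<and> 0 < tensor_order q r a + q - 2 * x. \<phi> (r(Suc a := x)))"
proof -
  define B where "B r = {x. x \<in> {1..min (tensor_order q r a) q} \<and> 0 < tensor_order q r a + q - 2 * x}" for r
  have upd: "tensor_order q (r(Suc a := x)) a = tensor_order q r a"
    "admissible q (r(Suc a := x)) a = admissible q r a" for r x
    by (rule tensor_order_cong admissible_cong; simp)+
  have restr: "tensor_order q (restrict r {1..a}) a = tensor_order q r a"
    "admissible q (restrict r {1..a}) a = admissible q r a" for r
    by (rule tensor_order_cong admissible_cong; simp)+
  have "bij_betw (\<lambda>(r, x). r(Suc a := x)) (Sigma (contraction_paths q a) B) (contraction_paths q (Suc a))"
  proof (rule bij_betw_byWitness[where f' = "\<lambda>r. (restrict r {1..a}, r (Suc a))"])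
    show "\<forall>z\<in>Sigma (contraction_paths q a) B.
        (\<lambda>r. (restrict r {1..a}, r (Suc a))) ((\<lambda>(r, x). r(Suc a := x)) z) = z"
      by (auto simp: contraction_paths_def fun_eq_iff PiE_def extensional_def restrict_def)
    show "\<forall>r\<in>contraction_paths q (Suc a).
        (\<lambda>(r, x). r(Suc a := x)) ((\<lambda>r. (restrict r {1..a}, r (Suc a))) r) = r"
      by (auto simp: contraction_paths_def fun_eq_iff PiE_def extensional_def restrict_def)
    show "(\<lambda>(r, x). r(Suc a := x)) ` Sigma (contraction_paths q a) B \<subseteq> contraction_paths q (Suc a)"
      by (auto simp: contraction_paths_def B_def admissible_Suc[OF assms] upd PiE_def Pi_def extensional_def)
    show "(\<lambda>r. (restrict r {1..a}, r (Suc a))) ` contraction_paths q (Suc a) \<subseteq> Sigma (contraction_paths q a) B"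
      by (auto simp: contraction_paths_def B_def admissible_Suc[OF assms] restr[unfolded One_nat_def] PiE_def Pi_def extensional_def)
  qed
  from sum.reindex_bij_betw[OF this, of \<phi>]
  have "(\<Sum>r\<in>contraction_paths q (Suc a). \<phi> r) =
      (\<Sum>(r, x)\<in>Sigma (contraction_paths q a) B. \<phi> (r(Suc a := x)))"
    by (simp add: case_prod_unfold)
  also have "\<dots> = (\<Sum>r\<in>contraction_paths q a. \<Sum>x\<in>B r. \<phi> (r(Suc a := x)))"
    by (rule sum.Sigma[symmetric]) (auto simp: finite_contraction_paths B_def)
  finally show ?thesis by (simp add: B_def)
qed

text \<open>
  The index conditions read in terms of orders: the strict bounds on partial sums say that the intermediate orders are
  positive, the bounds on single entries that each contraction fits, and the prescribed total that the last order
  is \<open>q\<close>.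
\<close>

lemma cumulant_indices_eq:
  assumes "0 < q" "3 \<le> s"
  shows "cumulant_indices q s = {r \<in> contraction_paths q (s - 2). tensor_order q r (s - 2) = q}"
proof -
  define m where "m = s - 2"
  have s: "s - 2 = m" "s - 3 = m - 1" "1 \<le> m" using assms(2) by (auto simp: m_def)
  have "(real (\<Sum>i=1..m. r i) = real (m * q) / 2 \<and>
        (\<forall>a\<in>{1..m-1}. real (\<Sum>i=1..a. r i) < real ((a + 1) * q) / 2) \<and>
        (\<forall>a\<in>{2..m}. int (r a) \<le> int (a * q) - 2 * int (\<Sum>i=1..a-1. r i)))
     \<longleftrightarrow> admissible q r m \<and> tensor_order q r m = q" (is "?L \<longleftrightarrow> ?R")
    if r: "r \<in> {1..m} \<rightarrow>\<^sub>E {1..q}" for r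
  proof -
    define R where "R a = (\<Sum>i=1..a. r i)" for a
    have order: "tensor_order q r a = (a + 1) * q - 2 * R a" for a
      by (simp add: tensor_order_def R_def)
    have 1: "real (R a) = real b / 2 \<longleftrightarrow> 2 * R a = b" for a b by linarith
    have 2: "real (R a) < real b / 2 \<longleftrightarrow> 2 * R a < b" for a b by linarith
    have L: "?L \<longleftrightarrow> 2 * R m = m * q \<and> (\<forall>a\<in>{1..m-1}. 2 * R a < (a + 1) * q) \<and>
        (\<forall>a\<in>{2..m}. r a + 2 * R (a - 1) \<le> a * q)"
      unfolding R_def[symmetric] 1 2 by (intro conj_cong ball_cong refl) linarith
    show ?thesis
    proof
      assume ?L
      then have l: "2 * R m = m * q" "\<And>a. a \<in> {1..m-1} \<Longrightarrow> 2 * R a < (a + 1) * q"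
        "\<And>a. a \<in> {2..m} \<Longrightarrow> r a + 2 * R (a - 1) \<le> a * q"
        unfolding L by auto
      have om: "tensor_order q r m = q" using l(1) by (simp add: order)
      have "0 < tensor_order q r a" if "a \<in> {1..m}" for a
        using l(2)[of a] that om assms(1) by (cases "a = m") (auto simp: order)
      moreover have "r a \<le> tensor_order q r (a - 1)" if "a \<in> {1..m}" for a
      proof (cases "a = 1")
        case True
        then show ?thesis using r that by (auto simp: tensor_order_0 PiE_def Pi_def)
      next
        case False
        then show ?thesis using l(3)[of a] that by (auto simp: order)
      qed
      moreover have "r a \<in> {1..q}" if "a \<in> {1..m}" for a using r that by (rule PiE_mem)
      ultimately show ?R using om unfolding admissible_def by blast
    next
      assume ?R
      then have om: "tensor_order q r m = q" and
        ad: "\<And>a. a \<in> {1..m} \<Longrightarrow> r a \<le> tensor_order q r (a - 1) \<and> 0 < tensor_order q r a"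
        by (auto simp: admissible_def)
      have "2 * R m = m * q" using om assms(1) by (simp add: order)
      moreover have "2 * R a < (a + 1) * q" if "a \<in> {1..m-1}" for a
        using ad[of a] that by (auto simp: order)
      moreover have "r a + 2 * R (a - 1) \<le> a * q" if "a \<in> {2..m}" for a
      proof -
        have "tensor_order q r (a - 1) = a * q - 2 * R (a - 1)"
          using that by (cases a) (auto simp: order)
        moreover have "a \<in> {1..m}" "a - 1 \<in> {1..m}" using that by auto
        ultimately show ?thesis using ad[of a] ad[of "a - 1"] by linarith
      qed
      ultimately show ?L unfolding L by blast
    qed
  qed
  then show ?thesis
    unfolding cumulant_indices_def contraction_paths_def s by blast
qed

section \<open>The moment recursion for finite sums of Hermite polynomials\<close>

lemma contraction_full: "contraction E q q q g f [] = tensor_inner E q g f"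
  by (simp add: contraction_def tensor_inner_def)

lemma sym_contraction_full: "sym_contraction E q q q g f [] = tensor_inner E q g f"
  by (simp add: sym_contraction_def symmetrization_def contraction_full)

lemma iterated_hermite_tensor:
  fixes E S :: "'h::real_inner set"
  assumes E: "complete_orthonormal E" and S: "finite S" and q: "0 < q" and r: "admissible q r a"
  shows "iterated_contraction E q (hermite_tensor S c q) r a \<in> simple_tensors (tensor_order q r a)"
    and "symmetric_form (iterated_contraction E q (hermite_tensor S c q) r a)"
proof -
  show "iterated_contraction E q (hermite_tensor S c q) r a \<in> simple_tensors (tensor_order q r a)"
    using r
  proof (induction a)
    case 0
    show ?case by (simp add: tensor_order_0 hermite_tensor_simple)
  next
    case (Suc a)
    have a: "admissible q r a" "r (Suc a) \<le> tensor_order q r a" "r (Suc a) \<le> q" "0 < tensor_order q r a"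
      using Suc.prems admissible_order_pos[OF q] by (auto simp: admissible_Suc[OF q])
    then show ?case
      using symmetrization_simple[OF contraction_hermite_tensor_simple[OF E Suc.IH S]]
      by (simp add: sym_contraction_def tensor_order_Suc)
  qed
  show "symmetric_form (iterated_contraction E q (hermite_tensor S c q) r a)"
    by (cases a) (simp_all add: hermite_tensor_symmetric sym_contraction_def symmetric_form_symmetrization)
qed

text \<open>
  For \<open>I\<^sub>q(f)\<close> this is \<open>\<kappa>\<^bsub>a+2\<^esub> / (a+1)!\<close>: after \<open>a\<close> contractions that lead back to order \<open>q\<close>, a full contraction with \<open>f\<close> closes
  the path and contributes the factor \<open>q!\<close>.
\<close>

definition path_sum :: "'h::real_inner set \<Rightarrow> nat \<Rightarrow> 'h tensor \<Rightarrow> nat \<Rightarrow> real" where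
  "path_sum E q f a = fact q * (\<Sum>r | r \<in> contraction_paths q a \<and> tensor_order q r a = q.
     real (cumulant_coeff q r a) * tensor_inner E q (iterated_contraction E q f r a) f)"

context isonormal
begin

definition hermite_sum :: "'h set \<Rightarrow> ('h \<Rightarrow> real) \<Rightarrow> nat \<Rightarrow> ('h \<Rightarrow> real) \<Rightarrow> real" where
  "hermite_sum S c q = (\<lambda>y. \<Sum>h\<in>S. c h * poly (hermite_poly q) (y h))"

lemma hermite_sum_polyfuns: "hermite_sum S c q \<in> polyfuns S"
  unfolding hermite_sum_def by (intro polyfuns_sum polyfuns_cmult polyfuns_poly)

lemma partial_hermite_sum_power:
  assumes S: "finite S" "h \<in> S" and q: "0 < q"
  shows "partial h (\<lambda>y. hermite_sum S c q y ^ Suc n) =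
    (\<lambda>y. (real (Suc n) * real q * c h) * (poly (hermite_poly (q - 1)) (y h) * hermite_sum S c q y ^ n))"
proof -
  have "pderiv (hermite_poly q) = smult (real q) (hermite_poly (q - 1))"
    using pderiv_hermite_poly[of "q - 1"] q by (simp add: of_nat_poly del: hermite_poly.simps)
  moreover have "partial h (hermite_sum S c q) = (\<lambda>y. \<Sum>k\<in>S. c k * partial h (\<lambda>y. poly (hermite_poly q) (y k)) y)"
    unfolding hermite_sum_def
    by (subst partial_sum[where S = S]; (intro S polyfuns_cmult polyfuns_poly; assumption)?)
      (simp add: partial_cmult[OF polyfuns_poly])
  ultimately have "partial h (hermite_sum S c q) = (\<lambda>y. c h * (real q * poly (hermite_poly (q - 1)) (y h)))"
    using S by (simp add: partial_poly if_distrib[of "\<lambda>x. _ * x"] cong: if_cong)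
  then show ?thesis
    unfolding partial_power[OF hermite_sum_polyfuns] by (simp add: mult_ac del: hermite_poly.simps)
qed

text \<open>
  The key identity. The first slot of \<open>g\<close> differentiates one of the \<open>n + 1\<close> factors \<open>F\<close>, which turns
  \<open>H\<^sub>q(X(h))\<close> into \<open>q H\<^bsub>q-1\<^esub>(X(h))\<close> and fills that slot with \<open>h\<close>; multiplying by \<open>H\<^bsub>q-1\<^esub>(X(h))\<close> fills \<open>r - 1\<close>
  further slots with \<open>h\<close>. Summed over \<open>h\<close>, this is a contraction of \<open>g\<close> with the kernel of \<open>F\<close> in \<open>r\<close> slots.
\<close>

lemma pairing_hermite_sum_power:
  assumes E: "complete_orthonormal E" and S: "finite S" "\<And>h. h \<in> S \<Longrightarrow> norm h = 1" and q: "0 < q"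
    and g: "g \<in> simple_tensors (Suc p)" "symmetric_form g"
  shows "pairing S (Suc p) g (\<lambda>y. hermite_sum S c q y ^ Suc n) =
    real (Suc n) * (\<Sum>r\<in>{1..min (Suc p) q}.
      real (q * fact (r - 1) * (p choose (r - 1)) * ((q - 1) choose (r - 1))) *
      pairing S (Suc p + q - 2 * r) (sym_contraction E (Suc p) q r g (hermite_tensor S c q))
        (\<lambda>y. hermite_sum S c q y ^ n))"
proof -
  let ?G = "\<lambda>y. hermite_sum S c q y ^ n"
  have G: "?G \<in> polyfuns S" by (intro polyfuns_power hermite_sum_polyfuns)
  define K where "K r h xs = g (h # take (p - r) xs @ replicate r h) * (\<Prod>x\<leftarrow>drop (p - r) xs. inner h x)" for r h xs
  define \<psi> where "\<psi> r = real (q * fact (r - 1) * (p choose (r - 1)) * ((q - 1) choose (r - 1))) *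
      pairing S (Suc p + q - 2 * r) (sym_contraction E (Suc p) q r g (hermite_tensor S c q)) ?G" for r
  have merge: "(\<Sum>h\<in>S. c h * pairing S (p + (q - 1) - 2 * r) (K r h) ?G) =
      pairing S (Suc p + q - 2 * Suc r) (sym_contraction E (Suc p) q (Suc r) g (hermite_tensor S c q)) ?G"
    if r: "r \<le> p" "r \<le> q - 1" for r
  proof -
    have len: "p + (q - 1) - 2 * r = Suc p + q - 2 * Suc r" using q by simp
    have "(\<Sum>h\<in>S. c h * K r h xs) = contraction E (Suc p) q (Suc r) g (hermite_tensor S c q) xs"
      if "xs \<in> tuples S (Suc p + q - 2 * Suc r)" for xs
    proof -
      have "g (h # take (p - r) xs @ replicate r h) = g (take (p - r) xs @ replicate (Suc r) h)" for h
        by (rule symmetric_formD[OF g(2)]) simp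
      then show ?thesis
        using that r q by (subst contraction_hermite_tensor[OF E g(1) S(1)]) (auto simp: K_def tuples_def)
    qed
    then have "pairing S (Suc p + q - 2 * Suc r) (\<lambda>xs. \<Sum>h\<in>S. c h * K r h xs) ?G =
        pairing S (Suc p + q - 2 * Suc r) (contraction E (Suc p) q (Suc r) g (hermite_tensor S c q)) ?G"
      by (rule pairing_cong)
    then show ?thesis
      unfolding len sym_contraction_def pairing_symmetrization[OF G]
      by (simp add: pairing_form_sum pairing_form_cmult)
  qed
  have "pairing S (Suc p) g (\<lambda>y. hermite_sum S c q y ^ Suc n) =
    (\<Sum>h\<in>S. pairing S p (\<lambda>xs. g (h # xs))
      (\<lambda>y. (real (Suc n) * real q * c h) * (poly (hermite_poly (q - 1)) (y h) * ?G y)))"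
    unfolding pairing_Suc using S(1) q by (intro sum.cong) (auto simp only: partial_hermite_sum_power)
  also have "\<dots> = (\<Sum>h\<in>S. (real (Suc n) * real q * c h) *
      (\<Sum>r\<le>p. fact r * real (p choose r) * real ((q - 1) choose r) * pairing S (p + (q - 1) - 2 * r) (K r h) ?G))"
  proof (intro sum.cong refl)
    fix h assume h: "h \<in> S"
    show "pairing S p (\<lambda>xs. g (h # xs))
      (\<lambda>y. (real (Suc n) * real q * c h) * (poly (hermite_poly (q - 1)) (y h) * ?G y)) =
      (real (Suc n) * real q * c h) *
      (\<Sum>r\<le>p. fact r * real (p choose r) * real ((q - 1) choose r) * pairing S (p + (q - 1) - 2 * r) (K r h) ?G)"
      unfolding K_def
      by (subst pairing_cmult, intro polyfuns_mult polyfuns_poly h G)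
        (subst pairing_hermite_mult[OF S(1) h S(2)[OF h] G symmetric_form_Cons[OF g(2)]], rule refl)
  qed
  also have "\<dots> = real (Suc n) * (\<Sum>r\<le>p. real (q * fact r * (p choose r) * ((q - 1) choose r)) *
      (\<Sum>h\<in>S. c h * pairing S (p + (q - 1) - 2 * r) (K r h) ?G))"
    by (simp only: sum_distrib_left) (subst sum.swap, simp add: mult_ac)
  also have "(\<Sum>r\<le>p. real (q * fact r * (p choose r) * ((q - 1) choose r)) *
      (\<Sum>h\<in>S. c h * pairing S (p + (q - 1) - 2 * r) (K r h) ?G)) = (\<Sum>r\<le>p. \<psi> (Suc r))"
  proof (intro sum.cong refl)
    fix r assume r: "r \<in> {..p}"
    show "real (q * fact r * (p choose r) * ((q - 1) choose r)) *
      (\<Sum>h\<in>S. c h * pairing S (p + (q - 1) - 2 * r) (K r h) ?G) = \<psi> (Suc r)"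
    proof (cases "r \<le> q - 1")
      case True
      then show ?thesis using r merge[of r] by (simp only: \<psi>_def diff_Suc_1 atMost_iff)
    qed (simp add: \<psi>_def)
  qed
  also have "\<dots> = (\<Sum>r\<in>{1..Suc p}. \<psi> r)"
    by (rule sum.reindex_bij_witness[of _ "\<lambda>r. r - 1" Suc]) auto
  also have "\<dots> = (\<Sum>r\<in>{1..min (Suc p) q}. \<psi> r)"
    by (rule sum.mono_neutral_right) (auto simp: \<psi>_def not_le)
  finally show ?thesis unfolding \<psi>_def .
qed

text \<open>
  The identity above, applied \<open>a\<close> times to \<open>E[F\<^bsup>n+1\<^esup>] = E[F\<^sup>n I\<^sub>q(f)]\<close>. The first sum collects what has
  split off at order \<open>0\<close>, the second one runs over the paths that are still of positive order.
\<close>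

lemma hermite_sum_moment_unwind:
  fixes S :: "'h set" and c :: "'h \<Rightarrow> real"
  assumes E: "complete_orthonormal E" and S: "finite S" "\<And>h. h \<in> S \<Longrightarrow> norm h = 1" and q: "0 < q"
  defines "F \<equiv> hermite_sum S c q" and "f \<equiv> hermite_tensor S c q"
  shows "a \<le> n \<Longrightarrow> mean_of (\<lambda>y. F y ^ Suc n) =
    (\<Sum>j=1..a. fact n / fact (n - j) * path_sum E q f (j - 1) * mean_of (\<lambda>y. F y ^ (n - j))) +
    fact n / fact (n - a) * (\<Sum>r\<in>contraction_paths q a. real (cumulant_coeff q r a) *
      pairing S (tensor_order q r a) (iterated_contraction E q f r a) (\<lambda>y. F y ^ (n - a)))"
proof (induction a)
  case 0
  have F: "F \<in> polyfuns S" unfolding F_def by (rule hermite_sum_polyfuns)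
  have "mean_of (\<lambda>y. F y ^ Suc n) = mean_of (\<lambda>y. \<Sum>h\<in>S. c h * (poly (hermite_poly q) (y h) * F y ^ n))"
    by (simp add: F_def hermite_sum_def sum_distrib_right mult.assoc)
  also have "\<dots> = (\<Sum>h\<in>S. c h * mean_of (\<lambda>y. poly (hermite_poly q) (y h) * F y ^ n))"
    by (subst mean_of_sum[where S = S]; (intro polyfuns_cmult polyfuns_mult polyfuns_poly polyfuns_power F; assumption)?)
      (simp add: mean_of_cmult)
  also have "\<dots> = (\<Sum>h\<in>S. c h * pairing S q (\<lambda>xs. \<Prod>x\<leftarrow>xs. inner h x) (\<lambda>y. F y ^ n))"
    by (intro sum.cong refl) (simp add: hermite_pairing[OF S(1) _ S(2) polyfuns_power[OF F]])
  also have "\<dots> = pairing S q (\<lambda>xs. \<Sum>h\<in>S. c h * (\<Prod>x\<leftarrow>xs. inner h x)) (\<lambda>y. F y ^ n)"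
    by (simp add: pairing_form_sum pairing_form_cmult)
  also have "\<dots> = pairing S q f (\<lambda>y. F y ^ n)"
    by (rule pairing_cong) (simp add: f_def hermite_tensor_def elem_power_def tuples_def)
  finally show ?case by (simp add: contraction_paths_0 tensor_order_0)
next
  case (Suc a)
  define N where "N = n - Suc a"
  have N: "n - a = Suc N" using Suc.prems by (simp add: N_def)
  define P where "P r b = real (cumulant_coeff q r b) *
      pairing S (tensor_order q r b) (iterated_contraction E q f r b) (\<lambda>y. F y ^ (n - b))" for r b
  have step: "P r a = real (Suc N) * (
      (if tensor_order q r a = q then fact q * real (cumulant_coeff q r a) *
          tensor_inner E q (iterated_contraction E q f r a) f * mean_of (\<lambda>y. F y ^ N) else 0) +
      (\<Sum>x | x \<in> {1..min (tensor_order q r a) q} \<and> 0 < tensor_order q r a + q - 2 * x. P (r(Suc a := x)) (Suc a)))"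
    if "r \<in> contraction_paths q a" for r
  proof -
    have r: "admissible q r a" using that by (simp add: contraction_paths_def)
    define d where "d = tensor_order q r a"
    define g where "g = iterated_contraction E q f r a"
    have d: "0 < d" unfolding d_def using admissible_order_pos[OF q r] .
    obtain p where p: "d = Suc p" using d by (cases d) auto
    have g: "g \<in> simple_tensors (Suc p)" "symmetric_form g"
      using iterated_hermite_tensor[OF E S(1) q r, of c] p by (simp_all add: g_def f_def d_def)
    define \<psi> where "\<psi> x = real (q * fact (x - 1) * (p choose (x - 1)) * ((q - 1) choose (x - 1))) *
      (real (cumulant_coeff q r a) * pairing S (d + q - 2 * x) (sym_contraction E d q x g f) (\<lambda>y. F y ^ N))" for x
    have "P r a = real (cumulant_coeff q r a) * pairing S (Suc p) g (\<lambda>y. F y ^ Suc N)"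
      by (simp only: P_def N d_def[symmetric] g_def[symmetric] p)
    also have "\<dots> = real (Suc N) * (\<Sum>x\<in>{1..min d q}. \<psi> x)"
      using pairing_hermite_sum_power[OF E S q g, of c N]
      unfolding F_def[symmetric] f_def[symmetric] p[symmetric] \<psi>_def
      by (simp add: sum_distrib_left mult_ac)
    also have "(\<Sum>x\<in>{1..min d q}. \<psi> x) =
        (\<Sum>x | x \<in> {1..min d q} \<and> d + q - 2 * x = 0. \<psi> x) + (\<Sum>x | x \<in> {1..min d q} \<and> 0 < d + q - 2 * x. \<psi> x)"
      by (subst sum.union_disjoint[symmetric]) (auto intro!: sum.cong)
    \<comment> \<open>Order \<open>0\<close> forces \<open>2 x = d + q\<close>, and \<open>x\<close> is at most \<open>d\<close> and \<open>q\<close>.\<close>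
    also have "{x. x \<in> {1..min d q} \<and> d + q - 2 * x = 0} = (if d = q then {q} else {})"
      using q by auto
    also have "(\<Sum>x\<in>\<dots>. \<psi> x) = (if d = q then fact q * real (cumulant_coeff q r a) *
          tensor_inner E q g f * mean_of (\<lambda>y. F y ^ N) else 0)"
    proof -
      have "\<psi> q = fact q * real (cumulant_coeff q r a) * tensor_inner E q g f * mean_of (\<lambda>y. F y ^ N)" if "d = q"
      proof -
        have "q - 1 = p" using that p by simp
        then show ?thesis
          using that p fact_reduce[OF q, where 'a = real]
          by (simp add: \<psi>_def pairing_0 sym_contraction_full mult_ac)
      qed
      then show ?thesis by auto
    qed
    also have "(\<Sum>x | x \<in> {1..min d q} \<and> 0 < d + q - 2 * x. \<psi> x) =
        (\<Sum>x | x \<in> {1..min d q} \<and> 0 < d + q - 2 * x. P (r(Suc a := x)) (Suc a))"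
    proof (intro sum.cong refl)
      fix x assume x: "x \<in> {x. x \<in> {1..min d q} \<and> 0 < d + q - 2 * x}"
      let ?r = "r(Suc a := x)"
      have 1: "tensor_order q ?r a = d" unfolding d_def by (rule tensor_order_cong) simp
      have 2: "cumulant_coeff q ?r a = cumulant_coeff q r a" by (rule cumulant_coeff_cong) simp
      have 3: "iterated_contraction E q f ?r a = g" unfolding g_def by (rule iterated_contraction_cong) simp
      have 4: "tensor_order q ?r (Suc a) = d + q - 2 * x"
        using tensor_order_Suc[of q ?r a] x d by (simp add: 1)
      show "\<psi> x = P ?r (Suc a)"
        unfolding P_def \<psi>_def cumulant_coeff_Suc 4 iterated_contraction.simps 1 2 3 N_def
        by (simp add: p mult_ac)
    qed
    finally show ?thesis unfolding d_def g_def .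
  qed
  have "(\<Sum>r\<in>contraction_paths q a. P r a) =
    real (Suc N) * (path_sum E q f a * mean_of (\<lambda>y. F y ^ N) + (\<Sum>r\<in>contraction_paths q (Suc a). P r (Suc a)))"
  proof -
    have "(\<Sum>r\<in>contraction_paths q a. if tensor_order q r a = q then fact q * real (cumulant_coeff q r a) *
          tensor_inner E q (iterated_contraction E q f r a) f * mean_of (\<lambda>y. F y ^ N) else 0) =
        path_sum E q f a * mean_of (\<lambda>y. F y ^ N)"
      unfolding path_sum_def sum.inter_filter[OF finite_contraction_paths]
      by (auto simp: sum_distrib_left sum_distrib_right mult_ac intro!: sum.cong)
    then show ?thesis
      unfolding sum_contraction_paths_Suc[OF q] by (simp add: step sum.distrib flip: sum_distrib_left)
  qed
  moreover have "fact n / fact (n - a) * real (Suc N) = fact n / (fact (n - Suc a) :: real)"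
    unfolding N N_def[symmetric] by (simp add: divide_simps)
  ultimately have "fact n / fact (n - a) * (\<Sum>r\<in>contraction_paths q a. P r a) =
      fact n / fact (n - Suc a) * (path_sum E q f a * mean_of (\<lambda>y. F y ^ N) + (\<Sum>r\<in>contraction_paths q (Suc a). P r (Suc a)))"
    by (simp only: mult.assoc[symmetric])
  then show ?case
    using Suc.IH Suc.prems unfolding P_def by (simp add: N_def distrib_left mult.assoc)
qed

text \<open>After \<open>n\<close> steps no factor \<open>F\<close> is left, and a derivative of the constant \<open>1\<close> kills all remaining paths.\<close>

lemma hermite_sum_moment_recursion:
  fixes S :: "'h set" and c :: "'h \<Rightarrow> real"
  assumes E: "complete_orthonormal E" and S: "finite S" "\<And>h. h \<in> S \<Longrightarrow> norm h = 1" and q: "0 < q"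
  shows "mean_of (\<lambda>y. hermite_sum S c q y ^ Suc n) =
    (\<Sum>j=1..n. fact n / fact (n - j) * path_sum E q (hermite_tensor S c q) (j - 1) *
      mean_of (\<lambda>y. hermite_sum S c q y ^ (n - j)))"
proof -
  have "pairing S (tensor_order q r n) g (\<lambda>y. 1) = 0" if "r \<in> contraction_paths q n" for r g
  proof -
    have "0 < tensor_order q r n"
      using that admissible_order_pos[OF q] by (auto simp: contraction_paths_def)
    then obtain p where "tensor_order q r n = Suc p" by (auto simp: gr0_conv_Suc)
    then show ?thesis by (simp add: pairing_const)
  qed
  then show ?thesis
    using hermite_sum_moment_unwind[OF E S q order_refl, of c n] by simp
qed

end

section \<open>Continuity of contractions in the Hilbert-Schmidt norm\<close>

lemma cauchy_schwarz_infsum: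
  fixes f g :: "'a \<Rightarrow> real"
  assumes "(\<lambda>x. (f x)\<^sup>2) summable_on A" "(\<lambda>x. (g x)\<^sup>2) summable_on A"
  shows "(\<lambda>x. f x * g x) summable_on A"
    and "(\<Sum>\<^sub>\<infinity>x\<in>A. f x * g x)\<^sup>2 \<le> (\<Sum>\<^sub>\<infinity>x\<in>A. (f x)\<^sup>2) * (\<Sum>\<^sub>\<infinity>x\<in>A. (g x)\<^sup>2)"
proof -
  have "(\<lambda>x. norm (f x * f x)) summable_on A" "(\<lambda>x. norm (g x * g x)) summable_on A"
    using assms by (simp_all add: power2_eq_square)
  from abs_summable_product[OF this]
  show s: "(\<lambda>x. f x * g x) summable_on A" by (rule summable_on_iff_abs_summable_on_real[THEN iffD2])
  show "(\<Sum>\<^sub>\<infinity>x\<in>A. f x * g x)\<^sup>2 \<le> (\<Sum>\<^sub>\<infinity>x\<in>A. (f x)\<^sup>2) * (\<Sum>\<^sub>\<infinity>x\<in>A. (g x)\<^sup>2)"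
  proof (rule tendsto_upperbound)
    show "((\<lambda>F. (\<Sum>x\<in>F. f x * g x)\<^sup>2) \<longlongrightarrow> (\<Sum>\<^sub>\<infinity>x\<in>A. f x * g x)\<^sup>2) (finite_subsets_at_top A)"
      by (intro tendsto_power infsum_tendsto s)
    show "\<forall>\<^sub>F F in finite_subsets_at_top A.
        (\<Sum>x\<in>F. f x * g x)\<^sup>2 \<le> (\<Sum>\<^sub>\<infinity>x\<in>A. (f x)\<^sup>2) * (\<Sum>\<^sub>\<infinity>x\<in>A. (g x)\<^sup>2)"
    proof (rule eventually_finite_subsets_at_top_weakI)
      fix F assume F: "finite F" "F \<subseteq> A"
      have "(\<Sum>x\<in>F. f x * g x)\<^sup>2 \<le> (\<Sum>x\<in>F. (f x)\<^sup>2) * (\<Sum>x\<in>F. (g x)\<^sup>2)"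
        by (rule Cauchy_Schwarz_ineq_sum)
      also have "\<dots> \<le> (\<Sum>\<^sub>\<infinity>x\<in>A. (f x)\<^sup>2) * (\<Sum>\<^sub>\<infinity>x\<in>A. (g x)\<^sup>2)"
        by (intro mult_mono finite_sum_le_infsum assms F sum_nonneg infsum_nonneg) auto
      finally show "(\<Sum>x\<in>F. f x * g x)\<^sup>2 \<le> (\<Sum>\<^sub>\<infinity>x\<in>A. (f x)\<^sup>2) * (\<Sum>\<^sub>\<infinity>x\<in>A. (g x)\<^sup>2)" .
    qed
  qed simp
qed

text \<open>
  Convergence of tensors concerns only their values on tuples from \<open>E\<close>, that is, elements of \<open>\<ell>\<^sup>2\<close>. Working with the
  square of the norm avoids the triangle inequality: \<open>(a + b)\<^sup>2 \<le> 2 a\<^sup>2 + 2 b\<^sup>2\<close> is enough for limits.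
\<close>

definition sq_summable :: "'h set \<Rightarrow> nat \<Rightarrow> 'h tensor \<Rightarrow> bool" where
  "sq_summable E p g \<longleftrightarrow> (\<lambda>es. (g es)\<^sup>2) summable_on tuples E p"

definition sq_norm :: "'h set \<Rightarrow> nat \<Rightarrow> 'h tensor \<Rightarrow> real" where
  "sq_norm E p g = (\<Sum>\<^sub>\<infinity>es\<in>tuples E p. (g es)\<^sup>2)"

lemma sq_norm_nonneg: "0 \<le> sq_norm E p g"
  unfolding sq_norm_def by (rule infsum_nonneg) simp

lemma sq_summable_mono:
  assumes "sq_summable E p g" "sq_summable E p h"
    and "\<And>es. es \<in> tuples E p \<Longrightarrow> (f es)\<^sup>2 \<le> a * (g es)\<^sup>2 + b * (h es)\<^sup>2"
  shows "sq_summable E p f" "sq_norm E p f \<le> a * sq_norm E p g + b * sq_norm E p h"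
proof -
  have s: "((\<lambda>es. a * (g es)\<^sup>2 + b * (h es)\<^sup>2) has_sum (a * sq_norm E p g + b * sq_norm E p h)) (tuples E p)"
    unfolding sq_norm_def
    using assms(1,2) by (intro has_sum_add has_sum_cmult_right has_sum_infsum) (auto simp: sq_summable_def)
  show "sq_summable E p f"
    unfolding sq_summable_def
    by (rule summable_on_comparison_test[OF has_sum_imp_summable[OF s] assms(3)]) auto
  then show "sq_norm E p f \<le> a * sq_norm E p g + b * sq_norm E p h"
    unfolding sq_norm_def sq_summable_def
    by (intro has_sum_mono[OF has_sum_infsum s[unfolded sq_norm_def]] assms(3))
qed

lemma has_sum_diff_real:
  "(f has_sum (a::real)) A \<Longrightarrow> (g has_sum b) A \<Longrightarrow> ((\<lambda>x. f x - g x) has_sum (a - b)) A"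
  using has_sum_add[of f A a "\<lambda>x. - g x" "- b"] by (simp add: has_sum_uminusI)

lemma sum_sq_le: "(a + b)\<^sup>2 \<le> 2 * a\<^sup>2 + 2 * (b::real)\<^sup>2"
  using sum_squares_bound[of a b] by (simp add: power2_sum)

lemma diff_sq_le: "(a - b)\<^sup>2 \<le> 2 * a\<^sup>2 + 2 * (b::real)\<^sup>2"
  using sum_sq_le[of a "- b"] by simp

lemma sq_norm_add:
  assumes "sq_summable E p g" "sq_summable E p h"
  shows "sq_summable E p (\<lambda>xs. g xs + h xs)"
    and "sq_norm E p (\<lambda>xs. g xs + h xs) \<le> 2 * sq_norm E p g + 2 * sq_norm E p h"
  using sq_summable_mono[OF assms, of "\<lambda>xs. g xs + h xs" 2 2] sum_sq_le by auto

lemma sq_norm_diff: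
  assumes "sq_summable E p g" "sq_summable E p h"
  shows "sq_summable E p (\<lambda>xs. g xs - h xs)"
    and "sq_norm E p (\<lambda>xs. g xs - h xs) \<le> 2 * sq_norm E p g + 2 * sq_norm E p h"
  using sq_summable_mono[OF assms, of "\<lambda>xs. g xs - h xs" 2 2] diff_sq_le by auto

lemma sq_norm_split:
  assumes "sq_summable E (a + b) g"
  shows "xs \<in> tuples E a \<Longrightarrow> (\<lambda>es. (g (xs @ es))\<^sup>2) summable_on tuples E b"
    and "((\<lambda>xs. \<Sum>\<^sub>\<infinity>es\<in>tuples E b. (g (xs @ es))\<^sup>2) has_sum sq_norm E (a + b) g) (tuples E a)"
proof -
  have s: "(\<lambda>(xs, es). (g (xs @ es))\<^sup>2) summable_on tuples E a \<times> tuples E b"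
    using assms
      summable_on_reindex_bij_betw[OF bij_betw_append_tuples, of "\<lambda>zs. (g zs)\<^sup>2" E a b]
    by (simp add: sq_summable_def case_prod_unfold)
  show "xs \<in> tuples E a \<Longrightarrow> (\<lambda>es. (g (xs @ es))\<^sup>2) summable_on tuples E b"
    using summable_on_SigmaD1[OF s] .
  have "sq_norm E (a + b) g = (\<Sum>\<^sub>\<infinity>(xs, es)\<in>tuples E a \<times> tuples E b. (g (xs @ es))\<^sup>2)"
    using infsum_reindex_bij_betw[OF bij_betw_append_tuples, of "\<lambda>zs. (g zs)\<^sup>2" E a b]
    by (simp add: sq_norm_def case_prod_unfold)
  also have "\<dots> = (\<Sum>\<^sub>\<infinity>xs\<in>tuples E a. \<Sum>\<^sub>\<infinity>es\<in>tuples E b. (g (xs @ es))\<^sup>2)"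
    using infsum_Sigma'_banach[OF s] by simp
  finally show "((\<lambda>xs. \<Sum>\<^sub>\<infinity>es\<in>tuples E b. (g (xs @ es))\<^sup>2) has_sum sq_norm E (a + b) g) (tuples E a)"
    using summable_on_Sigma_banach[OF s] by (simp add: has_sum_iff)
qed

lemma contraction_append:
  assumes "r \<le> p" "r \<le> q" "length as = p - r" "length bs = q - r"
  shows "contraction E p q r g f (as @ bs) = (\<Sum>\<^sub>\<infinity>es\<in>tuples E r. g (as @ es) * f (bs @ es))"
  using assms by (simp add: contraction_def)

text \<open>
  By the Cauchy-Schwarz inequality in the contracted indices, the square of the contraction is dominated by a
  product of a function of the free indices of \<open>g\<close> and a function of those of \<open>f\<close>.
\<close>

lemma sq_norm_contraction:
  assumes g: "sq_summable E p g" and f: "sq_summable E q f" and r: "r \<le> p" "r \<le> q"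
  shows "sq_summable E (p + q - 2 * r) (contraction E p q r g f)"
    and "sq_norm E (p + q - 2 * r) (contraction E p q r g f) \<le> sq_norm E p g * sq_norm E q f"
proof -
  define \<alpha> where "\<alpha> as = (\<Sum>\<^sub>\<infinity>es\<in>tuples E r. (g (as @ es))\<^sup>2)" for as
  define \<beta> where "\<beta> bs = (\<Sum>\<^sub>\<infinity>es\<in>tuples E r. (f (bs @ es))\<^sup>2)" for bs
  let ?k = "contraction E p q r g f"
  have len: "p - r + (q - r) = p + q - 2 * r" using r by simp
  have gs: "sq_summable E (p - r + r) g" and fs: "sq_summable E (q - r + r) f"
    using g f r by simp_all
  note gs = sq_norm_split[OF gs] and fs = sq_norm_split[OF fs]
  have ab: "((\<lambda>(as, bs). \<alpha> as * \<beta> bs) has_sum sq_norm E p g * sq_norm E q f)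
      (tuples E (p - r) \<times> tuples E (q - r))"
    unfolding \<alpha>_def \<beta>_def using gs(2) fs(2) r by (intro has_sum_product_real) simp_all
  have le: "(?k (as @ bs))\<^sup>2 \<le> \<alpha> as * \<beta> bs"
    if "as \<in> tuples E (p - r)" "bs \<in> tuples E (q - r)" for as bs
  proof -
    have "?k (as @ bs) = (\<Sum>\<^sub>\<infinity>es\<in>tuples E r. g (as @ es) * f (bs @ es))"
      using that r by (intro contraction_append) (auto simp: tuples_def)
    then show ?thesis
      using cauchy_schwarz_infsum(2)[OF gs(1)[OF that(1)] fs(1)[OF that(2)]]
      by (simp add: \<alpha>_def \<beta>_def)
  qed
  have s: "(\<lambda>z. (?k (case z of (as, bs) \<Rightarrow> as @ bs))\<^sup>2) summable_on tuples E (p - r) \<times> tuples E (q - r)"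
    by (rule summable_on_comparison_test[OF has_sum_imp_summable[OF ab]]) (auto intro: le)
  show "sq_summable E (p + q - 2 * r) ?k"
    using s summable_on_reindex_bij_betw[OF bij_betw_append_tuples, of "\<lambda>zs. (?k zs)\<^sup>2" E "p - r" "q - r"]
    unfolding len by (simp add: sq_summable_def)
  have "sq_norm E (p + q - 2 * r) ?k =
      infsum (\<lambda>z. (?k (case z of (as, bs) \<Rightarrow> as @ bs))\<^sup>2) (tuples E (p - r) \<times> tuples E (q - r))"
    using infsum_reindex_bij_betw[OF bij_betw_append_tuples, of "\<lambda>zs. (?k zs)\<^sup>2" E "p - r" "q - r"]
    unfolding len by (simp add: sq_norm_def)
  also have "\<dots> \<le> sq_norm E p g * sq_norm E q f"
    by (rule has_sum_mono[OF has_sum_infsum[OF s] ab]) (auto intro: le)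
  finally show "sq_norm E (p + q - 2 * r) ?k \<le> sq_norm E p g * sq_norm E q f" .
qed

text \<open>Symmetrization averages rearrangements of the same norm, and the square is convex.\<close>

lemma sq_norm_symmetrization:
  assumes g: "sq_summable E p g"
  shows "sq_summable E p (symmetrization g)" "sq_norm E p (symmetrization g) \<le> sq_norm E p g"
proof -
  let ?P = "{\<pi>. \<pi> permutes {..<p}}"
  have fin: "finite ?P" by (rule finite_permutations) simp
  have card: "card ?P = fact p" by (rule card_permutations) auto
  have "((\<lambda>es. (g (permute_list \<pi> es))\<^sup>2) has_sum sq_norm E p g) (tuples E p)" if "\<pi> \<in> ?P" for \<pi>
    using g has_sum_reindex_bij_betw[OF bij_betw_permute_tuples, of \<pi> p "\<lambda>es. (g es)\<^sup>2" E] that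
    by (simp add: sq_norm_def sq_summable_def)
  from has_sum_cmult_right[OF has_sum_finite_sum[OF fin this], where c = "1 / fact p"]
  have s: "((\<lambda>es. 1 / fact p * (\<Sum>\<pi>\<in>?P. (g (permute_list \<pi> es))\<^sup>2)) has_sum sq_norm E p g) (tuples E p)"
    by (simp add: card)
  have le: "(symmetrization g es)\<^sup>2 \<le> 1 / fact p * (\<Sum>\<pi>\<in>?P. (g (permute_list \<pi> es))\<^sup>2)"
    if "es \<in> tuples E p" for es
  proof -
    have "(\<Sum>\<pi>\<in>?P. g (permute_list \<pi> es))\<^sup>2 \<le> (\<Sum>\<pi>\<in>?P. (g (permute_list \<pi> es))\<^sup>2) * fact p"
      using sum_squared_le_sum_of_squares[of "\<lambda>\<pi>. g (permute_list \<pi> es)" ?P] by (simp add: card)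
    then show ?thesis
      using that by (simp add: symmetrization_def tuples_def power_divide divide_simps power2_eq_square)
  qed
  show 1: "sq_summable E p (symmetrization g)"
    unfolding sq_summable_def
    by (rule summable_on_comparison_test[OF has_sum_imp_summable[OF s] le]) auto
  show "sq_norm E p (symmetrization g) \<le> sq_norm E p g"
    unfolding sq_norm_def using 1
    by (intro has_sum_mono[OF has_sum_infsum s[unfolded sq_norm_def]] le) (auto simp: sq_summable_def)
qed

definition sq_tendsto :: "'h set \<Rightarrow> nat \<Rightarrow> (nat \<Rightarrow> 'h tensor) \<Rightarrow> 'h tensor \<Rightarrow> bool" where
  "sq_tendsto E p gs g \<longleftrightarrow> (\<forall>k. sq_summable E p (gs k)) \<and> sq_summable E p g \<and>
     (\<lambda>k. sq_norm E p (\<lambda>xs. gs k xs - g xs)) \<longlonglongrightarrow> 0"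

lemma sq_tendsto_bounded:
  assumes "sq_tendsto E p gs g"
  obtains B where "\<And>k. sq_norm E p (gs k) \<le> B"
proof -
  have "convergent (\<lambda>k. sq_norm E p (\<lambda>xs. gs k xs - g xs))"
    using assms by (auto simp: sq_tendsto_def convergent_def)
  then have "Bseq (\<lambda>k. sq_norm E p (\<lambda>xs. gs k xs - g xs))" by (rule convergent_imp_Bseq)
  then obtain C where "\<forall>k. norm (sq_norm E p (\<lambda>xs. gs k xs - g xs)) \<le> C"
    unfolding Bseq_def by blast
  then have C: "norm (sq_norm E p (\<lambda>xs. gs k xs - g xs)) \<le> C" for k by blast
  have "sq_norm E p (gs k) \<le> 2 * C + 2 * sq_norm E p g" for k
  proof -
    have "sq_norm E p (\<lambda>xs. (gs k xs - g xs) + g xs) \<le>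
        2 * sq_norm E p (\<lambda>xs. gs k xs - g xs) + 2 * sq_norm E p g"
      using assms by (intro sq_norm_add sq_norm_diff) (auto simp: sq_tendsto_def)
    then show ?thesis using C[of k] by simp
  qed
  then show ?thesis by (rule that)
qed

lemma sq_tendsto_contraction:
  assumes g: "sq_tendsto E p gs g" and f: "sq_tendsto E q fs f" and r: "r \<le> p" "r \<le> q"
  shows "sq_tendsto E (p + q - 2 * r) (\<lambda>k. contraction E p q r (gs k) (fs k)) (contraction E p q r g f)"
proof -
  let ?n = "p + q - 2 * r" and ?C = "contraction E p q r"
  have gsum: "sq_summable E p (gs k)" "sq_summable E p g" "sq_summable E p (\<lambda>xs. gs k xs - g xs)" for k
    using g by (auto simp: sq_tendsto_def intro: sq_norm_diff)
  have fsum: "sq_summable E q (fs k)" "sq_summable E q f" "sq_summable E q (\<lambda>xs. fs k xs - f xs)" for k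
    using f by (auto simp: sq_tendsto_def intro: sq_norm_diff)
  note csum = sq_norm_contraction[OF _ _ r]
  obtain B where B: "\<And>k. sq_norm E q (fs k) \<le> B" by (rule sq_tendsto_bounded[OF f]) blast
  have split: "?C (gs k) (fs k) xs - ?C g f xs = ?C (\<lambda>xs. gs k xs - g xs) (fs k) xs + ?C g (\<lambda>xs. fs k xs - f xs) xs"
    if xs: "xs \<in> tuples E ?n" for k xs
  proof -
    define as bs where "as = take (p - r) xs" and "bs = drop (p - r) xs"
    have ab: "as \<in> tuples E (p - r)" "bs \<in> tuples E (q - r)" "xs = as @ bs"
      using xs r by (auto simp: as_def bs_def tuples_def dest: in_set_takeD in_set_dropD)
    have sum: "(\<lambda>es. u (as @ es) * v (bs @ es)) summable_on tuples E r"
      if "sq_summable E p u" "sq_summable E q v" for u v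
      using that r ab by (intro cauchy_schwarz_infsum sq_norm_split(1)[where a = "p - r"]
          sq_norm_split(1)[where a = "q - r"]) simp_all
    have app: "?C u v xs = (\<Sum>\<^sub>\<infinity>es\<in>tuples E r. u (as @ es) * v (bs @ es))" for u v
      using ab r by (simp add: contraction_append tuples_def)
    have "?C (\<lambda>xs. gs k xs - g xs) (fs k) xs = ?C (gs k) (fs k) xs - ?C g (fs k) xs"
      unfolding app left_diff_distrib
      by (rule infsumI) (intro has_sum_diff_real has_sum_infsum sum gsum fsum)
    moreover have "?C g (\<lambda>xs. fs k xs - f xs) xs = ?C g (fs k) xs - ?C g f xs"
      unfolding app right_diff_distrib
      by (rule infsumI) (intro has_sum_diff_real has_sum_infsum sum gsum fsum)
    ultimately show ?thesis by simp
  qed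
  have le: "sq_norm E ?n (\<lambda>xs. ?C (gs k) (fs k) xs - ?C g f xs) \<le>
      2 * (sq_norm E p (\<lambda>xs. gs k xs - g xs) * B) + 2 * (sq_norm E p g * sq_norm E q (\<lambda>xs. fs k xs - f xs))" for k
  proof -
    have "sq_norm E ?n (\<lambda>xs. ?C (gs k) (fs k) xs - ?C g f xs) =
        sq_norm E ?n (\<lambda>xs. ?C (\<lambda>xs. gs k xs - g xs) (fs k) xs + ?C g (\<lambda>xs. fs k xs - f xs) xs)"
      unfolding sq_norm_def by (intro infsum_cong) (simp add: split)
    also have "\<dots> \<le> 2 * sq_norm E ?n (?C (\<lambda>xs. gs k xs - g xs) (fs k)) + 2 * sq_norm E ?n (?C g (\<lambda>xs. fs k xs - f xs))"
      by (intro sq_norm_add csum gsum fsum)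
    also have "\<dots> \<le> 2 * (sq_norm E p (\<lambda>xs. gs k xs - g xs) * sq_norm E q (fs k)) +
        2 * (sq_norm E p g * sq_norm E q (\<lambda>xs. fs k xs - f xs))"
      by (intro add_mono mult_left_mono csum gsum fsum) auto
    also have "\<dots> \<le> 2 * (sq_norm E p (\<lambda>xs. gs k xs - g xs) * B) +
        2 * (sq_norm E p g * sq_norm E q (\<lambda>xs. fs k xs - f xs))"
      by (intro add_mono mult_left_mono B sq_norm_nonneg) auto
    finally show ?thesis .
  qed
  have lim: "(\<lambda>k. 2 * (sq_norm E p (\<lambda>xs. gs k xs - g xs) * B) +
      2 * (sq_norm E p g * sq_norm E q (\<lambda>xs. fs k xs - f xs))) \<longlonglongrightarrow> 2 * (0 * B) + 2 * (sq_norm E p g * 0)"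
    using g f by (intro tendsto_intros) (auto simp: sq_tendsto_def)
  have "(\<lambda>k. sq_norm E ?n (\<lambda>xs. ?C (gs k) (fs k) xs - ?C g f xs)) \<longlonglongrightarrow> 0"
    by (rule tendsto_sandwich[OF always_eventually always_eventually tendsto_const lim[simplified]])
      (simp_all add: sq_norm_nonneg le)
  then show ?thesis
    unfolding sq_tendsto_def by (auto intro: csum gsum fsum)
qed

lemma sq_tendsto_symmetrization:
  assumes "sq_tendsto E p gs g"
  shows "sq_tendsto E p (\<lambda>k. symmetrization (gs k)) (symmetrization g)"
proof -
  have sum: "sq_summable E p (gs k)" "sq_summable E p g" "sq_summable E p (\<lambda>xs. gs k xs - g xs)" for k
    using assms by (auto simp: sq_tendsto_def intro: sq_norm_diff)
  have "symmetrization (\<lambda>xs. gs k xs - g xs) = (\<lambda>xs. symmetrization (gs k) xs - symmetrization g xs)" for k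
    by (auto simp: symmetrization_def sum_subtractf diff_divide_distrib)
  then have le: "sq_norm E p (\<lambda>xs. symmetrization (gs k) xs - symmetrization g xs) \<le> sq_norm E p (\<lambda>xs. gs k xs - g xs)" for k
    using sq_norm_symmetrization(2)[OF sum(3)[of k]] by simp
  have lim: "(\<lambda>k. sq_norm E p (\<lambda>xs. gs k xs - g xs)) \<longlonglongrightarrow> 0"
    using assms by (simp add: sq_tendsto_def)
  have "(\<lambda>k. sq_norm E p (\<lambda>xs. symmetrization (gs k) xs - symmetrization g xs)) \<longlonglongrightarrow> 0"
    by (rule tendsto_sandwich[OF always_eventually always_eventually tendsto_const lim])
      (simp_all add: sq_norm_nonneg le)
  then show ?thesis unfolding sq_tendsto_def by (auto intro: sq_norm_symmetrization sum)
qed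

lemma sq_tendsto_0D:
  assumes "sq_tendsto E 0 gs g"
  shows "(\<lambda>k. gs k []) \<longlonglongrightarrow> g []"
proof -
  have "(\<lambda>k. (gs k [] - g [])\<^sup>2) \<longlonglongrightarrow> 0"
    using assms by (simp add: sq_tendsto_def sq_norm_def tuples_0)
  then have "(\<lambda>k. gs k [] - g []) \<longlonglongrightarrow> 0"
    by simp
  then show ?thesis by (rule LIM_zero_cancel)
qed

lemma sq_tendsto_iterated_contraction:
  assumes f: "sq_tendsto E q fs f" and q: "0 < q" and r: "admissible q r a"
  shows "sq_tendsto E (tensor_order q r a) (\<lambda>k. iterated_contraction E q (fs k) r a) (iterated_contraction E q f r a)"
  using r
proof (induction a)
  case 0
  then show ?case using f by (simp add: tensor_order_0)
next
  case (Suc a)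
  have a: "admissible q r a" "r (Suc a) \<le> tensor_order q r a" "r (Suc a) \<le> q" "0 < tensor_order q r a"
    using Suc.prems admissible_order_pos[OF q] by (auto simp: admissible_Suc[OF q])
  then show ?case
    using sq_tendsto_symmetrization[OF sq_tendsto_contraction[OF Suc.IH f]]
    by (simp add: sym_contraction_def tensor_order_Suc)
qed

text \<open>Inner products need no separate argument: they are contractions to order \<open>0\<close>.\<close>

lemma path_sum_tendsto:
  assumes f: "sq_tendsto E q fs f" and q: "0 < q"
  shows "(\<lambda>k. path_sum E q (fs k) a) \<longlonglongrightarrow> path_sum E q f a"
  unfolding path_sum_def
proof (intro tendsto_intros)
  fix r assume "r \<in> {r \<in> contraction_paths q a. tensor_order q r a = q}"
  then have r: "admissible q r a" "tensor_order q r a = q" by (auto simp: contraction_paths_def)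
  from sq_tendsto_iterated_contraction[OF f q r(1)]
  have "sq_tendsto E q (\<lambda>k. iterated_contraction E q (fs k) r a) (iterated_contraction E q f r a)"
    by (simp add: r(2))
  from sq_tendsto_contraction[OF this f order_refl order_refl]
  show "(\<lambda>k. tensor_inner E q (iterated_contraction E q (fs k) r a) (fs k)) \<longlonglongrightarrow>
      tensor_inner E q (iterated_contraction E q f r a) f"
    by (auto dest!: sq_tendsto_0D simp: contraction_full)
qed

section \<open>Cumulants and moments\<close>

text \<open>The \<open>n\<close>th derivative of the characteristic function.\<close>

definition char_moment :: "'a measure \<Rightarrow> ('a \<Rightarrow> real) \<Rightarrow> nat \<Rightarrow> real \<Rightarrow> complex" where
  "char_moment M Y n t = (LINT \<omega>|M. (\<i> * of_real (Y \<omega>)) ^ n * iexp (t * Y \<omega>))"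

lemma all_moments_abs: "all_moments M Y \<Longrightarrow> integrable M (\<lambda>\<omega>. \<bar>Y \<omega>\<bar> ^ n)"
  using integrable_norm[of M "\<lambda>\<omega>. Y \<omega> ^ n"] by (simp add: all_moments_def power_abs)

lemma integrable_char_moment:
  assumes "all_moments M Y"
  shows "integrable M (\<lambda>\<omega>. (\<i> * of_real (Y \<omega>)) ^ n * iexp (t * Y \<omega>))"
proof (rule Bochner_Integration.integrable_bound[OF all_moments_abs[OF assms, of n]])
  have [measurable]: "Y \<in> borel_measurable M" using assms by (simp add: all_moments_def)
  show "(\<lambda>\<omega>. (\<i> * of_real (Y \<omega>)) ^ n * iexp (t * Y \<omega>)) \<in> borel_measurable M" by measurable
qed (simp add: norm_mult norm_power)

lemma char_moment_derivative:
  assumes Y: "all_moments M Y"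
  shows "(char_moment M Y n has_vector_derivative char_moment M Y (Suc n) t) (at t)"
  unfolding has_vector_derivative_def
proof (rule has_derivativeI_sandwich[where e = 1])
  define C where "C = (LINT \<omega>|M. \<bar>Y \<omega>\<bar> ^ (n + 2)) / 2"
  show "bounded_linear (\<lambda>h. h *\<^sub>R char_moment M Y (Suc n) t)"
    by (rule bounded_linear_scaleR_left)
  show "((\<lambda>s. \<bar>s - t\<bar> * C) \<longlongrightarrow> 0) (at t)"
    by (rule tendsto_eq_intros | simp)+
  fix s :: real assume "s \<noteq> t"
  define h where "h = s - t"
  note int = integrable_char_moment[OF Y]
  let ?a = "\<lambda>\<omega>. (\<i> * of_real (Y \<omega>)) ^ n * iexp (t * Y \<omega>)"
  have eq: "(\<i> * of_real (Y \<omega>)) ^ n * iexp (s * Y \<omega>) - ?a \<omega> -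
      of_real h * ((\<i> * of_real (Y \<omega>)) ^ Suc n * iexp (t * Y \<omega>)) =
      ?a \<omega> * (iexp (h * Y \<omega>) - (1 + \<i> * of_real (h * Y \<omega>)))" for \<omega>
  proof -
    have "iexp (s * Y \<omega>) = iexp (t * Y \<omega>) * iexp (h * Y \<omega>)"
      by (simp add: h_def algebra_simps flip: exp_add)
    then show ?thesis by (simp add: algebra_simps)
  qed
  have bound: "norm (?a \<omega> * (iexp (h * Y \<omega>) - (1 + \<i> * of_real (h * Y \<omega>)))) \<le> h\<^sup>2 / 2 * \<bar>Y \<omega>\<bar> ^ (n + 2)" for \<omega>
  proof -
    have "cmod (iexp (h * Y \<omega>) - (1 + \<i> * of_real (h * Y \<omega>))) \<le> \<bar>h * Y \<omega>\<bar>\<^sup>2 / 2"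
      using iexp_approx1[of "h * Y \<omega>" 1] by (simp add: numeral_2_eq_2)
    from mult_left_mono[OF this, of "\<bar>Y \<omega>\<bar> ^ n"] show ?thesis
      by (simp add: norm_mult norm_power abs_mult power_mult_distrib power_add power2_eq_square mult_ac)
  qed
  have "char_moment M Y n s - char_moment M Y n t - (s - t) *\<^sub>R char_moment M Y (Suc n) t =
      (LINT \<omega>|M. ?a \<omega> * (iexp (h * Y \<omega>) - (1 + \<i> * of_real (h * Y \<omega>))))"
    unfolding char_moment_def scaleR_conv_of_real h_def[symmetric] eq[symmetric]
    using int by (subst Bochner_Integration.integral_diff Bochner_Integration.integral_mult_right;
        (intro Bochner_Integration.integrable_diff integrable_mult_right int)?)+ simp
  also have "norm \<dots> \<le> (LINT \<omega>|M. h\<^sup>2 / 2 * \<bar>Y \<omega>\<bar> ^ (n + 2))"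
  proof (rule order_trans[OF integral_norm_bound integral_mono])
    show "integrable M (\<lambda>\<omega>. norm (?a \<omega> * (iexp (h * Y \<omega>) - (1 + \<i> * of_real (h * Y \<omega>)))))"
      unfolding eq[symmetric] by (intro integrable_norm Bochner_Integration.integrable_diff integrable_mult_right int)
    show "integrable M (\<lambda>\<omega>. h\<^sup>2 / 2 * \<bar>Y \<omega>\<bar> ^ (n + 2))"
      by (intro integrable_mult_right all_moments_abs Y)
  qed (rule bound)
  also have "\<dots> = h\<^sup>2 / 2 * (LINT \<omega>|M. \<bar>Y \<omega>\<bar> ^ (n + 2))"
    by (rule integral_mult_right_zero)
  also have "\<dots> = \<bar>s - t\<bar> * (\<bar>s - t\<bar> * C)"
    by (simp only: C_def h_def[symmetric] mult.assoc[symmetric] abs_mult_self_eq power2_eq_square) simp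
  finally show "norm (char_moment M Y n s - char_moment M Y n t - (s - t) *\<^sub>R char_moment M Y (Suc n) t) /
      norm (s - t) \<le> \<bar>s - t\<bar> * C"
    using \<open>s \<noteq> t\<close> by (simp add: divide_simps mult_ac)
qed simp

lemma char_eq_char_moment:
  assumes "Y \<in> borel_measurable M"
  shows "char (distr M borel Y) t = char_moment M Y 0 t"
  unfolding char_def char_moment_def using assms by (subst integral_distr) auto

lemma char_moment_at_0: "char_moment M Y n 0 = \<i> ^ n * of_real (LINT \<omega>|M. Y \<omega> ^ n)"
proof -
  have "char_moment M Y n 0 = (LINT \<omega>|M. \<i> ^ n * complex_of_real (Y \<omega> ^ n))"
    by (simp add: char_moment_def power_mult_distrib)
  also have "\<dots> = \<i> ^ n * (LINT \<omega>|M. complex_of_real (Y \<omega> ^ n))"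
    by (rule integral_mult_right_zero)
  finally show ?thesis by (simp only: integral_complex_of_real)
qed

text \<open>
  The combinatorial step of Leibniz' rule, separated from the analysis; \<open>G j\<close> and \<open>\<phi> j\<close> stand for derivatives of order \<open>j\<close>.
\<close>

lemma leibniz_sum_step:
  fixes G \<phi> :: "nat \<Rightarrow> complex"
  shows "(\<Sum>j\<le>n. of_nat (n choose j) * (G (j + 1) * \<phi> (n - j + 1) + G (j + 2) * \<phi> (n - j))) =
    (\<Sum>j\<le>Suc n. of_nat (Suc n choose j) * (G (j + 1) * \<phi> (Suc n - j)))"
proof -
  have a: "(\<Sum>j\<le>n. of_nat (n choose j) * (G (j + 1) * \<phi> (n - j + 1))) =
      (\<Sum>j\<le>Suc n. of_nat (n choose j) * (G (j + 1) * \<phi> (Suc n - j)))"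
    by (simp add: Suc_diff_le)
  have "(\<Sum>j\<le>Suc n. of_nat (Suc n choose j) * (G (j + 1) * \<phi> (Suc n - j))) =
      (\<Sum>j\<le>Suc n. of_nat (n choose j) * (G (j + 1) * \<phi> (Suc n - j))) +
      (\<Sum>j\<le>n. of_nat (n choose j) * (G (j + 2) * \<phi> (n - j)))"
    unfolding sum.atMost_Suc_shift by (simp add: distrib_right sum.distrib algebra_simps)
  then show ?thesis by (simp only: distrib_left sum.distrib a)
qed

lemma has_vector_derivative_sum_mult:
  fixes g f :: "nat \<Rightarrow> real \<Rightarrow> complex"
  assumes "\<And>j. j \<in> A \<Longrightarrow> (g j has_vector_derivative g' j) (at t)"
    and "\<And>j. j \<in> A \<Longrightarrow> (f j has_vector_derivative f' j) (at t)"
  shows "((\<lambda>t. \<Sum>j\<in>A. c j * (g j t * f j t)) has_vector_derivative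
    (\<Sum>j\<in>A. c j * (g j t * f' j + g' j * f j t))) (at t)"
  by (intro has_vector_derivative_sum has_vector_derivative_mult_right has_vector_derivative_mult assms)

text \<open>
  The equation \<open>\<phi>' = (log \<phi>)' \<phi>\<close> differentiated \<open>n\<close> times. Smoothness of \<open>log \<phi>\<close> near \<open>0\<close> comes out of the same induction:
  the identity of order \<open>n\<close> expresses the derivative of order \<open>n + 1\<close> of \<open>log \<phi>\<close> by lower ones, hence that
  derivative is again differentiable.
\<close>

lemma log_char_leibniz:
  assumes M: "prob_space M" and Y: "all_moments M Y"
  defines "G \<equiv> \<lambda>j. ((\<lambda>g t. vector_derivative g (at t)) ^^ j) (\<lambda>t. Ln (char (distr M borel Y) t))"
  shows "char_moment M Y (Suc n) 0 = (\<Sum>j\<le>n. of_nat (n choose j) * (G (j + 1) 0 * char_moment M Y (n - j) 0))"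
proof -
  interpret prob_space M by fact
  define \<phi> where "\<phi> = char_moment M Y"
  define U where "U = {t. \<phi> 0 t \<notin> \<real>\<^sub>\<le>\<^sub>0}"
  have D\<phi>: "(\<phi> n has_vector_derivative \<phi> (Suc n) t) (at t)" for n t
    unfolding \<phi>_def by (rule char_moment_derivative[OF Y])
  have G0: "G 0 = (\<lambda>t. Ln (\<phi> 0 t))"
    using Y by (simp add: G_def \<phi>_def char_eq_char_moment all_moments_def)
  have GS: "G (Suc j) t = vector_derivative (G j) (at t)" for j t
    by (simp add: G_def)
  have "continuous_on UNIV (\<phi> 0)"
    using D\<phi>[of 0] by (intro continuous_at_imp_continuous_on) (auto intro: has_vector_derivative_continuous)
  then have "open ((\<phi> 0) -` (- \<real>\<^sub>\<le>\<^sub>0))"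
    by (rule open_vimage[rotated]) (simp add: open_Compl)
  then have U: "open U" by (simp add: U_def vimage_def)
  have nz: "\<phi> 0 t \<noteq> 0" if "t \<in> U" for t using that by (auto simp: U_def)
  have "0 \<in> U" by (simp add: U_def \<phi>_def char_moment_at_0 prob_space)
  have GD: "(G j has_vector_derivative G (Suc j) t) (at t)" if "(G j has_vector_derivative d) (at t)" for j t d
    using that vector_derivative_at[OF that] by (simp add: GS)
  have main: "(\<forall>k\<le>n. \<forall>t\<in>U. (G k has_vector_derivative G (Suc k) t) (at t)) \<and>
      (\<forall>t\<in>U. \<phi> (Suc n) t = (\<Sum>j\<le>n. of_nat (n choose j) * (G (j + 1) t * \<phi> (n - j) t)))" for n
  proof (induction n)
    case 0
    have d: "(G 0 has_vector_derivative \<phi> 1 t * inverse (\<phi> 0 t)) (at t)" if "t \<in> U" for t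
      using field_vector_diff_chain_at[OF D\<phi>[of 0 t] has_field_derivative_Ln] that
      by (simp add: G0 o_def U_def)
    have "G 1 t = \<phi> 1 t * inverse (\<phi> 0 t)" if "t \<in> U" for t
      using vector_derivative_at[OF d[OF that]] by (simp add: GS)
    then show ?case using d nz by (auto simp: GS intro!: GD)
  next
    case (Suc n)
    then have IHD: "\<And>k t. k \<le> n \<Longrightarrow> t \<in> U \<Longrightarrow> (G k has_vector_derivative G (Suc k) t) (at t)"
      and IHL: "\<And>t. t \<in> U \<Longrightarrow> \<phi> (Suc n) t = (\<Sum>j\<le>n. of_nat (n choose j) * (G (j + 1) t * \<phi> (n - j) t))"
      by auto
    \<comment> \<open>The identity of order \<open>n\<close>, solved for the term of highest order.\<close>
    define R where "R t = (\<phi> (Suc n) t - (\<Sum>j<n. of_nat (n choose j) * (G (j + 1) t * \<phi> (n - j) t))) * inverse (\<phi> 0 t)" for t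
    have GR: "G (Suc n) t = R t" if "t \<in> U" for t
      using IHL[OF that] nz[OF that] by (simp add: R_def lessThan_Suc_atMost[symmetric])
    have "\<exists>d. (G (Suc n) has_vector_derivative d) (at t)" if t: "t \<in> U" for t
    proof -
      have "(G (j + 1) has_vector_derivative G (j + 2) t) (at t)" if "j \<in> {..<n}" for j
        using IHD[of "j + 1" t] that t by simp
      note d1 = has_vector_derivative_sum_mult[where g = "\<lambda>j. G (j + 1)" and f = "\<lambda>j. \<phi> (n - j)"
          and f' = "\<lambda>j. \<phi> (Suc (n - j)) t" and c = "\<lambda>j. of_nat (n choose j)", OF this D\<phi>]
      have "(inverse has_field_derivative - (inverse (\<phi> 0 t) * inverse (\<phi> 0 t))) (at (\<phi> 0 t))"
        using DERIV_inverse[OF nz[OF t]] by (simp add: power2_eq_square)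
      from field_vector_diff_chain_at[OF D\<phi>[of 0 t] this]
      obtain d2 where d2: "((\<lambda>t. inverse (\<phi> 0 t)) has_vector_derivative d2) (at t)" by (auto simp: o_def)
      have "(R has_vector_derivative (\<phi> (Suc n) t - (\<Sum>j<n. of_nat (n choose j) * (G (j + 1) t * \<phi> (n - j) t))) * d2 +
          (\<phi> (Suc (Suc n)) t - (\<Sum>j<n. of_nat (n choose j) *
            (G (j + 1) t * \<phi> (Suc (n - j)) t + G (j + 2) t * \<phi> (n - j) t))) * inverse (\<phi> 0 t)) (at t)"
        unfolding R_def
        by (rule has_vector_derivative_mult[OF has_vector_derivative_diff[OF D\<phi>[of "Suc n" t] d1] d2])
      from has_vector_derivative_transform_within_open[OF this U t GR[symmetric]] show ?thesis by blast
    qed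
    then have DS: "(G (Suc n) has_vector_derivative G (Suc (Suc n)) t) (at t)" if "t \<in> U" for t
      using that GD by blast
    then have D: "(G k has_vector_derivative G (Suc k) t) (at t)" if "k \<le> Suc n" "t \<in> U" for k t
      using IHD that by (cases "k = Suc n") auto
    have "\<phi> (Suc (Suc n)) t = (\<Sum>j\<le>Suc n. of_nat (Suc n choose j) * (G (j + 1) t * \<phi> (Suc n - j) t))" if t: "t \<in> U" for t
    proof -
      have "((\<lambda>t. \<Sum>j\<le>n. of_nat (n choose j) * (G (j + 1) t * \<phi> (n - j) t)) has_vector_derivative
          (\<Sum>j\<le>n. of_nat (n choose j) * (G (j + 1) t * \<phi> (n - j + 1) t + G (j + 2) t * \<phi> (n - j) t))) (at t)"
      proof (rule has_vector_derivative_sum_mult)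
        show "(G (j + 1) has_vector_derivative G (j + 2) t) (at t)" if "j \<in> {..n}" for j
          using D[of "j + 1" t] that t by simp
        show "(\<phi> (n - j) has_vector_derivative \<phi> (n - j + 1) t) (at t)" for j
          using D\<phi>[of "n - j" t] by simp
      qed
      then have "(\<phi> (Suc n) has_vector_derivative
          (\<Sum>j\<le>n. of_nat (n choose j) * (G (j + 1) t * \<phi> (n - j + 1) t + G (j + 2) t * \<phi> (n - j) t))) (at t)"
        by (rule has_vector_derivative_transform_within_open[OF _ U t]) (simp add: IHL)
      from vector_derivative_unique_at[OF D\<phi> this] show ?thesis
        by (simp only: leibniz_sum_step[where G = "\<lambda>j. G j t" and \<phi> = "\<lambda>j. \<phi> j t"])
    qed
    then show ?case using D by blast
  qed
  then show ?thesis using \<open>0 \<in> U\<close> unfolding \<phi>_def by blast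
qed

lemma moment_cumulant_recursion:
  assumes M: "prob_space M" and Y: "all_moments M Y"
  shows "of_real (LINT \<omega>|M. Y \<omega> ^ Suc n) =
    (\<Sum>j\<le>n. of_nat (n choose j) * (cumulant M Y (j + 1) * of_real (LINT \<omega>|M. Y \<omega> ^ (n - j))))"
proof -
  define G where "G = (\<lambda>j. ((\<lambda>g t. vector_derivative g (at t)) ^^ j) (\<lambda>t. Ln (char (distr M borel Y) t)))"
  have ii: "(\<i>::complex) ^ k * (- \<i>) ^ k = 1" for k by (simp flip: power_mult_distrib)
  have G: "G j 0 = \<i> ^ j * cumulant M Y j" for j
    using ii[of j] by (simp add: cumulant_def G_def flip: mult.assoc)
  have "\<i> ^ Suc n * of_real (LINT \<omega>|M. Y \<omega> ^ Suc n) =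
      (\<Sum>j\<le>n. of_nat (n choose j) * ((\<i> ^ (j + 1) * cumulant M Y (j + 1)) *
        (\<i> ^ (n - j) * of_real (LINT \<omega>|M. Y \<omega> ^ (n - j)))))"
  proof -
    have "char_moment M Y (Suc n) 0 = (\<Sum>j\<le>n. of_nat (n choose j) * (G (j + 1) 0 * char_moment M Y (n - j) 0))"
      using log_char_leibniz[OF M Y, of n] unfolding G_def .
    then show ?thesis unfolding char_moment_at_0 G .
  qed
  also have "\<dots> = (\<Sum>j\<le>n. \<i> ^ Suc n * (of_nat (n choose j) *
      (cumulant M Y (j + 1) * of_real (LINT \<omega>|M. Y \<omega> ^ (n - j)))))"
  proof (intro sum.cong refl)
    fix j assume "j \<in> {..n}"
    then have "\<i> ^ Suc n = \<i> ^ (j + 1) * \<i> ^ (n - j)" by (simp flip: power_add)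
    then show "of_nat (n choose j) * ((\<i> ^ (j + 1) * cumulant M Y (j + 1)) *
        (\<i> ^ (n - j) * of_real (LINT \<omega>|M. Y \<omega> ^ (n - j)))) =
        \<i> ^ Suc n * (of_nat (n choose j) * (cumulant M Y (j + 1) * of_real (LINT \<omega>|M. Y \<omega> ^ (n - j))))"
      by (simp only: mult_ac)
  qed
  finally show ?thesis by (simp flip: sum_distrib_left)
qed

text \<open>
  In the recursion of order \<open>n\<close> the cumulant of order \<open>n + 1\<close> enters with coefficient \<open>1\<close>, so the moments determine
  the cumulants.
\<close>

lemma cumulant_eqI:
  assumes M: "prob_space M" and Y: "all_moments M Y"
    and rec: "\<And>n. (LINT \<omega>|M. Y \<omega> ^ Suc n) = (\<Sum>j\<le>n. real (n choose j) * (K j * (LINT \<omega>|M. Y \<omega> ^ (n - j))))"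
  shows "cumulant M Y (Suc n) = of_real (K n)"
proof (induction n rule: less_induct)
  case (less n)
  let ?m = "\<lambda>n. LINT \<omega>|M. Y \<omega> ^ n"
  have m0: "?m 0 = 1" using prob_space.prob_space[OF M] by simp
  have "of_real (?m (Suc n)) = (\<Sum>j<n. of_nat (n choose j) * (cumulant M Y (j + 1) * of_real (?m (n - j)))) +
      cumulant M Y (Suc n)"
    using moment_cumulant_recursion[OF M Y, of n] m0 by (simp add: lessThan_Suc_atMost[symmetric])
  also have "(\<Sum>j<n. of_nat (n choose j) * (cumulant M Y (j + 1) * of_real (?m (n - j)))) =
      (\<Sum>j<n. complex_of_real (real (n choose j) * (K j * ?m (n - j))))"
    by (intro sum.cong) (auto simp: less)
  finally have "of_real (?m (Suc n)) =
      complex_of_real (\<Sum>j<n. real (n choose j) * (K j * ?m (n - j))) + cumulant M Y (Suc n)"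
    by simp
  moreover have "?m (Suc n) = (\<Sum>j<n. real (n choose j) * (K j * ?m (n - j))) + K n"
    using rec[of n] m0 by (simp add: lessThan_Suc_atMost[symmetric])
  ultimately show ?case by simp
qed

section \<open>Passing to the limit\<close>

lemma all_moments_sum:
  "prob_space M \<Longrightarrow> (\<And>i. i \<in> A \<Longrightarrow> all_moments M (Z i)) \<Longrightarrow> all_moments M (\<lambda>\<omega>. \<Sum>i\<in>A. Z i \<omega>)"
  by (induction A rule: infinite_finite_induct)
    (auto intro: all_moments_add prob_space.all_moments_const)

lemma all_moments_power:
  "prob_space M \<Longrightarrow> all_moments M Z \<Longrightarrow> all_moments M (\<lambda>\<omega>. Z \<omega> ^ n)"
  by (induction n) (auto intro: all_moments_mult prob_space.all_moments_const)

lemma all_moments_diff: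
  "prob_space M \<Longrightarrow> all_moments M Z \<Longrightarrow> all_moments M W \<Longrightarrow> all_moments M (\<lambda>\<omega>. Z \<omega> - W \<omega>)"
  using all_moments_add[of M Z "\<lambda>\<omega>. - 1 * W \<omega>"]
    all_moments_mult[OF prob_space.all_moments_const[of M "- 1"], of W] by simp

text \<open>
  By Fatou's lemma along an almost everywhere convergent subsequence, the limit inherits the bounds
  on the even moments.
\<close>

lemma all_moments_L2_limit:
  fixes F :: "'a \<Rightarrow> real"
  assumes M: "prob_space M" and F: "F \<in> borel_measurable M"
    and Fs: "\<And>k. all_moments M (Fs k)"
    and int: "\<And>k. integrable M (\<lambda>\<omega>. (F \<omega> - Fs k \<omega>)\<^sup>2)"
    and lim: "(\<lambda>k. LINT \<omega>|M. (F \<omega> - Fs k \<omega>)\<^sup>2) \<longlonglongrightarrow> 0"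
    and bound: "\<And>n. \<exists>B. \<forall>k. (LINT \<omega>|M. Fs k \<omega> ^ n) \<le> B"
  shows "all_moments M F"
proof -
  interpret prob_space M by fact
  note [measurable] = F
  have [measurable]: "Fs k \<in> borel_measurable M" for k using Fs by (simp add: all_moments_def)
  obtain r where r: "strict_mono (r :: nat \<Rightarrow> nat)" "AE \<omega> in M. (\<lambda>k. (F \<omega> - Fs (r k) \<omega>)\<^sup>2) \<longlonglongrightarrow> 0"
    using tendsto_L1_AE_subseq[of M "\<lambda>k \<omega>. (F \<omega> - Fs k \<omega>)\<^sup>2"] int lim by auto
  have "(\<lambda>k. Fs (r k) \<omega>) \<longlonglongrightarrow> F \<omega>" if "(\<lambda>k. (F \<omega> - Fs (r k) \<omega>)\<^sup>2) \<longlonglongrightarrow> 0" for \<omega>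
    using that tendsto_diff[OF tendsto_const[of "F \<omega>"], of "\<lambda>k. F \<omega> - Fs (r k) \<omega>" 0] by simp
  then have ae: "AE \<omega> in M. (\<lambda>k. Fs (r k) \<omega>) \<longlonglongrightarrow> F \<omega>"
    using r(2) by (auto elim: eventually_mono)
  have even: "integrable M (\<lambda>\<omega>. F \<omega> ^ (2 * n))" for n
  proof (rule integrableI_bounded)
    obtain B where B: "\<And>k. (LINT \<omega>|M. Fs k \<omega> ^ (2 * n)) \<le> B" using bound by blast
    have nonneg: "0 \<le> (x::real) ^ (2 * n)" for x by (simp add: power_mult)
    have "(\<integral>\<^sup>+ \<omega>. ennreal (norm (F \<omega> ^ (2 * n))) \<partial>M) =
        (\<integral>\<^sup>+ \<omega>. liminf (\<lambda>k. ennreal (Fs (r k) \<omega> ^ (2 * n))) \<partial>M)"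
    proof (rule nn_integral_cong_AE)
      show "AE \<omega> in M. ennreal (norm (F \<omega> ^ (2 * n))) = liminf (\<lambda>k. ennreal (Fs (r k) \<omega> ^ (2 * n)))"
        using ae
      proof (rule eventually_mono)
        fix \<omega> assume "(\<lambda>k. Fs (r k) \<omega>) \<longlonglongrightarrow> F \<omega>"
        then have "(\<lambda>k. ennreal (Fs (r k) \<omega> ^ (2 * n))) \<longlonglongrightarrow> ennreal (F \<omega> ^ (2 * n))"
          by (intro tendsto_ennrealI tendsto_power)
        from lim_imp_Liminf[OF sequentially_bot this]
        show "ennreal (norm (F \<omega> ^ (2 * n))) = liminf (\<lambda>k. ennreal (Fs (r k) \<omega> ^ (2 * n)))"
          using nonneg[of "F \<omega>"] by simp
      qed
    qed
    also have "\<dots> \<le> liminf (\<lambda>k. \<integral>\<^sup>+ \<omega>. ennreal (Fs (r k) \<omega> ^ (2 * n)) \<partial>M)"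
      by (rule nn_integral_liminf) measurable
    also have "\<dots> \<le> ennreal B"
    proof (rule order_trans[OF Liminf_le_Limsup Limsup_bounded])
      have "(\<integral>\<^sup>+ \<omega>. ennreal (Fs (r k) \<omega> ^ (2 * n)) \<partial>M) \<le> ennreal B" for k
        using Fs[of "r k"] B[of "r k"] nonneg
        by (subst nn_integral_eq_integral) (auto simp: all_moments_def intro!: ennreal_leI)
      then show "\<forall>\<^sub>F k in sequentially. (\<integral>\<^sup>+ \<omega>. ennreal (Fs (r k) \<omega> ^ (2 * n)) \<partial>M) \<le> ennreal B"
        by simp
    qed simp
    finally show "(\<integral>\<^sup>+ \<omega>. ennreal (norm (F \<omega> ^ (2 * n))) \<partial>M) < \<infinity>"
      using le_less_trans ennreal_less_top by (metis infinity_ennreal_def)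
  qed measurable
  have "integrable M (\<lambda>\<omega>. F \<omega> ^ n)" for n
  proof (rule Bochner_Integration.integrable_bound)
    show "integrable M (\<lambda>\<omega>. 1 + F \<omega> ^ (2 * n))" using even by simp
    have "\<bar>y\<bar> \<le> \<bar>1 + y\<^sup>2\<bar>" for y :: real
      using sum_squares_bound[of 1 "\<bar>y\<bar>"] by simp
    from this[of "F _ ^ n"] show "AE \<omega> in M. norm (F \<omega> ^ n) \<le> norm (1 + F \<omega> ^ (2 * n))"
      by (simp add: mult.commute flip: power_mult)
  qed measurable
  then show ?thesis by (simp add: all_moments_def)
qed

text \<open>
  \<open>F\<^sup>n - F\<^sub>k\<^sup>n = (F - F\<^sub>k) Q\<^sub>k\<close> where \<open>Q\<^sub>k\<close> is bounded in \<open>L\<^sup>2\<close>, by the bounds on the moments of the \<open>F\<^sub>k\<close>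
  and the moments of \<open>F\<close>.
\<close>

lemma moments_L2_limit:
  fixes F :: "'a \<Rightarrow> real"
  assumes M: "prob_space M" and F: "all_moments M F"
    and Fs: "\<And>k. all_moments M (Fs k)"
    and lim: "(\<lambda>k. LINT \<omega>|M. (F \<omega> - Fs k \<omega>)\<^sup>2) \<longlonglongrightarrow> 0"
    and bound: "\<And>n. \<exists>B. \<forall>k. (LINT \<omega>|M. Fs k \<omega> ^ n) \<le> B"
  shows "(\<lambda>k. LINT \<omega>|M. Fs k \<omega> ^ n) \<longlonglongrightarrow> (LINT \<omega>|M. F \<omega> ^ n)"
proof -
  interpret prob_space M by fact
  define D where "D k \<omega> = F \<omega> - Fs k \<omega>" for k \<omega>
  define Q where "Q k \<omega> = (\<Sum>i<n. Fs k \<omega> ^ (n - Suc i) * F \<omega> ^ i)" for k \<omega>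
  have D: "all_moments M (D k)" for k
    unfolding D_def by (intro all_moments_diff M F Fs)
  have Q: "all_moments M (Q k)" for k
    unfolding Q_def by (intro all_moments_sum all_moments_mult all_moments_power M F Fs)
  have DQ: "F \<omega> ^ n - Fs k \<omega> ^ n = D k \<omega> * Q k \<omega>" for k \<omega>
    unfolding D_def Q_def by (rule power_diff_sumr2)
  have int: "integrable M (\<lambda>\<omega>. Z \<omega> ^ m)" if "all_moments M Z" for Z m
    using that by (simp add: all_moments_def)
  obtain B where B: "\<And>m k. (LINT \<omega>|M. Fs k \<omega> ^ m) \<le> B m" using bound by metis
  define C where "C = real n * (\<Sum>i<n. B (4 * (n - Suc i)) + (LINT \<omega>|M. F \<omega> ^ (4 * i)))"
  have QC: "(LINT \<omega>|M. (Q k \<omega>)\<^sup>2) \<le> C" for k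
  proof -
    have "(Q k \<omega>)\<^sup>2 \<le> real n * (\<Sum>i<n. Fs k \<omega> ^ (4 * (n - Suc i)) + F \<omega> ^ (4 * i))" for \<omega>
    proof -
      have "(Q k \<omega>)\<^sup>2 \<le> (\<Sum>i<n. (Fs k \<omega> ^ (n - Suc i) * F \<omega> ^ i)\<^sup>2) * real (card {..<n})"
        unfolding Q_def by (rule sum_squared_le_sum_of_squares)
      also have "\<dots> \<le> (\<Sum>i<n. Fs k \<omega> ^ (4 * (n - Suc i)) + F \<omega> ^ (4 * i)) * real (card {..<n})"
      proof (intro mult_right_mono sum_mono)
        fix i
        have "(a * b)\<^sup>2 \<le> a ^ 4 + b ^ 4" for a b :: real
        proof -
          have "2 * (a\<^sup>2 * b\<^sup>2) \<le> (a\<^sup>2)\<^sup>2 + (b\<^sup>2)\<^sup>2" "0 \<le> a\<^sup>2 * b\<^sup>2"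
            using sum_squares_bound[of "a\<^sup>2" "b\<^sup>2"] by (simp_all add: mult.assoc)
          moreover have "(a\<^sup>2)\<^sup>2 = a ^ 4" "(b\<^sup>2)\<^sup>2 = b ^ 4" by (simp_all flip: power_mult)
          ultimately show ?thesis unfolding power_mult_distrib by linarith
        qed
        from this[of "Fs k \<omega> ^ (n - Suc i)" "F \<omega> ^ i"]
        show "(Fs k \<omega> ^ (n - Suc i) * F \<omega> ^ i)\<^sup>2 \<le> Fs k \<omega> ^ (4 * (n - Suc i)) + F \<omega> ^ (4 * i)"
          by (simp add: mult.commute flip: power_mult)
      qed simp
      finally show ?thesis by (simp add: mult.commute)
    qed
    then have "(LINT \<omega>|M. (Q k \<omega>)\<^sup>2) \<le> (LINT \<omega>|M. real n * (\<Sum>i<n. Fs k \<omega> ^ (4 * (n - Suc i)) + F \<omega> ^ (4 * i)))"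
      by (intro integral_mono int Q integrable_mult_right Bochner_Integration.integrable_sum
          Bochner_Integration.integrable_add F Fs)
    also have "\<dots> = real n * (\<Sum>i<n. (LINT \<omega>|M. Fs k \<omega> ^ (4 * (n - Suc i))) + (LINT \<omega>|M. F \<omega> ^ (4 * i)))"
      using int F Fs by (simp add: Bochner_Integration.integral_sum Bochner_Integration.integral_add)
    also have "\<dots> \<le> C"
      unfolding C_def by (intro mult_left_mono sum_mono add_right_mono B) simp
    finally show ?thesis .
  qed
  define \<delta> where "\<delta> k = (LINT \<omega>|M. (D k \<omega>)\<^sup>2)" for k
  \<comment> \<open>The weight \<open>s k\<close> in \<open>\<bar>D Q\<bar> \<le> D\<^sup>2 / (2 s) + s Q\<^sup>2 / 2\<close> must be positive and tend to \<open>0\<close>, but dominate \<open>sqrt (\<delta> k)\<close>.\<close>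
  define s where "s k = sqrt (\<delta> k) + 1 / (real k + 1)" for k
  have \<delta>0: "0 \<le> \<delta> k" for k unfolding \<delta>_def by simp
  have s0: "0 < s k" for k unfolding s_def using \<delta>0[of k] by (intro add_nonneg_pos) auto
  have le: "norm ((LINT \<omega>|M. F \<omega> ^ n) - (LINT \<omega>|M. Fs k \<omega> ^ n)) \<le> s k * (1 + C) / 2" for k
  proof -
    have "(LINT \<omega>|M. F \<omega> ^ n) - (LINT \<omega>|M. Fs k \<omega> ^ n) = (LINT \<omega>|M. D k \<omega> * Q k \<omega>)"
      unfolding DQ[symmetric] using int F Fs by simp
    also have "norm \<dots> \<le> (LINT \<omega>|M. norm (D k \<omega> * Q k \<omega>))" by (rule integral_norm_bound)
    also have "\<dots> \<le> (LINT \<omega>|M. (D k \<omega>)\<^sup>2 / (2 * s k) + s k / 2 * (Q k \<omega>)\<^sup>2)"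
    proof (rule integral_mono)
      show "integrable M (\<lambda>\<omega>. norm (D k \<omega> * Q k \<omega>))"
        using all_moments_mult[OF D Q] by (intro integrable_norm all_moments_integrable)
      show "integrable M (\<lambda>\<omega>. (D k \<omega>)\<^sup>2 / (2 * s k) + s k / 2 * (Q k \<omega>)\<^sup>2)"
        using int D Q by simp
      have "\<bar>a * b\<bar> \<le> a\<^sup>2 / (2 * t) + t / 2 * b\<^sup>2" if "0 < t" for a b t :: real
      proof -
        have "2 * \<bar>a\<bar> * (t * \<bar>b\<bar>) \<le> a\<^sup>2 + t\<^sup>2 * b\<^sup>2"
          using sum_squares_bound[of "\<bar>a\<bar>" "t * \<bar>b\<bar>"] by (simp add: power_mult_distrib)
        then show ?thesis using that by (simp add: abs_mult field_simps power2_eq_square)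
      qed
      then show "norm (D k \<omega> * Q k \<omega>) \<le> (D k \<omega>)\<^sup>2 / (2 * s k) + s k / 2 * (Q k \<omega>)\<^sup>2" for \<omega>
        using s0 by simp
    qed
    also have "\<dots> = \<delta> k / (2 * s k) + s k / 2 * (LINT \<omega>|M. (Q k \<omega>)\<^sup>2)"
      unfolding \<delta>_def using int D Q by simp
    also have "\<delta> k / (2 * s k) \<le> s k / 2"
    proof -
      have "sqrt (\<delta> k) \<le> s k" by (simp add: s_def)
      then have "(sqrt (\<delta> k))\<^sup>2 \<le> (s k)\<^sup>2" using \<delta>0 by (intro power_mono) auto
      then show ?thesis using \<delta>0[of k] s0[of k] by (simp add: field_simps power2_eq_square)
    qed
    also have "s k / 2 * (LINT \<omega>|M. (Q k \<omega>)\<^sup>2) \<le> s k / 2 * C"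
      using QC[of k] s0[of k] by (intro mult_left_mono) auto
    finally show ?thesis by (simp add: algebra_simps)
  qed
  have "(\<lambda>k. sqrt (\<delta> k)) \<longlonglongrightarrow> 0"
    using tendsto_real_sqrt[OF lim] by (simp add: \<delta>_def D_def)
  moreover have "(\<lambda>k. 1 / (real k + 1)) \<longlonglongrightarrow> 0"
    using LIMSEQ_inverse_real_of_nat by (simp add: inverse_eq_divide add.commute)
  ultimately have "(\<lambda>k. s k) \<longlonglongrightarrow> 0 + 0" unfolding s_def by (rule tendsto_add)
  then have "(\<lambda>k. s k * (1 + C) / 2) \<longlonglongrightarrow> 0" by (intro tendsto_eq_intros) auto
  then have "(\<lambda>k. (LINT \<omega>|M. F \<omega> ^ n) - (LINT \<omega>|M. Fs k \<omega> ^ n)) \<longlonglongrightarrow> 0"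
    by (rule Lim_null_comparison[rotated]) (intro always_eventually allI le)
  from tendsto_diff[OF tendsto_const[of "LINT \<omega>|M. F \<omega> ^ n"] this] show ?thesis by simp
qed

section \<open>Approximation of a multiple integral\<close>

lemma sym_tensor_lincomb:
  assumes f: "f \<in> sym_tensor_power E q" and g: "g \<in> sym_tensor_power E q"
  shows "(\<lambda>xs. a * f xs + b * g xs) \<in> sym_tensor_power E q"
proof -
  have lin: "linear (\<lambda>x. a * f (xs[i := x]) + b * g (xs[i := x]))" if "length xs = q" "i < q" for xs i
  proof -
    have "linear (\<lambda>x. f (xs[i := x]))" "linear (\<lambda>x. g (xs[i := x]))"
      using f g that by (auto simp: sym_tensor_power_def tensor_power_def bounded_multilinear_def)
    from linear_compose_add[OF linear_compose_scale_right[OF this(1), of a]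
        linear_compose_scale_right[OF this(2), of b]]
    show ?thesis by simp
  qed
  obtain C C' where C: "\<And>xs. length xs = q \<Longrightarrow> \<bar>f xs\<bar> \<le> C * prod_list (map norm xs)"
    "\<And>xs. length xs = q \<Longrightarrow> \<bar>g xs\<bar> \<le> C' * prod_list (map norm xs)"
    using f g unfolding sym_tensor_power_def tensor_power_def bounded_multilinear_def by blast
  have "\<bar>a * f xs + b * g xs\<bar> \<le> (\<bar>a\<bar> * C + \<bar>b\<bar> * C') * prod_list (map norm xs)" if "length xs = q" for xs
  proof -
    have "\<bar>a * f xs + b * g xs\<bar> \<le> \<bar>a\<bar> * \<bar>f xs\<bar> + \<bar>b\<bar> * \<bar>g xs\<bar>"
      by (metis abs_mult abs_triangle_ineq)
    also have "\<dots> \<le> \<bar>a\<bar> * (C * prod_list (map norm xs)) + \<bar>b\<bar> * (C' * prod_list (map norm xs))"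
      using C that by (intro add_mono mult_left_mono) auto
    finally show ?thesis by (simp add: algebra_simps)
  qed
  moreover have "sq_summable E q (\<lambda>xs. a * f xs + b * g xs)"
  proof (rule sq_summable_mono)
    show "sq_summable E q f" "sq_summable E q g"
      using f g by (auto simp: sym_tensor_power_def tensor_power_def sq_summable_def)
    show "(a * f es + b * g es)\<^sup>2 \<le> (2 * a\<^sup>2) * (f es)\<^sup>2 + (2 * b\<^sup>2) * (g es)\<^sup>2" for es
      using sum_sq_le[of "a * f es" "b * g es"] by (simp add: power_mult_distrib)
  qed
  moreover have "a * f xs + b * g xs = 0" if "length xs \<noteq> q" for xs
    using f g that by (simp add: sym_tensor_power_def tensor_power_def)
  moreover have "f (permute_list \<pi> xs) = f xs" "g (permute_list \<pi> xs) = g xs"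
    if "\<pi> permutes {..<q}" "length xs = q" for \<pi> xs
    using f g that by (auto simp: sym_tensor_power_def)
  ultimately show ?thesis
    unfolding sym_tensor_power_def tensor_power_def bounded_multilinear_def sq_summable_def
    using lin by (intro CollectI conjI allI impI) (auto intro!: exI[of _ "\<bar>a\<bar> * C + \<bar>b\<bar> * C'"])
qed

lemma elem_power_sym_tensor:
  fixes E :: "'h::real_inner set"
  assumes E: "complete_orthonormal E"
  shows "elem_power q h \<in> sym_tensor_power E q"
proof -
  have lin: "linear (\<lambda>x. elem_power q h (xs[i := x]))" if "length xs = q" "i < q" for xs i
  proof -
    define c where "c = (\<Prod>x\<leftarrow>take i xs. inner h x) * (\<Prod>x\<leftarrow>drop (Suc i) xs. inner h x)"
    have "elem_power q h (xs[i := x]) = c * inner h x" for x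
      using that by (simp add: elem_power_def c_def upd_conv_take_nth_drop mult_ac)
    then show ?thesis
      using linear_compose_scale_right[OF bounded_linear.linear[OF bounded_linear_inner_right[of h]], of c] by simp
  qed
  have "\<bar>\<Prod>x\<leftarrow>xs. inner h x\<bar> \<le> norm h ^ length xs * prod_list (map norm xs)" for xs
  proof (induction xs)
    case (Cons x xs)
    have "\<bar>inner h x\<bar> * \<bar>\<Prod>x\<leftarrow>xs. inner h x\<bar> \<le> (norm h * norm x) * (norm h ^ length xs * prod_list (map norm xs))"
      by (intro mult_mono Cauchy_Schwarz_ineq2 Cons.IH) auto
    then show ?case by (simp add: abs_mult mult_ac)
  qed simp
  then have "\<bar>elem_power q h xs\<bar> \<le> norm h ^ q * prod_list (map norm xs)" if "length xs = q" for xs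
    using that by (auto simp: elem_power_def)
  then have bd: "\<exists>C. \<forall>xs. length xs = q \<longrightarrow> \<bar>elem_power q h xs\<bar> \<le> C * prod_list (map norm xs)" by blast
  have "(\<lambda>es. elementary (replicate q h) es * elementary (replicate q h) es) summable_on tuples E q"
    using has_sum_imp_summable[OF parseval_elementary[OF E refl, of "replicate q h"]] by simp
  moreover have "(elem_power q h es)\<^sup>2 = elementary (replicate q h) es * elementary (replicate q h) es"
    if "es \<in> tuples E q" for es
    using that elementary_replicate[of es h] by (simp add: tuples_def elem_power_def power2_eq_square)
  ultimately have "(\<lambda>es. (elem_power q h es)\<^sup>2) summable_on tuples E q"
    by (simp cong: summable_on_cong)
  moreover have "elem_power q h (permute_list \<pi> xs) = elem_power q h xs"
    if "\<pi> permutes {..<q}" "length xs = q" for \<pi> xs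
    using that by (simp add: elem_power_def flip: prod_mset_prod_list)
  ultimately show ?thesis
    using lin bd
    by (auto simp: sym_tensor_power_def tensor_power_def bounded_multilinear_def elem_power_def[of q h])
qed

lemma sq_norm_eq_tensor_norm: "sq_norm E q g = (tensor_norm E q g)\<^sup>2"
proof -
  have "tensor_inner E q g g = sq_norm E q g"
    by (simp add: tensor_inner_def sq_norm_def power2_eq_square)
  then show ?thesis using sq_norm_nonneg[of E q g] by (simp add: tensor_norm_def)
qed

lemma hermite_tensor_insert:
  assumes "finite S" "h \<notin> S"
  shows "hermite_tensor (insert h S) c q = (\<lambda>xs. c h * elem_power q h xs + 1 * hermite_tensor S c q xs)"
  using assms by (simp add: hermite_tensor_def)

lemma hermite_tensor_sym_tensor:
  fixes E S :: "'h::real_inner set"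
  assumes E: "complete_orthonormal E" and S: "finite S"
  shows "hermite_tensor S c q \<in> sym_tensor_power E q"
  using S
proof (induction S rule: finite_induct)
  case empty
  have "hermite_tensor {} c q = (\<lambda>xs. 0 * elem_power q 0 xs + 0 * elem_power q (0::'h) xs)"
    by (simp add: hermite_tensor_def)
  then show ?case using sym_tensor_lincomb[OF elem_power_sym_tensor[OF E] elem_power_sym_tensor[OF E]] by metis
next
  case (insert h S)
  then show ?case
    unfolding hermite_tensor_insert[OF insert.hyps]
    by (intro sym_tensor_lincomb elem_power_sym_tensor E)
qed

lemma multiple_integral_hermite_tensor:
  fixes X :: "'h::real_inner \<Rightarrow> 'a \<Rightarrow> real"
  assumes I: "multiple_integral M X E q I" and E: "complete_orthonormal E"
    and S: "finite S" "\<And>h. h \<in> S \<Longrightarrow> norm h = 1"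
  shows "AE \<omega> in M. I (hermite_tensor S c q) \<omega> = (\<Sum>h\<in>S. c h * hermite q (X h \<omega>))"
  using S
proof (induction S rule: finite_induct)
  case empty
  have "hermite_tensor {} c q = (\<lambda>xs. 0 * elem_power q 0 xs + 0 * elem_power q (0::'h) xs)"
    by (simp add: hermite_tensor_def)
  moreover have "AE \<omega> in M. I (\<lambda>xs. 0 * elem_power q 0 xs + 0 * elem_power q (0::'h) xs) \<omega> =
      0 * I (elem_power q 0) \<omega> + 0 * I (elem_power q 0) \<omega>"
    using I elem_power_sym_tensor[OF E] unfolding multiple_integral_def by blast
  ultimately show ?case by simp
next
  case (insert h S)
  have "AE \<omega> in M. I (hermite_tensor (insert h S) c q) \<omega> = c h * I (elem_power q h) \<omega> + 1 * I (hermite_tensor S c q) \<omega>"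
    using I elem_power_sym_tensor[OF E] hermite_tensor_sym_tensor[OF E insert.hyps(1)]
    unfolding multiple_integral_def hermite_tensor_insert[OF insert.hyps] by blast
  moreover have "AE \<omega> in M. I (elem_power q h) \<omega> = hermite q (X h \<omega>)"
    using I insert.prems unfolding multiple_integral_def by blast
  moreover have "AE \<omega> in M. I (hermite_tensor S c q) \<omega> = (\<Sum>h\<in>S. c h * hermite q (X h \<omega>))"
    using insert by blast
  ultimately show ?case
    by eventually_elim (simp add: insert.hyps)
qed

lemma multiple_integral_isometry:
  assumes I: "multiple_integral M X E q I" and f: "f \<in> sym_tensor_power E q"
  shows "(LINT \<omega>|M. (I f \<omega>)\<^sup>2) = fact q * sq_norm E q f"
proof -
  have "L2_norm M (I f) = sqrt (fact q) * tensor_norm E q f"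
    using I f unfolding multiple_integral_def by blast
  then have "(L2_norm M (I f))\<^sup>2 = (sqrt (fact q) * tensor_norm E q f)\<^sup>2" by simp
  then show ?thesis
    by (simp add: L2_norm_def power_mult_distrib sq_norm_eq_tensor_norm)
qed

text \<open>
  Finite sums \<open>\<Sum> c\<^sub>h h \<otimes> \<dots> \<otimes> h\<close> are dense in the symmetric tensors because their integrals are dense in the
  Wiener chaos by definition and the multiple integral is an isometry up to a factor.
\<close>

lemma multiple_integral_approximation:
  fixes X :: "'h::real_inner \<Rightarrow> 'a \<Rightarrow> real"
  assumes X: "isonormal_process M X" and E: "complete_orthonormal E"
    and I: "multiple_integral M X E q I" and f: "f \<in> sym_tensor_power E q"
  obtains S c where "\<And>k. finite (S k)" "\<And>k h. h \<in> S k \<Longrightarrow> norm h = 1"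
    "\<And>k. integrable M (\<lambda>\<omega>. (I f \<omega> - (\<Sum>h\<in>S k. c k h * hermite q (X h \<omega>)))\<^sup>2)"
    "(\<lambda>k. LINT \<omega>|M. (I f \<omega> - (\<Sum>h\<in>S k. c k h * hermite q (X h \<omega>)))\<^sup>2) \<longlonglongrightarrow> 0"
    "sq_tendsto E q (\<lambda>k. hermite_tensor (S k) (c k) q) f"
proof -
  interpret isonormal M X by (rule isonormal_processD[OF X])
  have chaos: "I f \<in> wiener_chaos M X q" using I f unfolding multiple_integral_def by blast
  define good where "good k p \<longleftrightarrow> finite (fst p) \<and> (\<forall>h\<in>fst p. norm h = 1) \<and>
      L2_norm M (\<lambda>\<omega>. I f \<omega> - (\<Sum>h\<in>fst p. snd p h * hermite q (X h \<omega>))) < 1 / (real k + 1)"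
    for k :: nat and p
  have "\<exists>p. good k p" for k
  proof -
    have "\<exists>S c. finite S \<and> (\<forall>h\<in>S. norm h = 1) \<and>
        L2_norm M (\<lambda>\<omega>. I f \<omega> - (\<Sum>h\<in>S. c h * hermite q (X h \<omega>))) < 1 / (real k + 1)"
      using chaos unfolding wiener_chaos_def by (auto dest!: spec[of _ "1 / (real k + 1)"])
    then show ?thesis by (auto simp: good_def)
  qed
  then obtain p where p: "\<forall>k. good k (p k)" using choice[of good] by blast
  define S c where "S k = fst (p k)" and "c k = snd (p k)" for k
  have S: "\<And>k. finite (S k)" "\<And>k h. h \<in> S k \<Longrightarrow> norm h = 1"
    and approx: "\<And>k. L2_norm M (\<lambda>\<omega>. I f \<omega> - (\<Sum>h\<in>S k. c k h * hermite q (X h \<omega>))) < 1 / (real k + 1)"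
    using p by (auto simp: good_def S_def c_def)
  define Fs where "Fs k \<omega> = (\<Sum>h\<in>S k. c k h * hermite q (X h \<omega>))" for k \<omega>
  define fs where "fs k = hermite_tensor (S k) (c k) q" for k
  have Fs: "all_moments M (Fs k)" for k
    using all_moments_polyfun[OF hermite_sum_polyfuns[of "S k" "c k" q]]
    by (simp add: hermite_sum_def Fs_def[abs_def] hermite_eq_poly)
  have fs: "fs k \<in> sym_tensor_power E q" for k
    unfolding fs_def by (rule hermite_tensor_sym_tensor[OF E S(1)])
  have F: "I f \<in> borel_measurable M" "integrable M (\<lambda>\<omega>. (I f \<omega>)\<^sup>2)"
    using chaos by (auto simp: wiener_chaos_def L2_def)
  have int: "integrable M (\<lambda>\<omega>. (I f \<omega> - Fs k \<omega>)\<^sup>2)" for k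
  proof (rule Bochner_Integration.integrable_bound)
    show "integrable M (\<lambda>\<omega>. 2 * (I f \<omega>)\<^sup>2 + 2 * (Fs k \<omega>)\<^sup>2)"
      using F(2) Fs by (simp add: all_moments_def)
    show "(\<lambda>\<omega>. (I f \<omega> - Fs k \<omega>)\<^sup>2) \<in> borel_measurable M"
      using F(1) Fs[of k] unfolding all_moments_def
      by (intro borel_measurable_power borel_measurable_diff) auto
    show "AE \<omega> in M. norm ((I f \<omega> - Fs k \<omega>)\<^sup>2) \<le> norm (2 * (I f \<omega>)\<^sup>2 + 2 * (Fs k \<omega>)\<^sup>2)"
      using diff_sq_le by simp
  qed
  have lim: "(\<lambda>k. LINT \<omega>|M. (I f \<omega> - Fs k \<omega>)\<^sup>2) \<longlonglongrightarrow> 0"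
  proof -
    have null: "(\<lambda>k. 1 / (real k + 1)) \<longlonglongrightarrow> 0"
      using LIMSEQ_inverse_real_of_nat by (simp add: inverse_eq_divide add.commute)
    have "(\<lambda>k. L2_norm M (\<lambda>\<omega>. I f \<omega> - Fs k \<omega>)) \<longlonglongrightarrow> 0"
      by (rule tendsto_sandwich[OF always_eventually always_eventually tendsto_const null])
        (auto simp: L2_norm_def Fs_def intro: less_imp_le approx[unfolded L2_norm_def])
    from tendsto_power[OF this, of 2] show ?thesis by (simp add: L2_norm_def)
  qed
  have dist: "(LINT \<omega>|M. (I f \<omega> - Fs k \<omega>)\<^sup>2) = fact q * sq_norm E q (\<lambda>xs. fs k xs - f xs)" for k
  proof -
    let ?d = "\<lambda>xs. 1 * f xs + - 1 * fs k xs"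
    have d: "?d \<in> sym_tensor_power E q" by (intro sym_tensor_lincomb f fs)
    have "AE \<omega> in M. I ?d \<omega> = 1 * I f \<omega> + - 1 * I (fs k) \<omega>"
      using I f fs unfolding multiple_integral_def by blast
    moreover have "AE \<omega> in M. I (fs k) \<omega> = Fs k \<omega>"
      unfolding fs_def Fs_def by (rule multiple_integral_hermite_tensor[OF I E S])
    ultimately have "AE \<omega> in M. (I f \<omega> - Fs k \<omega>)\<^sup>2 = (I ?d \<omega>)\<^sup>2"
      by eventually_elim simp
    moreover have "I ?d \<in> borel_measurable M"
      using I d unfolding multiple_integral_def wiener_chaos_def L2_def by blast
    ultimately have "(LINT \<omega>|M. (I f \<omega> - Fs k \<omega>)\<^sup>2) = (LINT \<omega>|M. (I ?d \<omega>)\<^sup>2)"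
      using F(1) Fs[of k] by (intro integral_cong_AE) (auto simp: all_moments_def)
    also have "\<dots> = fact q * sq_norm E q ?d" by (rule multiple_integral_isometry[OF I d])
    also have "sq_norm E q ?d = sq_norm E q (\<lambda>xs. fs k xs - f xs)"
      unfolding sq_norm_def by (intro infsum_cong) (simp add: power2_commute)
    finally show ?thesis .
  qed
  have "(\<lambda>k. sq_norm E q (\<lambda>xs. fs k xs - f xs)) \<longlonglongrightarrow> 0"
    using tendsto_divide[OF lim tendsto_const[of "fact q"]] by (simp add: dist)
  then have "sq_tendsto E q fs f"
    using f fs by (auto simp: sq_tendsto_def sym_tensor_power_def tensor_power_def sq_summable_def)
  then show ?thesis
    using that[of S c] S int lim unfolding Fs_def fs_def by blast
qed

text \<open>
  The moment recursion is stable under the approximation: the coefficients converge, hence, by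
  induction, so do the moments.
\<close>

lemma multiple_integral_moments:
  fixes X :: "'h::real_inner \<Rightarrow> 'a \<Rightarrow> real"
  assumes X: "isonormal_process M X" and E: "complete_orthonormal E" and q: "0 < q"
    and I: "multiple_integral M X E q I" and f: "f \<in> sym_tensor_power E q"
  shows "all_moments M (I f)"
    and "(LINT \<omega>|M. I f \<omega> ^ Suc n) = (\<Sum>j=1..n. fact n / fact (n - j) * path_sum E q f (j - 1) *
      (LINT \<omega>|M. I f \<omega> ^ (n - j)))"
proof -
  interpret isonormal M X by (rule isonormal_processD[OF X])
  obtain S c where S: "\<And>k. finite (S k)" "\<And>k h. h \<in> S k \<Longrightarrow> norm h = 1"
    and int: "\<And>k. integrable M (\<lambda>\<omega>. (I f \<omega> - (\<Sum>h\<in>S k. c k h * hermite q (X h \<omega>)))\<^sup>2)"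
    and lim: "(\<lambda>k. LINT \<omega>|M. (I f \<omega> - (\<Sum>h\<in>S k. c k h * hermite q (X h \<omega>)))\<^sup>2) \<longlonglongrightarrow> 0"
    and fs: "sq_tendsto E q (\<lambda>k. hermite_tensor (S k) (c k) q) f"
    by (rule multiple_integral_approximation[OF X E I f]) blast
  define Fs where "Fs k \<omega> = (\<Sum>h\<in>S k. c k h * hermite q (X h \<omega>))" for k \<omega>
  note int = int[folded Fs_def] and lim = lim[folded Fs_def]
  define m where "m k n = (LINT \<omega>|M. Fs k \<omega> ^ n)" for k n
  have Fs_eq: "Fs k = (\<lambda>\<omega>. hermite_sum (S k) (c k) q (\<lambda>h. X h \<omega>))" for k
    by (simp add: hermite_sum_def Fs_def[abs_def] hermite_eq_poly)
  have Fs: "all_moments M (Fs k)" for k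
    unfolding Fs_eq by (rule all_moments_polyfun[OF hermite_sum_polyfuns])
  have rec: "m k (Suc n) = (\<Sum>j=1..n. fact n / fact (n - j) *
      path_sum E q (hermite_tensor (S k) (c k) q) (j - 1) * m k (n - j))" for k n
    using hermite_sum_moment_recursion[OF E S q, where c = "c k" and n = n] by (simp add: m_def Fs_eq mean_of_def)
  note lim_path = path_sum_tendsto[OF fs q]
  have conv: "convergent (\<lambda>k. m k n)" for n
  proof (induction n rule: less_induct)
    case (less n)
    show ?case
    proof (cases n)
      case 0
      then show ?thesis by (simp add: m_def convergent_const)
    next
      case (Suc n')
      have "convergent (\<lambda>k. fact n' / fact (n' - j) *
          path_sum E q (hermite_tensor (S k) (c k) q) (j - 1) * m k (n' - j))" for j
      proof -
        have "convergent (\<lambda>k. m k (n' - j))" using less Suc by simp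
        moreover have "convergent (\<lambda>k. path_sum E q (hermite_tensor (S k) (c k) q) (j - 1))"
          using lim_path by (auto simp: convergent_def)
        ultimately show ?thesis by (intro convergent_mult convergent_const)
      qed
      then show ?thesis unfolding Suc rec by (intro convergent_sum)
    qed
  qed
  have bound: "\<exists>B. \<forall>k. (LINT \<omega>|M. Fs k \<omega> ^ n) \<le> B" for n
  proof -
    from convergent_imp_Bseq[OF conv[of n]] obtain B where "\<forall>k. norm (m k n) \<le> B"
      unfolding Bseq_def by blast
    then show ?thesis unfolding m_def real_norm_def abs_le_iff by blast
  qed
  have meas: "I f \<in> borel_measurable M"
    using I f unfolding multiple_integral_def wiener_chaos_def L2_def by blast
  show mom: "all_moments M (I f)"
    by (rule all_moments_L2_limit[OF prob_space_axioms meas Fs int lim bound])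
  have m_lim: "(\<lambda>k. m k n) \<longlonglongrightarrow> (LINT \<omega>|M. I f \<omega> ^ n)" for n
    unfolding m_def by (rule moments_L2_limit[OF prob_space_axioms mom Fs lim bound])
  have "(\<lambda>k. m k (Suc n)) \<longlonglongrightarrow> (\<Sum>j=1..n. fact n / fact (n - j) * path_sum E q f (j - 1) *
      (LINT \<omega>|M. I f \<omega> ^ (n - j)))"
    unfolding rec by (intro tendsto_sum tendsto_mult tendsto_const lim_path m_lim)
  then show "(LINT \<omega>|M. I f \<omega> ^ Suc n) = (\<Sum>j=1..n. fact n / fact (n - j) * path_sum E q f (j - 1) *
      (LINT \<omega>|M. I f \<omega> ^ (n - j)))"
    using m_lim[of "Suc n"] LIMSEQ_unique by blast
qed

section \<open>The cumulants of a multiple integral\<close>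

theorem theorem5p1:
  fixes M :: "'a measure"
    and X :: "'h::{real_inner, complete_space, second_countable_topology} \<Rightarrow> 'a \<Rightarrow> real"
    and E :: "'h set"
    and I :: "'h tensor \<Rightarrow> 'a \<Rightarrow> real"
    and f :: "'h tensor"
    and F :: "'a \<Rightarrow> real"
    and q :: nat
  assumes "isonormal_process M X"
    and "complete_orthonormal E"
    and "q \<ge> 2"
    and "multiple_integral M X E q I"
    and "f \<in> sym_tensor_power E q"
    and "F = I f"
  shows "cumulant M F 1 = 0 \<and>
    cumulant M F 2 = of_real (fact q * (tensor_norm E q f)\<^sup>2) \<and>
    (\<forall>s\<ge>3. cumulant M F s =
       of_real (fact q * fact (s - 1) *
         (\<Sum>r\<in>cumulant_indices q s.
            real (cumulant_coeff q r (s - 2)) *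
            tensor_inner E q (iterated_contraction E q f r (s - 2)) f)))"
proof -
  have q: "0 < q" using assms(3) by simp
  have M: "prob_space M" using assms(1) by (simp add: isonormal_process_def)
  note mom = multiple_integral_moments[OF assms(1,2) q assms(4,5), folded assms(6)]
  \<comment> \<open>The claimed value of the cumulant of order \<open>j + 1\<close>.\<close>
  define K where "K j = (if j = 0 then 0 else fact j * path_sum E q f (j - 1))" for j :: nat
  have cumulant: "cumulant M F (Suc n) = of_real (K n)" for n
  proof (rule cumulant_eqI[OF M mom(1)])
    fix n
    have "(\<Sum>j=1..n. fact n / fact (n - j) * path_sum E q f (j - 1) * (LINT \<omega>|M. F \<omega> ^ (n - j))) =
        (\<Sum>j=1..n. real (n choose j) * (K j * (LINT \<omega>|M. F \<omega> ^ (n - j))))"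
      by (intro sum.cong refl) (auto simp: K_def binomial_fact)
    also have "\<dots> = (\<Sum>j\<le>n. real (n choose j) * (K j * (LINT \<omega>|M. F \<omega> ^ (n - j))))"
      by (rule sum.mono_neutral_left) (auto simp: K_def)
    finally show "(LINT \<omega>|M. F \<omega> ^ Suc n) = (\<Sum>j\<le>n. real (n choose j) * (K j * (LINT \<omega>|M. F \<omega> ^ (n - j))))"
      using mom(2)[of n] by simp
  qed
  have "cumulant M F 1 = 0" using cumulant[of 0] by (simp add: K_def)
  moreover have "cumulant M F 2 = of_real (fact q * (tensor_norm E q f)\<^sup>2)"
  proof -
    have "{r \<in> contraction_paths q 0. tensor_order q r 0 = q} = {\<lambda>_. undefined}"
      by (auto simp: contraction_paths_0 tensor_order_0)
    then have "path_sum E q f 0 = fact q * tensor_inner E q f f" by (simp add: path_sum_def)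
    moreover have "tensor_inner E q f f = (tensor_norm E q f)\<^sup>2"
      using sq_norm_eq_tensor_norm[of E q f] by (simp add: tensor_inner_def sq_norm_def power2_eq_square)
    ultimately show ?thesis using cumulant[of 1] by (simp add: K_def numeral_2_eq_2)
  qed
  moreover have "cumulant M F s = of_real (fact q * fact (s - 1) *
         (\<Sum>r\<in>cumulant_indices q s. real (cumulant_coeff q r (s - 2)) *
            tensor_inner E q (iterated_contraction E q f r (s - 2)) f))" if "3 \<le> s" for s
  proof -
    have "K (s - 1) = fact q * fact (s - 1) *
         (\<Sum>r\<in>cumulant_indices q s. real (cumulant_coeff q r (s - 2)) *
            tensor_inner E q (iterated_contraction E q f r (s - 2)) f)"
      using that by (simp add: K_def path_sum_def cumulant_indices_eq[OF q that] numeral_2_eq_2)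
    then show ?thesis using cumulant[of "s - 1"] that by simp
  qed
  ultimately show ?thesis by blast
qed

end
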